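(* Let $M^n$ be a connected, compact, closed, smooth manifold of dimension $n$, equipped with a fixed smooth triangulation. Then there exist subsets $C^n, K^{n-1}\subset M^n$ such that $M^n = C^n \cup K^{n-1}$, $C^n\cap K^{n-1}=\emptyset$, where $C^n$ is an $n$-dimensional cell and $K^{n-1}$ is a union of some finite number of $(n-1)$-simplexes of the triangulation.
   Context: "Closed" means without boundary. An $n$-dimensional cell on $M^n$ is an (open) coordinate neighborhood homeomorphic to $\mathbb{R}^n$ (equivalently to the interior of the standard simplex $\Delta^n$), with the subspace topology. The standard simplex is $\Delta^l=\{x\in\mathbb{R}^l : 0\le x_i\le 1,\ x_1+\dots+x_l\le 1\}$. A singular $l$-simplex is the restriction to $\Delta^l$ of a smooth embedding of an open neighborhood of $\Delta^l$ in $\mathbb{R}^l$ into $M^n$; its image is also called a simplex. A smooth triangulation of $M^n$ consists of finite sets $\Phi^l$, $0\le l\le n$, of such maps $\varphi:\Delta^l\to M^n$ such that (a) $M^n$ is the disjoint union of the images $\varphi(\operatorname{Int}\Delta^l)$, $\varphi\in\Phi^l$, $0\le l\le n$; (b) if $\varphi\in\Phi^l$ then $\varphi\circ\varepsilon_i\in\Phi^{l-1}$ for every $i$, where $\varepsilon_i:\Delta^{l-1}\to\Delta^l$ is the linear map sending the vertices of $\Delta^{l-1}$ in order to the vertices $v_0,\dots,\hat v_i,\dots,v_l$ of $\Delta^l$. *)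

theory Defs
  imports "HOL-Analysis.Analysis"
begin

text \<open>
  The space \<open>\<real>\<^sup>d\<close> is the topology \<^term>\<open>Euclidean_space d\<close>, whose points are the
  \<open>x :: nat \<Rightarrow> real\<close> with \<open>x i = 0\<close> for all \<open>i \<ge> d\<close>.  The coordinates of a point are therefore
  numbered \<open>0, \<dots>, d - 1\<close>.
\<close>

subsection \<open>Smooth maps between open sets of Euclidean spaces\<close>

definition partial_deriv :: "nat \<Rightarrow> ((nat \<Rightarrow> real) \<Rightarrow> real) \<Rightarrow> (nat \<Rightarrow> real) \<Rightarrow> real" where
  "partial_deriv i f x = deriv (\<lambda>t. f (x(i := t))) (x i)"

text \<open>
  \<open>Ck_on d k U f\<close>: all partial derivatives of \<open>f\<close> of order at most \<open>k\<close> exist and are continuous on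
  \<open>U\<close>.  It is only meaningful for \<open>U\<close> open in \<open>\<real>\<^sup>d\<close>; then the values of \<open>f\<close> outside \<open>U\<close> are
  irrelevant.
\<close>

primrec Ck_on :: "nat \<Rightarrow> nat \<Rightarrow> (nat \<Rightarrow> real) set \<Rightarrow> ((nat \<Rightarrow> real) \<Rightarrow> real) \<Rightarrow> bool" where
  "Ck_on d 0 U f \<longleftrightarrow> continuous_map (subtopology (Euclidean_space d) U) euclideanreal f"
| "Ck_on d (Suc k) U f \<longleftrightarrow>
     continuous_map (subtopology (Euclidean_space d) U) euclideanreal f \<and>
     (\<forall>i<d. (\<forall>x\<in>U. (\<lambda>t. f (x(i := t))) differentiable (at (x i))) \<and>
            Ck_on d k U (partial_deriv i f))"

definition smooth_map_on ::
  "nat \<Rightarrow> nat \<Rightarrow> (nat \<Rightarrow> real) set \<Rightarrow> ((nat \<Rightarrow> real) \<Rightarrow> (nat \<Rightarrow> real)) \<Rightarrow> bool" where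
  "smooth_map_on d e U F \<longleftrightarrow> (\<forall>i<e. \<forall>k. Ck_on d k U (\<lambda>x. F x i))"

subsection \<open>Smooth manifolds\<close>

text \<open>A chart is a pair of its domain and its coordinate map.  The coordinate map is a total
  function whose values outside the domain are arbitrary.\<close>

type_synonym 'a chart = "'a set \<times> ('a \<Rightarrow> nat \<Rightarrow> real)"

definition is_chart :: "nat \<Rightarrow> 'a topology \<Rightarrow> 'a chart \<Rightarrow> bool" where
  "is_chart n M = (\<lambda>(U, h).
     openin M U \<and> openin (Euclidean_space n) (h ` U) \<and>
     homeomorphic_map (subtopology M U) (subtopology (Euclidean_space n) (h ` U)) h)"

definition smooth_transition :: "nat \<Rightarrow> 'a chart \<Rightarrow> 'a chart \<Rightarrow> bool" where
  "smooth_transition n = (\<lambda>(U, h) (V, k). smooth_map_on n n (h ` (U \<inter> V)) (k \<circ> inv_into U h))"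

definition smooth_compatible :: "nat \<Rightarrow> 'a chart \<Rightarrow> 'a chart \<Rightarrow> bool" where
  "smooth_compatible n c c' \<longleftrightarrow> smooth_transition n c c' \<and> smooth_transition n c' c"

definition smooth_structure :: "nat \<Rightarrow> 'a topology \<Rightarrow> 'a chart set \<Rightarrow> bool" where
  "smooth_structure n M \<A> \<longleftrightarrow>
     (\<forall>c\<in>\<A>. is_chart n M c) \<and>
     topspace M = (\<Union>c\<in>\<A>. fst c) \<and>
     (\<forall>c\<in>\<A>. \<forall>c'\<in>\<A>. smooth_compatible n c c') \<and>
     (\<forall>c. is_chart n M c \<and> (\<forall>c'\<in>\<A>. smooth_compatible n c c') \<longrightarrow> c \<in> \<A>)"

text \<open>All charts map onto open subsets of \<open>\<real>\<^sup>n\<close>, never of a half-space, so the manifolds below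
  have no boundary.\<close>

definition smooth_manifold :: "nat \<Rightarrow> 'a topology \<Rightarrow> 'a chart set \<Rightarrow> bool" where
  "smooth_manifold n M \<A> \<longleftrightarrow>
     Hausdorff_space M \<and>
     (\<exists>\<B>. countable \<B> \<and> (\<forall>V\<in>\<B>. openin M V) \<and>
          (\<forall>U x. openin M U \<and> x \<in> U \<longrightarrow> (\<exists>V\<in>\<B>. x \<in> V \<and> V \<subseteq> U))) \<and>
     smooth_structure n M \<A>"

text \<open>A smooth embedding of an open set \<open>U\<close> of \<open>\<real>\<^sup>l\<close> is a smooth immersion that is a
  homeomorphism onto its image.  The last clause says that the Jacobian matrix of \<open>f\<close> in each
  chart has trivial kernel.\<close>

definition smooth_embedding ::
  "nat \<Rightarrow> nat \<Rightarrow> 'a topology \<Rightarrow> 'a chart set \<Rightarrow> (nat \<Rightarrow> real) set \<Rightarrow> ((nat \<Rightarrow> real) \<Rightarrow> 'a) \<Rightarrow> bool"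
where
  "smooth_embedding l n M \<A> U f \<longleftrightarrow>
     embedding_map (subtopology (Euclidean_space l) U) M f \<and>
     (\<forall>(V, h)\<in>\<A>. smooth_map_on l n (U \<inter> f -` V) (h \<circ> f) \<and>
        (\<forall>x\<in>U \<inter> f -` V. \<forall>v :: nat \<Rightarrow> real.
           (\<forall>i<n. (\<Sum>j<l. partial_deriv j (\<lambda>y. h (f y) i) x * v j) = 0) \<longrightarrow> (\<forall>j<l. v j = 0)))"

definition cell :: "nat \<Rightarrow> 'a topology \<Rightarrow> 'a chart set \<Rightarrow> 'a set \<Rightarrow> bool" where
  "cell n M \<A> C \<longleftrightarrow> (\<exists>h. (C, h) \<in> \<A>) \<and> subtopology M C homeomorphic_space Euclidean_space n"

subsection \<open>Smooth triangulations\<close>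

definition std_simplex :: "nat \<Rightarrow> (nat \<Rightarrow> real) set" where
  "std_simplex l = {x \<in> topspace (Euclidean_space l).
     (\<forall>i<l. 0 \<le> x i \<and> x i \<le> 1) \<and> (\<Sum>i<l. x i) \<le> 1}"

text \<open>The vertices of \<open>\<Delta>\<^sup>l\<close> in order: \<open>v\<^sub>0\<close> is the origin, and \<open>v\<^sub>j\<close> is the \<open>j\<close>-th standard basis
  vector for \<open>1 \<le> j \<le> l\<close>.\<close>

definition vertex :: "nat \<Rightarrow> nat \<Rightarrow> real" where
  "vertex j = (\<lambda>k. if j = Suc k then 1 else 0)"

text \<open>\<open>face_map l i\<close> is the affine map \<open>\<epsilon>\<^sub>i : \<Delta>\<^sup>l \<rightarrow> \<Delta>\<^sup>l\<^sup>+\<^sup>1\<close> omitting the vertex \<open>v\<^sub>i\<close>.  It is written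
  via the barycentric coordinates \<open>1 - \<Sum> x\<close>, \<open>x 0\<close>, \dots, \<open>x (l - 1)\<close> of a point \<open>x\<close>.\<close>

definition skip :: "nat \<Rightarrow> nat \<Rightarrow> nat" where
  "skip i j = (if j < i then j else Suc j)"

definition face_map :: "nat \<Rightarrow> nat \<Rightarrow> (nat \<Rightarrow> real) \<Rightarrow> (nat \<Rightarrow> real)" where
  "face_map l i x =
     (\<lambda>k. (1 - (\<Sum>j<l. x j)) * vertex (skip i 0) k + (\<Sum>j<l. x j * vertex (skip i (Suc j)) k))"

lemma face_map_vertex:
  assumes "j \<le> l"
  shows "face_map l i (vertex j) = vertex (skip i j)"
proof (cases j)
  case 0
  then show ?thesis by (simp add: face_map_def vertex_def)
next
  case (Suc m)
  with assms have "m < l" by simp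
  have "(\<Sum>a<l. vertex j a * g a) = g m" for g :: "nat \<Rightarrow> real"
    using \<open>m < l\<close> Suc by (simp add: vertex_def if_distrib [of "\<lambda>t. t * _"] sum.delta cong: if_cong)
  from this [of "\<lambda>_. 1"] this show ?thesis
    by (simp add: face_map_def Suc)
qed

text \<open>Singular simplices are maps with domain \<open>\<Delta>\<^sup>l\<close>.  They are represented as extensional functions,
  so that equality of simplices is equality on \<open>\<Delta>\<^sup>l\<close>.\<close>

definition smooth_simplex ::
  "nat \<Rightarrow> nat \<Rightarrow> 'a topology \<Rightarrow> 'a chart set \<Rightarrow> ((nat \<Rightarrow> real) \<Rightarrow> 'a) \<Rightarrow> bool" where
  "smooth_simplex l n M \<A> \<phi> \<longleftrightarrow>
     (\<exists>U f. openin (Euclidean_space l) U \<and> std_simplex l \<subseteq> U \<and>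
            smooth_embedding l n M \<A> U f \<and> \<phi> = restrict f (std_simplex l))"

definition smooth_triangulation ::
  "nat \<Rightarrow> 'a topology \<Rightarrow> 'a chart set \<Rightarrow> (nat \<Rightarrow> ((nat \<Rightarrow> real) \<Rightarrow> 'a) set) \<Rightarrow> bool" where
  "smooth_triangulation n M \<A> \<Phi> \<longleftrightarrow>
     (\<forall>l\<le>n. finite (\<Phi> l) \<and> (\<forall>\<phi>\<in>\<Phi> l. smooth_simplex l n M \<A> \<phi>)) \<and>
     topspace M = (\<Union>l\<le>n. \<Union>\<phi>\<in>\<Phi> l. \<phi> ` (Euclidean_space l interior_of std_simplex l)) \<and>
     disjoint_family_on (\<lambda>(l, \<phi>). \<phi> ` (Euclidean_space l interior_of std_simplex l))
       (SIGMA l:{..n}. \<Phi> l) \<and>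
     (\<forall>l<n. \<forall>\<phi>\<in>\<Phi> (Suc l). \<forall>i\<le>Suc l. restrict (\<phi> \<circ> face_map l i) (std_simplex l) \<in> \<Phi> l)"

definition simplexes :: "(nat \<Rightarrow> ((nat \<Rightarrow> real) \<Rightarrow> 'a) set) \<Rightarrow> nat \<Rightarrow> 'a set set" where
  "simplexes \<Phi> l = {\<phi> ` std_simplex l | \<phi>. \<phi> \<in> \<Phi> l}"

end

theory Submission
  imports Defs "HOL-Homology.Invariance_of_Domain" "Jordan_Normal_Form.Determinant"
begin

text \<open>
  Call two \<open>n\<close>-simplices adjacent if they have a common facet.  The cell is the union of all open
  \<open>n\<close>-simplices and of the open facets that correspond to the edges of a spanning tree of the
  adjacency graph; its complement is the union of the remaining closed facets.

  The spanning tree exists because the adjacency graph is connected (\<open>adjacent_simplex\<close>).  If it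
  split into two parts, the unions \<open>X\<close> and \<open>Y\<close> of their closed simplices would cover \<open>M\<close> and
  meet, by connectedness, but only inside the skeleton of codimension two.  Near a common point
  choose \<open>r\<close> in an open simplex of \<open>Y\<close>.  The cone with apex \<open>r\<close> over the skeleton has dimension at
  most \<open>n - 1\<close>, so some segment from \<open>r\<close> to an open simplex of \<open>X\<close> avoids the skeleton, although
  it passes from \<open>Y\<close> to \<open>X\<close>.  Here dimension is measured by counting cubes: a set is \<open>thin\<close> of
  dimension \<open>m\<close> if \<open>O(N^m)\<close> cubes of side \<open>1/N\<close> cover it, and an open set of \<open>\<real>\<^sup>n\<close> is not thin of
  any dimension below \<open>n\<close> (\<open>not_thin_open\<close>).  The same count shows that the closed \<open>n\<close>-simplices
  cover \<open>M\<close> (\<open>top_simplices_cover\<close>).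

  The tree is built up one simplex at a time.  Suppose \<open>C\<close> is the cell so far and \<open>\<tau>\<close> is a new
  simplex, with a facet \<open>F\<close> in common with an old one.  A collar of the open facet in \<open>C\<close>,
  thinner and thinner towards the boundary of \<open>F\<close>, is stretched over the open facet and all of the
  open simplex \<open>\<tau>\<close> by a diffeomorphism that is the identity near the far end of the collar.
  Extended by the identity it becomes a diffeomorphism from \<open>C\<close> to the enlarged cell, so that a chart
  of \<open>C\<close> is turned into a chart of the enlarged cell with the same image (\<open>grow_cell\<close>).  This
  image is an open simplex throughout, hence homeomorphic to \<open>\<real>\<^sup>n\<close>.  The extension is smooth because
  the collar accumulates only at the boundary of \<open>\<tau>\<close>, which is disjoint from \<open>C\<close>.  A collar with
  an explicit smooth thickness exists because the change of coordinates between the two simplices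
  is Lipschitz along \<open>F\<close> (\<open>facet_collar\<close>).

  That the complement is a union of facets is an invariant of the construction: each point of a
  used simplex outside the cell lies on a facet that misses the cell (\<open>partial_cell_extend\<close>).

  Two analytic facts enter.  The inverse function theorem (\<open>inverse_map_smooth\<close>), with openness
  of the image taken from invariance of domain, makes the inverse of a smoothly embedded
  \<open>n\<close>-simplex a chart of the maximal atlas (\<open>embedding_chart\<close>).  Charts that agree on overlaps
  glue (\<open>chart_glue\<close>), which reduces smoothness of the new chart to the collar and its
  complement.
\<close>

section \<open>Euclidean space as a set of sequences\<close>

definition ES :: "nat \<Rightarrow> (nat \<Rightarrow> real) set" where
  "ES d = {x. \<forall>i\<ge>d. x i = 0}"

lemma ES_iff: "x \<in> ES d \<longleftrightarrow> (\<forall>i\<ge>d. x i = 0)"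
  by (simp add: ES_def)

lemma topspace_ES [simp]: "topspace (Euclidean_space d) = ES d"
  by (simp add: topspace_Euclidean_space ES_def)

text \<open>
  The topology of \<open>Euclidean_space d\<close> is the one that the type \<open>nat \<Rightarrow> real\<close> carries as a product, so
  that \<open>continuous_on\<close>, \<open>tendsto\<close> and \<open>compact\<close> of the type class apply to it.
\<close>

lemma Euclidean_space_top_of_set: "Euclidean_space d = top_of_set (ES d)"
  by (simp add: Euclidean_space_def ES_def euclidean_product_topology)

lemma openin_ES_iff: "openin (Euclidean_space d) U \<longleftrightarrow> (\<exists>T. open T \<and> U = ES d \<inter> T)"
  by (simp add: Euclidean_space_top_of_set openin_open)

lemma openin_ES_subset: "openin (Euclidean_space d) U \<Longrightarrow> U \<subseteq> ES d"
  using openin_subset by fastforce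

lemma subtopology_ES: "U \<subseteq> ES d \<Longrightarrow> subtopology (Euclidean_space d) U = top_of_set U"
  by (metis Euclidean_space_top_of_set inf.absorb_iff2 subtopology_subtopology)

lemma continuous_map_ES_real:
  "U \<subseteq> ES d \<Longrightarrow> continuous_map (subtopology (Euclidean_space d) U) euclideanreal f \<longleftrightarrow> continuous_on U f"
  by (simp add: subtopology_ES)

lemma continuous_map_ES_ES:
  "U \<subseteq> ES d \<Longrightarrow> continuous_map (subtopology (Euclidean_space d) U) (Euclidean_space e) f
     \<longleftrightarrow> continuous_on U f \<and> f ` U \<subseteq> ES e"
  by (simp only: subtopology_ES Euclidean_space_top_of_set[of e] continuous_map_in_subtopology)
     (auto simp: image_subset_iff_funcset)

lemma continuous_on_fun_upd [continuous_intros]: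
  fixes x :: "nat \<Rightarrow> real"
  shows "continuous_on S (\<lambda>t. x(i := t))"
proof (rule continuous_on_coordinatewise_then_product)
  show "continuous_on S (\<lambda>t. (x(i := t)) j)" for j
    by (cases "j = i") (auto intro: continuous_intros)
qed

lemma tendsto_funI:
  fixes X :: "'a \<Rightarrow> nat \<Rightarrow> real"
  assumes "\<And>i. tendsto (\<lambda>t. X t i) (l i) F"
  shows "tendsto X l F"
proof -
  have "limitin (powertop_real UNIV) X l F"
    using assms by (auto simp: limitin_componentwise)
  then show ?thesis by (simp add: euclidean_product_topology)
qed

lemma ES_fun_upd: "x \<in> ES d \<Longrightarrow> i < d \<Longrightarrow> x(i := t) \<in> ES d"
  by (auto simp: ES_iff)

lemma eventually_fun_upd:
  assumes "openin (Euclidean_space d) U" "x \<in> U" "i < d"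
  shows "\<forall>\<^sub>F t in nhds (x i). x(i := t) \<in> U"
proof -
  obtain T where T: "open T" "U = ES d \<inter> T" using assms openin_ES_iff by blast
  have "open ((\<lambda>t. x(i := t)) -` T)"
    using T by (intro open_vimage continuous_intros)
  moreover have "x i \<in> (\<lambda>t. x(i := t)) -` T" using assms T by auto
  ultimately have "\<forall>\<^sub>F t in nhds (x i). x(i := t) \<in> T"
    by (auto simp: eventually_nhds)
  then show ?thesis
    by (rule eventually_mono) (use assms T in \<open>auto intro: ES_fun_upd\<close>)
qed

lemma open_fun_box:
  fixes T :: "(nat \<Rightarrow> real) set"
  assumes "open T" "x \<in> T"
  shows "\<exists>e>0. \<exists>n. \<forall>y. (\<forall>i<n. \<bar>y i - x i\<bar> < e) \<longrightarrow> y \<in> T"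
proof -
  have "openin (product_topology (\<lambda>i. euclidean) UNIV) T"
    using assms(1) by (simp add: euclidean_product_topology)
  then obtain X where X: "x \<in> Pi\<^sub>E UNIV X" "\<And>i. openin euclideanreal (X i)"
    "finite {i. X i \<noteq> topspace euclideanreal}" "Pi\<^sub>E UNIV X \<subseteq> T"
    using product_topology_open_contains_basis [of "\<lambda>i. euclideanreal" UNIV T x] assms(2) by blast
  have "\<exists>e>0. \<forall>t. \<bar>t - x i\<bar> < e \<longrightarrow> t \<in> X i" for i
    using X(1) X(2)[of i] by (auto simp: open_dist PiE_iff dist_real_def)
  then obtain e where e: "\<And>i. e i > 0" "\<And>i t. \<bar>t - x i\<bar> < e i \<Longrightarrow> t \<in> X i" by metis
  let ?I = "{i. X i \<noteq> UNIV}"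
  have fin: "finite ?I" using X(3) by simp
  obtain n where n: "?I \<subseteq> {..<n}" using finite_nat_iff_bounded fin by blast
  define d where "d = Min (insert 1 (e ` ?I))"
  have "d > 0" unfolding d_def using fin e by auto
  moreover have "y \<in> T" if "\<forall>i<n. \<bar>y i - x i\<bar> < d" for y
  proof -
    have "y i \<in> X i" for i
    proof (cases "i \<in> ?I")
      case True
      then have "d \<le> e i" unfolding d_def using fin by auto
      moreover have "i < n" using n True by blast
      then have "\<bar>y i - x i\<bar> < d" using that by blast
      ultimately show ?thesis using e(2) by (meson order_less_le_trans)
    qed auto
    then show ?thesis using X(4) by auto
  qed
  ultimately show ?thesis by blast
qed

text \<open>
  Only the first \<open>d\<close> coordinates vary in \<open>ES d\<close>, so a cube in these coordinates is a neighbourhood.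
\<close>

lemma openin_ES_box:
  assumes "openin (Euclidean_space d) U" "x \<in> U"
  shows "\<exists>e>0. \<forall>y\<in>ES d. (\<forall>i<d. \<bar>y i - x i\<bar> < e) \<longrightarrow> y \<in> U"
proof -
  obtain T where T: "open T" "U = ES d \<inter> T" using assms openin_ES_iff by blast
  then obtain e n where "e > 0" and e: "\<And>y. (\<forall>i<n. \<bar>y i - x i\<bar> < e) \<Longrightarrow> y \<in> T"
    using open_fun_box[of T x] assms by blast
  have "y \<in> U" if "y \<in> ES d" "\<forall>i<d. \<bar>y i - x i\<bar> < e" for y
  proof -
    have "x \<in> ES d" using assms T by auto
    then have "\<bar>y i - x i\<bar> < e" for i
      using that \<open>e > 0\<close> by (cases "i < d") (auto simp: ES_iff)
    then show ?thesis using e T that by auto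
  qed
  then show ?thesis using \<open>e > 0\<close> by blast
qed

lemma openin_ES_Collect_less:
  assumes "\<And>i. i < m \<Longrightarrow> continuous_on (ES d) (f i)" "\<And>i. i < m \<Longrightarrow> continuous_on (ES d) (g i)"
  shows "openin (Euclidean_space d) {x \<in> ES d. \<forall>i<(m::nat). f i x < (g i x :: real)}"
proof -
  have "openin (Euclidean_space d) {x \<in> ES d. f i x < g i x}" if "i < m" for i
  proof -
    have "continuous_on (ES d) (\<lambda>x. g i x - f i x)"
      using assms that by (intro continuous_intros) auto
    then have "openin (top_of_set (ES d)) (ES d \<inter> (\<lambda>x. g i x - f i x) -` {0<..})"
      by (rule continuous_openin_preimage_gen) simp
    moreover have "ES d \<inter> (\<lambda>x. g i x - f i x) -` {0<..} = {x \<in> ES d. f i x < g i x}"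
      by auto
    ultimately show ?thesis by (simp add: Euclidean_space_top_of_set[symmetric])
  qed
  then have "openin (Euclidean_space d) ((\<Inter>i\<in>{..<m}. {x \<in> ES d. f i x < g i x}) \<inter> ES d)"
    using openin_INT[of "{..<m}" "Euclidean_space d" "\<lambda>i. {x \<in> ES d. f i x < g i x}"] by simp
  moreover have "(\<Inter>i\<in>{..<m}. {x \<in> ES d. f i x < g i x}) \<inter> ES d
      = {x \<in> ES d. \<forall>i<m. f i x < g i x}" by auto
  ultimately show ?thesis by simp
qed

lemma continuous_on_coord [continuous_intros]: "continuous_on S (\<lambda>x::nat \<Rightarrow> real. x i)"
  by (rule continuous_on_product_then_coordinatewise) (rule continuous_on_id)

lemma openin_ES_cube:
  "openin (Euclidean_space d) {x \<in> ES d. \<forall>i<d. \<bar>x i - a i\<bar> < e}"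
  by (rule openin_ES_Collect_less) (intro continuous_intros)+

lemma continuous_within_ES_iff:
  fixes f :: "(nat \<Rightarrow> real) \<Rightarrow> real"
  assumes U: "openin (Euclidean_space d) U" and x: "x \<in> U"
  shows "continuous (at x within U) f \<longleftrightarrow>
    (\<forall>e>0. \<exists>\<delta>>0. \<forall>y\<in>U. (\<forall>i<d. \<bar>y i - x i\<bar> < \<delta>) \<longrightarrow> \<bar>f y - f x\<bar> < e)" (is "?L \<longleftrightarrow> ?R")
proof
  assume ?L
  show ?R
  proof (intro allI impI)
    fix e :: real assume "e > 0"
    then have "\<forall>\<^sub>F y in at x within U. dist (f y) (f x) < e"
      using \<open>?L\<close> by (auto simp: continuous_within tendsto_iff)
    then obtain S where S: "open S" "x \<in> S" "\<And>y. y \<in> S \<Longrightarrow> y \<in> U \<Longrightarrow> y \<noteq> x \<Longrightarrow> dist (f y) (f x) < e"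
      unfolding eventually_at_topological by blast
    have "openin (Euclidean_space d) (U \<inter> S)"
      using U S by (auto simp: openin_ES_iff)
    from openin_ES_box[OF this, of x] obtain \<delta> where "\<delta> > 0" "\<forall>y\<in>ES d. (\<forall>i<d. \<bar>y i - x i\<bar> < \<delta>) \<longrightarrow> y \<in> U \<inter> S"
      using S(2) x by auto
    then show "\<exists>\<delta>>0. \<forall>y\<in>U. (\<forall>i<d. \<bar>y i - x i\<bar> < \<delta>) \<longrightarrow> \<bar>f y - f x\<bar> < e"
      using S openin_ES_subset[OF U] \<open>e > 0\<close>
      by (metis Int_iff dist_real_def subsetD diff_self abs_zero)
  qed
next
  assume R: ?R
  have "\<forall>\<^sub>F y in at x within U. dist (f y) (f x) < e" if e: "e > 0" for e
  proof -
    obtain \<delta> where d: "\<delta> > 0" "\<forall>y\<in>U. (\<forall>i<d. \<bar>y i - x i\<bar> < \<delta>) \<longrightarrow> \<bar>f y - f x\<bar> < e"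
      using R[rule_format, OF e] by blast
    obtain S where S: "open S" "{y \<in> ES d. \<forall>i<d. \<bar>y i - x i\<bar> < \<delta>} = ES d \<inter> S"
      using openin_ES_cube[of d x \<delta>] unfolding openin_ES_iff by metis
    have xE: "x \<in> ES d" using openin_ES_subset[OF U] x by blast
    have "x \<in> S" using S(2) xE d(1) by auto
    moreover have "dist (f y) (f x) < e" if "y \<in> S" "y \<in> U" for y
      using that d S openin_ES_subset[OF U] by (auto simp: dist_real_def)
    ultimately show ?thesis unfolding eventually_at_topological using S(1)
      by (intro exI[of _ S]) auto
  qed
  then show ?L by (auto simp: continuous_within tendsto_iff)
qed

section \<open>Calculus of continuously differentiable functions\<close>

lemma Ck_on_imp_continuous_on:
  assumes "openin (Euclidean_space d) U" "Ck_on d k U f"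
  shows "continuous_on U f"
  using assms continuous_map_ES_real[OF openin_ES_subset[OF assms(1)]] by (cases k) auto

lemma partial_deriv_eqI:
  "((\<lambda>t. f (x(i := t))) has_real_derivative D) (at (x i)) \<Longrightarrow> partial_deriv i f x = D"
  by (simp add: partial_deriv_def DERIV_imp_deriv)

lemma partial_deriv_cong:
  assumes "openin (Euclidean_space d) U" "x \<in> U" "i < d" "\<And>y. y \<in> U \<Longrightarrow> f y = g y"
  shows "partial_deriv i f x = partial_deriv i g x"
  unfolding partial_deriv_def
  by (rule deriv_cong_ev)
     (use eventually_fun_upd[OF assms(1-3)] assms in \<open>auto elim: eventually_mono\<close>)

lemma has_derivative_fun_upd_cong:
  assumes "openin (Euclidean_space d) U" "x \<in> U" "i < d" "\<And>y. y \<in> U \<Longrightarrow> f y = g y"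
  shows "((\<lambda>t. f (x(i := t))) has_real_derivative D) (at (x i)) \<longleftrightarrow>
         ((\<lambda>t. g (x(i := t))) has_real_derivative D) (at (x i))"
  by (rule DERIV_cong_ev)
     (use eventually_fun_upd[OF assms(1-3)] assms in \<open>auto elim: eventually_mono\<close>)

lemma Ck_on_cong:
  assumes "openin (Euclidean_space d) U" "\<And>x. x \<in> U \<Longrightarrow> f x = g x" "Ck_on d k U f"
  shows "Ck_on d k U g"
  using assms(2,3)
proof (induction k arbitrary: f g)
  case 0
  then show ?case
    using continuous_map_ES_real[OF openin_ES_subset[OF assms(1)]] continuous_on_cong[of U U f g] by auto
next
  case (Suc k)
  have "continuous_on U g"
    using Ck_on_imp_continuous_on[OF assms(1) Suc.prems(2)] continuous_on_cong[of U U f g] Suc by auto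
  moreover have "(\<lambda>t. g (x(i := t))) differentiable (at (x i))" if ix: "i < d" "x \<in> U" for i x
  proof -
    have "(\<lambda>t. f (x(i := t))) differentiable (at (x i))"
      using Suc.prems(2) ix by simp
    then obtain D where "((\<lambda>t. f (x(i := t))) has_real_derivative D) (at (x i))"
      unfolding real_differentiable_def by (elim exE)
    then have "((\<lambda>t. g (x(i := t))) has_real_derivative D) (at (x i))"
      using has_derivative_fun_upd_cong[OF assms(1) that(2,1), of f g] Suc.prems(1) by blast
    then show ?thesis by (auto simp: real_differentiable_def)
  qed
  moreover have "Ck_on d k U (partial_deriv i g)" if "i < d" for i
    using Suc.IH[of "partial_deriv i f" "partial_deriv i g"] Suc.prems that
      partial_deriv_cong[OF assms(1) _ that, of _ f g] by auto
  ultimately show ?case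
    using continuous_map_ES_real[OF openin_ES_subset[OF assms(1)]] by auto
qed

text \<open>
  The total functions \<open>partial_deriv i f\<close> are unspecified outside \<open>U\<close>.  The rule replaces them by any
  functions \<open>g i\<close> that are the partial derivatives on \<open>U\<close>, which is how all closure properties are
  proved.
\<close>

lemma Ck_on_SucI:
  assumes U: "openin (Euclidean_space d) U" and f: "continuous_on U f"
    and D: "\<And>i x. i < d \<Longrightarrow> x \<in> U \<Longrightarrow> ((\<lambda>t. f (x(i := t))) has_real_derivative g i x) (at (x i))"
    and g: "\<And>i. i < d \<Longrightarrow> Ck_on d k U (g i)"
  shows "Ck_on d (Suc k) U f"
proof -
  have "Ck_on d k U (partial_deriv i f)" if "i < d" for i
  proof (rule Ck_on_cong[OF U _ g[OF that]])
    show "g i x = partial_deriv i f x" if "x \<in> U" for x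
      by (rule partial_deriv_eqI[OF D[OF \<open>i < d\<close> that], symmetric])
  qed
  then show ?thesis
    using D f continuous_map_ES_real[OF openin_ES_subset[OF U]] by (auto simp: real_differentiable_def)
qed

lemma Ck_on_Suc_partial:
  assumes "Ck_on d (Suc k) U f" "i < d"
  shows "Ck_on d k U (partial_deriv i f)"
    and "x \<in> U \<Longrightarrow> ((\<lambda>t. f (x(i := t))) has_real_derivative partial_deriv i f x) (at (x i))"
  using assms by (auto simp: partial_deriv_def DERIV_deriv_iff_real_differentiable)

lemma Ck_on_Suc_imp: "Ck_on d (Suc k) U f \<Longrightarrow> Ck_on d k U f"
  by (induction k arbitrary: f) auto

lemma Ck_on_le: "Ck_on d k U f \<Longrightarrow> l \<le> k \<Longrightarrow> Ck_on d l U f"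
  by (induction k) (auto simp: le_Suc_eq dest: Ck_on_Suc_imp simp del: Ck_on.simps)

lemma Ck_on_subset:
  assumes "V \<subseteq> U" "Ck_on d k U f"
  shows "Ck_on d k V f"
  using assms(2) by (induction k arbitrary: f)
    (use assms(1) in \<open>auto intro: continuous_map_from_subtopology_mono\<close>)

text \<open>
  Differentiability is pointwise and continuity is local, so no compatibility condition appears.
\<close>

lemma Ck_on_Union:
  assumes "\<And>x. x \<in> U \<Longrightarrow> \<exists>V. openin (Euclidean_space d) V \<and> x \<in> V \<and> V \<subseteq> U \<and> Ck_on d k V f"
  shows "Ck_on d k U f"
proof -
  obtain V where V: "\<And>x. x \<in> U \<Longrightarrow> openin (Euclidean_space d) (V x) \<and> x \<in> V x \<and> V x \<subseteq> U \<and> Ck_on d k (V x) f"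
    using assms by metis
  have U: "U = (\<Union>x\<in>U. V x)" using V by blast
  have op: "openin (Euclidean_space d) U"
    by (subst U) (use V in auto)
  have cont: "continuous_on U g" if "\<And>x. x \<in> U \<Longrightarrow> continuous_on (V x) g" for g :: "(nat \<Rightarrow> real) \<Rightarrow> real"
  proof -
    have "continuous (at x within U) g" if x: "x \<in> U" for x
    proof -
      have "continuous (at x within V x) g"
        using \<open>\<And>x. x \<in> U \<Longrightarrow> continuous_on (V x) g\<close> x V by (auto simp: continuous_on_eq_continuous_within)
      moreover obtain T where "open T" "V x = ES d \<inter> T"
        using V[OF x] openin_ES_iff[of d "V x"] by metis
      moreover have "at x within V x = at x within U"
      proof -
        have "V x = U \<inter> T" "U \<subseteq> ES d" using V[OF x] \<open>V x = ES d \<inter> T\<close> openin_ES_subset[OF op] by auto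
        moreover have "at x within U = at x within (U \<inter> T)"
          by (rule at_within_nhd[of _ T]) (use \<open>open T\<close> V[OF x] \<open>V x = U \<inter> T\<close> in auto)
        ultimately show ?thesis by simp
      qed
      ultimately show ?thesis by simp
    qed
    then show ?thesis by (simp add: continuous_on_eq_continuous_within)
  qed
  show ?thesis using V cont
  proof (induction k arbitrary: f)
    case 0
    have "continuous_on U f" using 0 Ck_on_imp_continuous_on by blast
    then show ?case using continuous_map_ES_real[OF openin_ES_subset[OF op]] by simp
  next
    case (Suc k)
    have "continuous_on U f" using Suc.prems Ck_on_imp_continuous_on by blast
    moreover have "Ck_on d k U (partial_deriv i f)" if "i < d" for i
      by (rule Suc.IH) (use Suc.prems that in auto)
    ultimately show ?case using continuous_map_ES_real[OF openin_ES_subset[OF op]] Suc.prems by auto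
  qed
qed

lemma Ck_on_const [simp]: "openin (Euclidean_space d) U \<Longrightarrow> Ck_on d k U (\<lambda>x. c)"
proof (induction k arbitrary: c)
  case (Suc k)
  then show ?case by (intro Ck_on_SucI[where g = "\<lambda>_ _. 0"]) auto
qed auto

lemma Ck_on_coord: "openin (Euclidean_space d) U \<Longrightarrow> Ck_on d k U (\<lambda>x. x j)"
proof (cases k)
  case (Suc k)
  assume U: "openin (Euclidean_space d) U"
  show ?thesis unfolding Suc
  proof (intro Ck_on_SucI[where g = "\<lambda>i _. if i = j then 1 else 0"] U continuous_intros)
    show "((\<lambda>t. (x(i := t)) j) has_real_derivative (if i = j then 1 else 0)) (at (x i))" for i and x :: "nat \<Rightarrow> real"
      by (cases "i = j") (auto intro!: derivative_eq_intros)
  qed (use U in auto)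
qed (auto simp: continuous_map_ES_real[OF openin_ES_subset] intro: continuous_intros)

lemma Ck_on_add:
  assumes U: "openin (Euclidean_space d) U"
  shows "Ck_on d k U f \<Longrightarrow> Ck_on d k U g \<Longrightarrow> Ck_on d k U (\<lambda>x. f x + g x)"
proof (induction k arbitrary: f g)
  case 0
  then show ?case
    using continuous_map_ES_real[OF openin_ES_subset[OF U]] by (auto intro: continuous_intros)
next
  case (Suc k)
  note prems = Suc.prems
  show ?case
  proof (rule Ck_on_SucI[OF U, where g = "\<lambda>i x. partial_deriv i f x + partial_deriv i g x"])
    show "continuous_on U (\<lambda>x. f x + g x)"
      using Ck_on_imp_continuous_on[OF U prems(1)] Ck_on_imp_continuous_on[OF U prems(2)] by (intro continuous_intros)
    show "((\<lambda>t. f (x(i := t)) + g (x(i := t))) has_real_derivative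
        partial_deriv i f x + partial_deriv i g x) (at (x i))" if "i < d" "x \<in> U" for i x
      by (rule DERIV_add[OF Ck_on_Suc_partial(2)[OF prems(1) that] Ck_on_Suc_partial(2)[OF prems(2) that]])
    show "Ck_on d k U (\<lambda>x. partial_deriv i f x + partial_deriv i g x)" if "i < d" for i
      using Suc.IH[OF Ck_on_Suc_partial(1)[OF prems(1) that] Ck_on_Suc_partial(1)[OF prems(2) that]] .
  qed
qed

lemma Ck_on_mult:
  assumes U: "openin (Euclidean_space d) U"
  shows "Ck_on d k U f \<Longrightarrow> Ck_on d k U g \<Longrightarrow> Ck_on d k U (\<lambda>x. f x * g x)"
proof (induction k arbitrary: f g)
  case 0
  then show ?case
    using continuous_map_ES_real[OF openin_ES_subset[OF U]] by (auto intro: continuous_intros)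
next
  case (Suc k)
  note prems = Suc.prems
  show ?case
  proof (rule Ck_on_SucI[OF U, where g = "\<lambda>i x. partial_deriv i f x * g x + f x * partial_deriv i g x"])
    show "continuous_on U (\<lambda>x. f x * g x)"
      using Ck_on_imp_continuous_on[OF U prems(1)] Ck_on_imp_continuous_on[OF U prems(2)] by (intro continuous_intros)
    show "((\<lambda>t. f (x(i := t)) * g (x(i := t))) has_real_derivative
        partial_deriv i f x * g x + f x * partial_deriv i g x) (at (x i))" if "i < d" "x \<in> U" for i x
      by (rule DERIV_cong[OF DERIV_mult[OF Ck_on_Suc_partial(2)[OF prems(1) that] Ck_on_Suc_partial(2)[OF prems(2) that]]])
         (simp add: algebra_simps)
    show "Ck_on d k U (\<lambda>x. partial_deriv i f x * g x + f x * partial_deriv i g x)" if "i < d" for i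
      using Ck_on_add[OF U Suc.IH[OF Ck_on_Suc_partial(1)[OF prems(1) that] Ck_on_Suc_imp[OF prems(2)]]
          Suc.IH[OF Ck_on_Suc_imp[OF prems(1)] Ck_on_Suc_partial(1)[OF prems(2) that]]] .
  qed
qed

lemma Ck_on_diff:
  assumes U: "openin (Euclidean_space d) U"
  shows "Ck_on d k U f \<Longrightarrow> Ck_on d k U g \<Longrightarrow> Ck_on d k U (\<lambda>x. f x - g x)"
  using Ck_on_add[OF U, of k f "\<lambda>x. (-1) * g x"] Ck_on_mult[OF U, of k "\<lambda>_. -1" g] U by simp

lemma Ck_on_sum:
  assumes U: "openin (Euclidean_space d) U"
  shows "(\<And>i. i \<in> I \<Longrightarrow> Ck_on d k U (f i)) \<Longrightarrow> Ck_on d k U (\<lambda>x. \<Sum>i\<in>I. f i x)"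
  by (induction I rule: infinite_finite_induct) (auto intro: Ck_on_add[OF U] Ck_on_const[OF U])

lemma Ck_on_prod:
  assumes U: "openin (Euclidean_space d) U"
  shows "(\<And>i. i \<in> I \<Longrightarrow> Ck_on d k U (f i)) \<Longrightarrow> Ck_on d k U (\<lambda>x. \<Prod>i\<in>I. f i x)"
  by (induction I rule: infinite_finite_induct) (auto intro: Ck_on_mult[OF U] Ck_on_const[OF U])

lemma Ck_on_inverse:
  assumes U: "openin (Euclidean_space d) U" and nz: "\<And>x. x \<in> U \<Longrightarrow> f x \<noteq> 0"
  shows "Ck_on d k U f \<Longrightarrow> Ck_on d k U (\<lambda>x. inverse (f x))"
proof (induction k)
  case 0
  then show ?case
    using continuous_map_ES_real[OF openin_ES_subset[OF U]] nz by (auto intro: continuous_intros)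
next
  case (Suc k)
  show ?case
  proof (rule Ck_on_SucI[OF U, where g = "\<lambda>i x. (-1) * (inverse (f x) * (inverse (f x) * partial_deriv i f x))"])
    show "continuous_on U (\<lambda>x. inverse (f x))"
      using Ck_on_imp_continuous_on[OF U Suc.prems] nz by (intro continuous_intros) auto
    show "((\<lambda>t. inverse (f (x(i := t)))) has_real_derivative
        (-1) * (inverse (f x) * (inverse (f x) * partial_deriv i f x))) (at (x i))" if "i < d" "x \<in> U" for i x
      by (rule DERIV_cong[OF DERIV_inverse_fun[OF Ck_on_Suc_partial(2)[OF Suc.prems that]]])
         (use nz[OF that(2)] in \<open>auto simp: algebra_simps\<close>)
    show "Ck_on d k U (\<lambda>x. (-1) * (inverse (f x) * (inverse (f x) * partial_deriv i f x)))" if "i < d" for i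
      using Ck_on_mult[OF U Ck_on_const[OF U] Ck_on_mult[OF U Suc.IH[OF Ck_on_Suc_imp[OF Suc.prems]]
          Ck_on_mult[OF U Suc.IH[OF Ck_on_Suc_imp[OF Suc.prems]] Ck_on_Suc_partial(1)[OF Suc.prems that]]]] .
  qed
qed

lemma Ck_on_divide:
  assumes U: "openin (Euclidean_space d) U" and nz: "\<And>x. x \<in> U \<Longrightarrow> g x \<noteq> 0"
  shows "Ck_on d k U f \<Longrightarrow> Ck_on d k U g \<Longrightarrow> Ck_on d k U (\<lambda>x. f x / g x)"
  unfolding divide_inverse by (rule Ck_on_mult[OF U]) (auto intro: Ck_on_inverse[OF U nz])

lemmas Ck_on_intros = Ck_on_const Ck_on_coord Ck_on_add Ck_on_mult Ck_on_diff Ck_on_sum Ck_on_prod Ck_on_divide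

section \<open>Caratheodory derivatives and the chain rule\<close>

text \<open>
  A form of the mean value theorem that does not ask in which order \<open>a\<close> and \<open>b\<close> lie.
\<close>

lemma MVT_abs:
  fixes f :: "real \<Rightarrow> real"
  assumes "\<And>t. min a b \<le> t \<Longrightarrow> t \<le> max a b \<Longrightarrow> (f has_real_derivative f' t) (at t)"
  shows "\<exists>t. min a b \<le> t \<and> t \<le> max a b \<and> f b - f a = f' t * (b - a)"
proof -
  consider "a < b" | "a = b" | "b < a" by linarith
  then show ?thesis
  proof cases
    case 1
    then obtain t where "t > a" "t < b" "f b - f a = (b - a) * f' t"
      using MVT2[of a b f f'] assms by (auto simp: min_def max_def)
    then show ?thesis using 1 by (intro exI[of _ t]) auto
  next
    case 3
    then obtain t where t: "t > b" "t < a" "f a - f b = (a - b) * f' t"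
      using MVT2[of b a f f'] assms by (auto simp: min_def max_def)
    then have "f b - f a = f' t * (b - a)" by argo
    then show ?thesis using 3 t by (intro exI[of _ t]) auto
  qed auto
qed

text \<open>
  Change the coordinates of \<open>x\<close> into those of \<open>y\<close> one at a time and apply the mean value theorem to
  each step.  Every intermediate point stays in the box spanned by \<open>x\<close> and \<open>y\<close>.
\<close>

lemma C1_telescope:
  assumes U: "openin (Euclidean_space d) U" and f: "Ck_on d 1 U f" and xy: "x \<in> ES d" "y \<in> ES d"
    and box: "\<And>z. z \<in> ES d \<Longrightarrow> (\<And>i. min (x i) (y i) \<le> z i \<and> z i \<le> max (x i) (y i)) \<Longrightarrow> z \<in> U"
  shows "\<exists>\<eta>. (\<forall>j<d. \<eta> j \<in> ES d \<and> (\<forall>i. min (x i) (y i) \<le> \<eta> j i \<and> \<eta> j i \<le> max (x i) (y i))) \<and>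
     f y - f x = (\<Sum>j<d. partial_deriv j f (\<eta> j) * (y j - x j))"
proof -
  \<comment> \<open>the points between \<open>x\<close> and \<open>y\<close> after \<open>j\<close> changes of a coordinate\<close>
  define p where "p j = (\<lambda>i. if i < j then y i else x i)" for j :: nat
  have p0: "p 0 = x" by (auto simp: p_def)
  have pd: "p d = y" using xy by (fastforce simp: p_def ES_iff)
  have pS: "p (Suc j) = (p j)(j := y j)" for j by (auto simp: p_def)
  have pj: "p j = (p j)(j := x j)" for j by (auto simp: p_def)
  have ex: "\<exists>t. min (x j) (y j) \<le> t \<and> t \<le> max (x j) (y j) \<and>
      f (p (Suc j)) - f (p j) = partial_deriv j f ((p j)(j := t)) * (y j - x j)" if j: "j < d" for j
  proof -
    have "((\<lambda>t. f ((p j)(j := t))) has_real_derivative partial_deriv j f ((p j)(j := t))) (at t)"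
      if "min (x j) (y j) \<le> t" "t \<le> max (x j) (y j)" for t
    proof -
      let ?z = "(p j)(j := t)"
      have "?z \<in> U"
        by (rule box) (use that xy j in \<open>auto simp: p_def ES_iff\<close>)
      then show ?thesis using Ck_on_Suc_partial(2)[of d 0 U f j ?z] f j by simp
    qed
    then show ?thesis
      using MVT_abs[of "x j" "y j" "\<lambda>t. f ((p j)(j := t))" "\<lambda>t. partial_deriv j f ((p j)(j := t))"]
      by (simp add: pS pj[symmetric])
  qed
  then obtain t where t: "\<And>j. j < d \<Longrightarrow> min (x j) (y j) \<le> t j \<and> t j \<le> max (x j) (y j) \<and>
      f (p (Suc j)) - f (p j) = partial_deriv j f ((p j)(j := t j)) * (y j - x j)" by metis
  have "f y - f x = (\<Sum>j<d. f (p (Suc j)) - f (p j))"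
    using sum_lessThan_telescope[of "\<lambda>j. f (p j)" d] by (simp add: p0 pd)
  also have "\<dots> = (\<Sum>j<d. partial_deriv j f ((p j)(j := t j)) * (y j - x j))"
    using t by (intro sum.cong) auto
  finally show ?thesis
    by (intro exI[of _ "\<lambda>j. (p j)(j := t j)"]) (use t xy in \<open>auto simp: p_def ES_iff\<close>)
qed

text \<open>
  The increment of \<open>f\<close> is linear in \<open>y - x\<close> with coefficients \<open>q j y\<close> that are continuous at \<open>x\<close>: the
  partial derivatives at the intermediate points of \<open>C1_telescope\<close>, which tend to \<open>x\<close> with \<open>y\<close>.  In
  this form the chain rule and the inverse function theorem reduce to limits of sums and quotients.
\<close>

lemma C1_Caratheodory:
  assumes U: "openin (Euclidean_space d) U" and f: "Ck_on d 1 U f" and x: "x \<in> U"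
  shows "\<exists>q \<delta>. \<delta> > 0 \<and> (\<forall>j<d. continuous (at x within U) (q j) \<and> q j x = partial_deriv j f x) \<and>
     (\<forall>y\<in>U. (\<forall>i<d. \<bar>y i - x i\<bar> < \<delta>) \<longrightarrow> f y - f x = (\<Sum>j<d. q j y * (y j - x j)))"
proof -
  have xE: "x \<in> ES d" using x openin_ES_subset[OF U] by blast
  obtain \<delta> where \<delta>: "\<delta> > 0" "\<And>y. y \<in> ES d \<Longrightarrow> (\<forall>i<d. \<bar>y i - x i\<bar> < \<delta>) \<Longrightarrow> y \<in> U"
    using openin_ES_box[OF U x] by blast
  have close: "\<bar>z i - x i\<bar> \<le> \<bar>y i - x i\<bar>" if "min (x i) (y i) \<le> z i \<and> z i \<le> max (x i) (y i)"
    for z y :: "nat \<Rightarrow> real" and i using that by auto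
  have "\<exists>\<eta>. (\<forall>j<d. \<eta> j \<in> U \<and> (\<forall>i. \<bar>\<eta> j i - x i\<bar> \<le> \<bar>y i - x i\<bar>)) \<and>
     f y - f x = (\<Sum>j<d. partial_deriv j f (\<eta> j) * (y j - x j))"
    if y: "y \<in> U" "\<forall>i<d. \<bar>y i - x i\<bar> < \<delta>" for y
  proof -
    have yE: "y \<in> ES d" using y openin_ES_subset[OF U] by blast
    have box: "z \<in> U" if "z \<in> ES d" "\<And>i. min (x i) (y i) \<le> z i \<and> z i \<le> max (x i) (y i)" for z
    proof (rule \<delta>(2)[OF that(1)], intro allI impI)
      fix i assume "i < d"
      then show "\<bar>z i - x i\<bar> < \<delta>" using close[of i z y] that(2)[of i] y(2) by force
    qed
    obtain \<eta> where \<eta>: "\<forall>j<d. \<eta> j \<in> ES d \<and> (\<forall>i. min (x i) (y i) \<le> \<eta> j i \<and> \<eta> j i \<le> max (x i) (y i))"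
      "f y - f x = (\<Sum>j<d. partial_deriv j f (\<eta> j) * (y j - x j))"
      using C1_telescope[OF U f xE yE box] by blast
    have "\<forall>j<d. \<eta> j \<in> U \<and> (\<forall>i. \<bar>\<eta> j i - x i\<bar> \<le> \<bar>y i - x i\<bar>)"
      using \<eta>(1) box close by simp
    then show ?thesis using \<eta>(2) by blast
  qed
  then have "\<forall>y. \<exists>\<eta>. y \<in> U \<and> (\<forall>i<d. \<bar>y i - x i\<bar> < \<delta>) \<longrightarrow>
      (\<forall>j<d. \<eta> j \<in> U \<and> (\<forall>i. \<bar>\<eta> j i - x i\<bar> \<le> \<bar>y i - x i\<bar>)) \<and>
       f y - f x = (\<Sum>j<d. partial_deriv j f (\<eta> j) * (y j - x j))" by blast
  from choice[OF this] obtain \<eta> where \<eta>: "\<And>y. y \<in> U \<Longrightarrow> \<forall>i<d. \<bar>y i - x i\<bar> < \<delta> \<Longrightarrow>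
      (\<forall>j<d. \<eta> y j \<in> U \<and> (\<forall>i. \<bar>\<eta> y j i - x i\<bar> \<le> \<bar>y i - x i\<bar>)) \<and>
       f y - f x = (\<Sum>j<d. partial_deriv j f (\<eta> y j) * (y j - x j))" by blast
  define q where "q j y = partial_deriv j f (\<eta> y j)" for j y
  have \<eta>x: "\<eta> x j = x" if "j < d" for j
    using \<eta>[OF x] \<delta>(1) that by auto
  have "continuous (at x within U) (q j)" if j: "j < d" for j
  proof -
    have "continuous_on U (partial_deriv j f)"
      using Ck_on_Suc_partial(1)[of d 0 U f j] f j Ck_on_imp_continuous_on[OF U, of 0] by simp
    then have c: "continuous (at x within U) (partial_deriv j f)"
      using x by (simp add: continuous_on_eq_continuous_within)
    show ?thesis unfolding continuous_within_ES_iff[OF U x]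
    proof (intro allI impI)
      fix e :: real assume "e > 0"
      then obtain r where r: "r > 0" "\<forall>y\<in>U. (\<forall>i<d. \<bar>y i - x i\<bar> < r) \<longrightarrow> \<bar>partial_deriv j f y - partial_deriv j f x\<bar> < e"
        using c unfolding continuous_within_ES_iff[OF U x] by blast
      have "\<bar>q j y - q j x\<bar> < e" if "y \<in> U" "\<forall>i<d. \<bar>y i - x i\<bar> < min r \<delta>" for y
      proof -
        have "\<eta> y j \<in> U" "\<forall>i<d. \<bar>\<eta> y j i - x i\<bar> < r"
          using \<eta>[of y] that j by (auto intro: order_le_less_trans)
        then show ?thesis using r(2) j by (auto simp: q_def \<eta>x)
      qed
      then show "\<exists>\<delta>>0. \<forall>y\<in>U. (\<forall>i<d. \<bar>y i - x i\<bar> < \<delta>) \<longrightarrow> \<bar>q j y - q j x\<bar> < e"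
        using r(1) \<delta>(1) by (intro exI[of _ "min r \<delta>"]) auto
    qed
  qed
  then show ?thesis using \<delta>(1) \<eta> \<eta>x
    by (intro exI[of _ q] exI[of _ \<delta>]) (auto simp: q_def)
qed

lemma C1_chain_curve:
  assumes V: "openin (Euclidean_space e) V" and f: "Ck_on e 1 V f"
    and G0: "G t0 \<in> V" and GV: "\<forall>\<^sub>F t in at t0. G t \<in> V"
    and D: "\<And>j. j < e \<Longrightarrow> ((\<lambda>t. G t j) has_real_derivative D j) (at t0)"
  shows "((\<lambda>t. f (G t)) has_real_derivative (\<Sum>j<e. partial_deriv j f (G t0) * D j)) (at t0)"
proof -
  obtain q \<delta> where \<delta>: "\<delta> > 0" and q: "\<And>j. j < e \<Longrightarrow> continuous (at (G t0) within V) (q j) \<and> q j (G t0) = partial_deriv j f (G t0)"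
    and id: "\<And>y. y \<in> V \<Longrightarrow> \<forall>i<e. \<bar>y i - G t0 i\<bar> < \<delta> \<Longrightarrow> f y - f (G t0) = (\<Sum>j<e. q j y * (y j - G t0 j))"
    using C1_Caratheodory[OF V f G0] by blast
  have lim: "tendsto (\<lambda>t. G t j) (G t0 j) (at t0)" for j
  proof (cases "j < e")
    case True
    then show ?thesis using DERIV_isCont[OF D] by (simp add: isCont_def)
  next
    case False
    have "\<forall>\<^sub>F t in at t0. G t j = G t0 j"
    proof (rule eventually_mono[OF GV])
      fix t assume "G t \<in> V"
      then have "G t \<in> ES e" "G t0 \<in> ES e" using G0 openin_ES_subset[OF V] by auto
      then show "G t j = G t0 j" using False by (auto simp: ES_iff)
    qed
    then show ?thesis by (simp add: tendsto_eventually)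
  qed
  then have G: "tendsto G (G t0) (at t0)" by (rule tendsto_funI)
  have "\<forall>\<^sub>F t in at t0. \<forall>i\<in>{..<e}. \<bar>G t i - G t0 i\<bar> < \<delta>"
    by (rule eventually_ball_finite) (use lim \<delta> in \<open>auto simp: tendsto_iff dist_real_def\<close>)
  with GV have ev: "\<forall>\<^sub>F t in at t0. (\<Sum>j<e. q j (G t) * ((G t j - G t0 j) / (t - t0))) = (f (G t) - f (G t0)) / (t - t0)"
  proof eventually_elim
    case (elim t)
    then have "f (G t) - f (G t0) = (\<Sum>j<e. q j (G t) * (G t j - G t0 j))" using id by auto
    then show ?case by (simp add: sum_divide_distrib)
  qed
  have "tendsto (\<lambda>t. \<Sum>j<e. q j (G t) * ((G t j - G t0 j) / (t - t0)))
      (\<Sum>j<e. partial_deriv j f (G t0) * D j) (at t0)"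
  proof (intro tendsto_sum tendsto_mult)
    fix j assume "j \<in> {..<e}"
    then show "tendsto (\<lambda>t. q j (G t)) (partial_deriv j f (G t0)) (at t0)"
      using q[of j] continuous_within_tendsto_compose[OF _ GV G, of "q j"] by auto
    show "tendsto (\<lambda>t. (G t j - G t0 j) / (t - t0)) (D j) (at t0)"
      using D[of j] \<open>j \<in> {..<e}\<close> by (simp add: has_field_derivative_iff)
  qed
  then show ?thesis
    unfolding has_field_derivative_iff using ev by (rule Lim_transform_eventually)
qed

lemma continuous_on_ES_coords:
  assumes "\<And>j. j < e \<Longrightarrow> continuous_on U (\<lambda>x. G x j)" "G ` U \<subseteq> ES e"
  shows "continuous_on U (G :: 'a::topological_space \<Rightarrow> _)"
proof (rule continuous_on_coordinatewise_then_product)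
  fix j show "continuous_on U (\<lambda>x. G x j)"
  proof (cases "j < e")
    case False
    then have "continuous_on U (\<lambda>x. G x j) \<longleftrightarrow> continuous_on U (\<lambda>x. 0 :: real)"
      using assms(2) by (intro continuous_on_cong) (auto simp: ES_iff subset_iff)
    then show ?thesis by simp
  qed (use assms in auto)
qed

text \<open>
  By induction on \<open>k\<close>: the chain rule expresses the partial derivatives of the composition through
  products of \<open>k\<close> times differentiable functions.
\<close>

lemma Ck_on_compose:
  assumes U: "openin (Euclidean_space d) U" and V: "openin (Euclidean_space e) V" and GV: "G ` U \<subseteq> V"
  shows "(\<And>j. j < e \<Longrightarrow> Ck_on d k U (\<lambda>x. G x j)) \<Longrightarrow> Ck_on e k V f \<Longrightarrow> Ck_on d k U (\<lambda>x. f (G x))"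
proof (induction k arbitrary: f)
  case (0 f)
  have "continuous_on U G"
    using continuous_on_ES_coords[of e U G] 0(1) Ck_on_imp_continuous_on[OF U, of 0] GV openin_ES_subset[OF V] by blast
  then have "continuous_on U (\<lambda>x. f (G x))"
    using continuous_on_compose2[OF Ck_on_imp_continuous_on[OF V 0(2)]] GV by blast
  then show ?case using continuous_map_ES_real[OF openin_ES_subset[OF U]] by simp
next
  case (Suc k f)
  note GS = Suc.prems(1)
  have "continuous_on U G"
    using continuous_on_ES_coords[of e U G] Ck_on_imp_continuous_on[OF U GS] GV openin_ES_subset[OF V] by blast
  then have c: "continuous_on U (\<lambda>x. f (G x))"
    using continuous_on_compose2[OF Ck_on_imp_continuous_on[OF V Suc.prems(2)]] GV by blast
  show ?case
  proof (rule Ck_on_SucI[OF U c, where g = "\<lambda>i x. \<Sum>j<e. partial_deriv j f (G x) * partial_deriv i (\<lambda>y. G y j) x"])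
    show "Ck_on d k U (\<lambda>x. \<Sum>j<e. partial_deriv j f (G x) * partial_deriv i (\<lambda>y. G y j) x)" if i: "i < d" for i
    proof (rule Ck_on_sum[OF U], rule Ck_on_mult[OF U])
      fix j assume "j \<in> {..<e}"
      then have j: "j < e" by simp
      show "Ck_on d k U (\<lambda>x. partial_deriv j f (G x))"
        by (rule Suc.IH[OF Ck_on_Suc_imp[OF GS] Ck_on_Suc_partial(1)[OF Suc.prems(2) j]])
      show "Ck_on d k U (partial_deriv i (\<lambda>y. G y j))"
        by (rule Ck_on_Suc_partial(1)[OF GS[OF j] i])
    qed
    show "((\<lambda>t. f (G (x(i := t)))) has_real_derivative
        (\<Sum>j<e. partial_deriv j f (G x) * partial_deriv i (\<lambda>y. G y j) x)) (at (x i))" if i: "i < d" and x: "x \<in> U" for i x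
    proof -
      have ev: "\<forall>\<^sub>F t in at (x i). G (x(i := t)) \<in> V"
        using eventually_fun_upd[OF U x i] GV
        by (auto simp: eventually_at_filter elim!: eventually_mono)
      have "Ck_on e 1 V f" using Ck_on_le[OF Suc.prems(2), of 1] by simp
      from C1_chain_curve[OF V this, of "\<lambda>t. G (x(i := t))" "x i" "\<lambda>j. partial_deriv i (\<lambda>y. G y j) x"]
      show ?thesis
        using ev GV x Ck_on_Suc_partial(2)[OF GS i x] unfolding fun_upd_triv by blast
    qed
  qed
qed

section \<open>Determinants and adjugates of real functions of two indices\<close>

text \<open>
  The dimension \<open>n\<close> of a manifold is a number, not a type, so Jacobian matrices are functions of two
  indices, of which the values below \<open>n\<close> matter.
\<close>

definition detfun :: "nat \<Rightarrow> (nat \<Rightarrow> nat \<Rightarrow> real) \<Rightarrow> real" where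
  "detfun n A = Determinant.det (Matrix.mat n n (\<lambda>(i, j). A i j))"

definition adjfun :: "nat \<Rightarrow> (nat \<Rightarrow> nat \<Rightarrow> real) \<Rightarrow> nat \<Rightarrow> nat \<Rightarrow> real" where
  "adjfun n A i j = adj_mat (Matrix.mat n n (\<lambda>(i, j). A i j)) $$ (i, j)"

lemma adjfun_mult:
  assumes "k < n" "l < n"
  shows "(\<Sum>j<n. adjfun n A k j * A j l) = (if k = l then detfun n A else 0)"
proof -
  let ?A = "Matrix.mat n n (\<lambda>(i, j). A i j)"
  have A: "?A \<in> carrier_mat n n" by simp
  note adj = adj_mat[OF A]
  have "(adj_mat ?A * ?A) $$ (k, l) = (\<Sum>j<n. adjfun n A k j * A j l)"
    using adj(1) assms by (auto simp: adjfun_def times_mat_def scalar_prod_def lessThan_atLeast0 intro!: sum.cong)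
  moreover have "(adj_mat ?A * ?A) $$ (k, l) = (if k = l then detfun n A else 0)"
    using assms by (subst adj(3)) (simp add: detfun_def)
  ultimately show ?thesis by simp
qed

text \<open>
  Cramer's rule, without division.
\<close>

lemma adjfun_solve:
  assumes "\<And>i. i < n \<Longrightarrow> (\<Sum>j<n. A i j * v j) = w i" and k: "k < n"
  shows "detfun n A * v k = (\<Sum>j<n. adjfun n A k j * w j)"
proof -
  have "(\<Sum>j<n. adjfun n A k j * w j) = (\<Sum>j<n. \<Sum>l<n. adjfun n A k j * A j l * v l)"
    using assms(1) by (intro sum.cong) (auto simp: sum_distrib_left mult.assoc simp flip: assms(1))
  also have "\<dots> = (\<Sum>l<n. (\<Sum>j<n. adjfun n A k j * A j l) * v l)"
    by (subst sum.swap) (simp add: sum_distrib_right)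
  also have "\<dots> = (\<Sum>l<n. (if k = l then detfun n A else 0) * v l)"
    using k by (intro sum.cong) (auto simp: adjfun_mult)
  also have "\<dots> = detfun n A * v k"
    using k by (subst sum.remove[of _ k]) auto
  finally show ?thesis by simp
qed

lemma detfun_nonzero:
  assumes "\<And>v. (\<And>i. i < n \<Longrightarrow> (\<Sum>j<n. A i j * v j) = 0) \<Longrightarrow> (\<And>j. j < n \<Longrightarrow> v j = 0)"
  shows "detfun n A \<noteq> 0"
proof
  let ?A = "Matrix.mat n n (\<lambda>(i, j). A i j)"
  assume "detfun n A = 0"
  then obtain v where v: "v \<in> carrier_vec n" "v \<noteq> 0\<^sub>v n" "?A *\<^sub>v v = 0\<^sub>v n"
    using det_0_iff_vec_prod_zero_field[of ?A n] by (auto simp: detfun_def)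
  have "(\<Sum>j<n. A i j * vec_index v j) = 0" if "i < n" for i
  proof -
    have "vec_index (?A *\<^sub>v v) i = (\<Sum>j<n. A i j * vec_index v j)"
      using v(1) that by (auto simp: mult_mat_vec_def scalar_prod_def lessThan_atLeast0 intro!: sum.cong)
    then show ?thesis using v(3) that by simp
  qed
  then have "vec_index v j = 0" if "j < n" for j
    using assms[of "vec_index v"] that by blast
  then show False using v(1,2) by auto
qed

text \<open>
  The determinant is a polynomial in the entries.  Hence it inherits every property of functions that
  is preserved by sums and products, such as being \<open>k\<close> times differentiable or having a limit.
\<close>

lemma detfun_closed:
  fixes P :: "('x \<Rightarrow> real) \<Rightarrow> bool"
  assumes c: "\<And>c. P (\<lambda>_. c)" and add: "\<And>f g. P f \<Longrightarrow> P g \<Longrightarrow> P (\<lambda>x. f x + g x)"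
    and mult: "\<And>f g. P f \<Longrightarrow> P g \<Longrightarrow> P (\<lambda>x. f x * g x)"
    and A: "\<And>i j. i < n \<Longrightarrow> j < n \<Longrightarrow> P (\<lambda>x. A x i j)"
  shows "P (\<lambda>x. detfun n (A x))"
proof -
  have sum: "P (\<lambda>x. \<Sum>i\<in>I. f i x)" if "\<And>i. i \<in> I \<Longrightarrow> P (f i)" for I :: "(nat \<Rightarrow> nat) set" and f
    using that by (induction I rule: infinite_finite_induct) (auto intro: c add)
  have prod: "P (\<lambda>x. \<Prod>i\<in>I. f i x)" if "\<And>i. i \<in> I \<Longrightarrow> P (f i)" for I :: "nat set" and f
    using that by (induction I rule: infinite_finite_induct) (auto intro: c mult)
  have eq: "detfun n (A x) = (\<Sum>p | p permutes {0..<n}. signof p * (\<Prod>i = 0..<n. A x i (p i)))" for x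
    unfolding detfun_def
    by (subst det_def'[where n = n]) (auto intro!: sum.cong prod.cong dest: permutes_in_image)
  show ?thesis unfolding eq
    by (intro sum mult prod c A) (auto dest: permutes_in_image)
qed

text \<open>
  The entries of the adjugate are signed minors, so \<open>detfun_closed\<close> applies.
\<close>

lemma adjfun_closed:
  fixes P :: "('x \<Rightarrow> real) \<Rightarrow> bool"
  assumes c: "\<And>c. P (\<lambda>_. c)" and add: "\<And>f g. P f \<Longrightarrow> P g \<Longrightarrow> P (\<lambda>x. f x + g x)"
    and mult: "\<And>f g. P f \<Longrightarrow> P g \<Longrightarrow> P (\<lambda>x. f x * g x)"
    and A: "\<And>i j. i < n \<Longrightarrow> j < n \<Longrightarrow> P (\<lambda>x. A x i j)" and kl: "k < n" "l < n"
  shows "P (\<lambda>x. adjfun n (A x) k l)"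
proof -
  let ?B = "\<lambda>x i j. A x (if i < l then i else Suc i) (if j < k then j else Suc j)"
  have "adjfun n (A x) k l = (-1) ^ (l + k) * detfun (n - 1) (?B x)" for x
  proof -
    have "mat_delete (Matrix.mat n n (\<lambda>(i, j). A x i j)) l k = Matrix.mat (n - 1) (n - 1) (\<lambda>(i, j). ?B x i j)"
      by (rule eq_matI) (auto simp: mat_delete_def)
    then show ?thesis using kl by (simp add: adjfun_def adj_mat_def cofactor_def detfun_def)
  qed
  moreover have "P (\<lambda>x. (-1) ^ (l + k) * detfun (n - 1) (?B x))"
    by (intro mult c detfun_closed[where P = P] add A) auto
  ultimately show ?thesis by simp
qed

section \<open>Smooth maps and their inverses\<close>

lemma smooth_map_on_cong:
  assumes "openin (Euclidean_space d) U" "\<And>x i. x \<in> U \<Longrightarrow> i < e \<Longrightarrow> F x i = G x i" "smooth_map_on d e U F"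
  shows "smooth_map_on d e U G"
  using assms Ck_on_cong[OF assms(1), of "\<lambda>x. F x i" "\<lambda>x. G x i" for i] by (auto simp: smooth_map_on_def)

lemma smooth_map_on_subset: "V \<subseteq> U \<Longrightarrow> smooth_map_on d e U F \<Longrightarrow> smooth_map_on d e V F"
  by (auto simp: smooth_map_on_def intro: Ck_on_subset)

lemma smooth_map_on_compose:
  assumes "openin (Euclidean_space d) U" "openin (Euclidean_space e) V" "G ` U \<subseteq> V"
    "smooth_map_on d e U G" "smooth_map_on e c V F"
  shows "smooth_map_on d c U (F \<circ> G)"
  unfolding smooth_map_on_def
proof (intro allI impI)
  fix i k assume "i < c"
  then have "Ck_on d k U (\<lambda>x. F (G x) i)"
    using Ck_on_compose[OF assms(1-3), of k "\<lambda>y. F y i"] assms(4,5) unfolding smooth_map_on_def by blast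
  then show "Ck_on d k U (\<lambda>x. (F \<circ> G) x i)" by simp
qed

lemma smooth_map_on_continuous:
  assumes U: "openin (Euclidean_space d) U" and F: "smooth_map_on d e U F" "F ` U \<subseteq> ES e"
  shows "continuous_on U F"
  using continuous_on_ES_coords[OF _ F(2)] Ck_on_imp_continuous_on[OF U, of 0] F(1)
  by (metis smooth_map_on_def)

lemma smooth_map_on_continuous_map:
  assumes U: "openin (Euclidean_space d) U" and F: "smooth_map_on d e U F" "F ` U \<subseteq> ES e"
  shows "continuous_map (subtopology (Euclidean_space d) U) (Euclidean_space e) F"
  using smooth_map_on_continuous[OF assms] continuous_map_ES_ES[OF openin_ES_subset[OF U]] F(2) by blast

lemma smooth_map_on_Union:
  assumes "\<And>x. x \<in> U \<Longrightarrow> \<exists>V. openin (Euclidean_space d) V \<and> x \<in> V \<and> V \<subseteq> U \<and> smooth_map_on d e V F"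
  shows "smooth_map_on d e U F"
  unfolding smooth_map_on_def
proof (intro allI impI)
  fix i k assume "i < e"
  show "Ck_on d k U (\<lambda>x. F x i)"
    by (rule Ck_on_Union) (use assms \<open>i < e\<close> in \<open>unfold smooth_map_on_def, meson\<close>)
qed

text \<open>
  The image is open by invariance of domain, which also makes the inverse \<open>g\<close> continuous.  Writing
  \<open>F y - F x = Q(y) (y - x)\<close> with \<open>Q\<close> as in \<open>C1_Caratheodory\<close> and solving for \<open>y - x\<close> by Cramer's
  rule shows that the partial derivatives of \<open>g\<close> are the entries of the inverse Jacobian, evaluated at
  \<open>g\<close>.  These are rational functions of the partial derivatives of \<open>F\<close>, so \<open>g\<close> is as often
  differentiable as one wishes, by induction on the order.
\<close>

theorem inverse_map_smooth:
  assumes U: "openin (Euclidean_space n) U" and F: "smooth_map_on n n U F" "F ` U \<subseteq> ES n"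
    and inj: "inj_on F U"
    and jac: "\<And>x v. x \<in> U \<Longrightarrow> (\<And>i. i < n \<Longrightarrow> (\<Sum>j<n. partial_deriv j (\<lambda>y. F y i) x * v j) = 0)
        \<Longrightarrow> (\<And>j. j < n \<Longrightarrow> v j = 0)"
  shows "openin (Euclidean_space n) (F ` U)" and "smooth_map_on n n (F ` U) (inv_into U F)"
proof -
  let ?V = "F ` U" and ?g = "inv_into U F"
  note cF = smooth_map_on_continuous[OF U F] and cmF = smooth_map_on_continuous_map[OF U F]
  show V: "openin (Euclidean_space n) ?V"
    by (rule invariance_of_domain_Euclidean_space[OF U cmF inj])
  have gF: "?g (F x) = x" if "x \<in> U" for x using inj that by simp
  have Fg: "F (?g z) = z" "?g z \<in> U" if "z \<in> ?V" for z
    using that by (auto simp: f_inv_into_f inv_into_into)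
  have "openin (top_of_set ?V) (F ` S)" if S: "openin (top_of_set U) S" for S
  proof -
    have SU: "openin (Euclidean_space n) S" "S \<subseteq> U"
      using S U subtopology_ES[OF openin_ES_subset[OF U]] by (metis openin_open_subtopology)+
    have "openin (Euclidean_space n) (F ` S)"
      using smooth_map_on_subset[OF SU(2) F(1)] F(2) SU inj_on_subset[OF inj SU(2)]
      by (intro invariance_of_domain_Euclidean_space[OF SU(1)] smooth_map_on_continuous_map) auto
    then show ?thesis
      using SU(2) V subtopology_ES[OF openin_ES_subset[OF V]] by (metis openin_open_subtopology image_mono)
  qed
  then have cg: "continuous_on ?V ?g"
    by (intro continuous_on_inverse_open_map[OF cF refl]) (auto simp: gF)
  define A where "A x i j = partial_deriv j (\<lambda>y. F y i) x" for x i j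
  define B where "B l k x = adjfun n (A x) l k / detfun n (A x)" for l k x
  have nz: "detfun n (A x) \<noteq> 0" if "x \<in> U" for x
    by (rule detfun_nonzero) (use jac[OF that] in \<open>simp add: A_def\<close>)
  have CA: "Ck_on n k U (\<lambda>x. A x i j)" if "i < n" "j < n" for i j k
  proof -
    have "Ck_on n (Suc k) U (\<lambda>y. F y i)" using F(1) that by (simp only: smooth_map_on_def)
    from Ck_on_Suc_partial(1)[OF this that(2)] show ?thesis unfolding A_def .
  qed
  have CB: "Ck_on n k U (B l m)" if "l < n" "m < n" for l m k
    unfolding B_def
    by (intro Ck_on_divide[OF U nz] detfun_closed[where P = "Ck_on n k U"] adjfun_closed[where P = "Ck_on n k U"])
       (use that CA Ck_on_const[OF U] Ck_on_add[OF U] Ck_on_mult[OF U] in auto)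
  have D: "((\<lambda>t. ?g (z(k := t)) l) has_real_derivative B l k (?g z)) (at (z k))"
    if z: "z \<in> ?V" and k: "k < n" and l: "l < n" for z k l
  proof -
    let ?x = "?g z" and ?y = "\<lambda>t. ?g (z(k := t))"
    have x: "?x \<in> U" using Fg z by blast
    have "\<forall>i. \<exists>q \<delta>. i < n \<longrightarrow> \<delta> > 0 \<and> (\<forall>j<n. continuous (at ?x within U) (q j) \<and> q j ?x = A ?x i j) \<and>
       (\<forall>y\<in>U. (\<forall>j<n. \<bar>y j - ?x j\<bar> < \<delta>) \<longrightarrow> F y i - F ?x i = (\<Sum>j<n. q j y * (y j - ?x j)))"
    proof
      fix i show "\<exists>q \<delta>. i < n \<longrightarrow> \<delta> > 0 \<and> (\<forall>j<n. continuous (at ?x within U) (q j) \<and> q j ?x = A ?x i j) \<and>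
       (\<forall>y\<in>U. (\<forall>j<n. \<bar>y j - ?x j\<bar> < \<delta>) \<longrightarrow> F y i - F ?x i = (\<Sum>j<n. q j y * (y j - ?x j)))"
      proof (cases "i < n")
        case True
        then have "Ck_on n 1 U (\<lambda>y. F y i)" using F(1) by (simp only: smooth_map_on_def)
        from C1_Caratheodory[OF U this x] show ?thesis unfolding A_def by blast
      qed auto
    qed
    from choice[OF this] obtain Q where "\<forall>i. \<exists>\<delta>. i < n \<longrightarrow> \<delta> > 0 \<and>
       (\<forall>j<n. continuous (at ?x within U) (Q i j) \<and> Q i j ?x = A ?x i j) \<and>
       (\<forall>y\<in>U. (\<forall>j<n. \<bar>y j - ?x j\<bar> < \<delta>) \<longrightarrow> F y i - F ?x i = (\<Sum>j<n. Q i j y * (y j - ?x j)))" by blast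
    from choice[OF this] obtain \<delta> where \<delta>: "\<And>i. i < n \<Longrightarrow> \<delta> i > 0"
      and Q: "\<And>i j. i < n \<Longrightarrow> j < n \<Longrightarrow> continuous (at ?x within U) (Q i j) \<and> Q i j ?x = A ?x i j"
      and QF: "\<And>i y. i < n \<Longrightarrow> y \<in> U \<Longrightarrow> (\<forall>j<n. \<bar>y j - ?x j\<bar> < \<delta> i) \<Longrightarrow>
         F y i - F ?x i = (\<Sum>j<n. Q i j y * (y j - ?x j))"
      by blast
    have ev: "\<forall>\<^sub>F t in at (z k). z(k := t) \<in> ?V"
      using eventually_fun_upd[OF V z k] by (auto simp: eventually_at_filter elim!: eventually_mono)
    then have evU: "\<forall>\<^sub>F t in at (z k). ?y t \<in> U"
      by (rule eventually_mono) (use Fg in blast)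
    have limz: "tendsto (\<lambda>t. z(k := t)) z (at (z k))"
      using continuous_on_fun_upd[of UNIV z k]
      by (metis UNIV_I continuous_on_def fun_upd_triv)
    have limy: "tendsto ?y ?x (at (z k))"
      by (rule continuous_within_tendsto_compose[OF _ ev limz])
         (use cg z in \<open>metis continuous_on_eq_continuous_within\<close>)
    have limyj: "tendsto (\<lambda>t. ?y t j) (?x j) (at (z k))" for j
    proof -
      have "isCont (\<lambda>y. y j) ?x"
        using continuous_on_coord[of UNIV j] continuous_on_eq_continuous_at[OF open_UNIV] by blast
      then show ?thesis using limy by (rule isCont_tendsto_compose)
    qed
    have limQ: "tendsto (\<lambda>t. Q i j (?y t)) (A ?x i j) (at (z k))" if "i < n" "j < n" for i j
      using continuous_within_tendsto_compose[OF _ evU limy, of "Q i j"] Q[OF that] by auto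
    have limdet: "tendsto (\<lambda>t. detfun n (\<lambda>i j. Q i j (?y t))) (detfun n (A ?x)) (at (z k))"
    proof -
      \<comment> \<open>\<open>None\<close> stands for the limit, so that value and limit are treated as one function\<close>
      have "\<exists>l. (\<lambda>t. detfun n (case_option (A ?x) (\<lambda>t i j. Q i j (?y t)) t)) None = l \<and>
          tendsto (\<lambda>t. detfun n (case_option (A ?x) (\<lambda>t i j. Q i j (?y t)) (Some t))) l (at (z k))"
        by (rule detfun_closed[where P = "\<lambda>f. \<exists>l. f None = l \<and> tendsto (\<lambda>t. f (Some t)) l (at (z k))"])
           (auto intro!: tendsto_intros limQ)
      then show ?thesis by simp
    qed
    have "\<forall>\<^sub>F t in at (z k). \<forall>i\<in>{..<n}. \<forall>j\<in>{..<n}. \<bar>?y t j - ?x j\<bar> < \<delta> i"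
      using limyj \<delta> by (intro eventually_ball_finite ballI) (auto simp: tendsto_iff dist_real_def)
    moreover have "\<forall>\<^sub>F t in at (z k). detfun n (\<lambda>i j. Q i j (?y t)) \<noteq> 0"
      by (rule tendsto_imp_eventually_ne[OF limdet nz[OF x]])
    moreover have "\<forall>\<^sub>F t in at (z k). t \<noteq> z k" by (simp add: eventually_at_filter)
    ultimately have eq: "\<forall>\<^sub>F t in at (z k). adjfun n (\<lambda>i j. Q i j (?y t)) l k / detfun n (\<lambda>i j. Q i j (?y t))
        = (?y t l - ?x l) / (t - z k)"
      using ev evU
    proof eventually_elim
      case (elim t)
      have "(\<Sum>j<n. Q i j (?y t) * (?y t j - ?x j)) = (if i = k then t - z k else 0)" if "i < n" for i
        using QF[OF that elim(5)] elim(1,4) that Fg(1)[OF z] Fg(1)[OF elim(4)] by auto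
      from adjfun_solve[OF this l] have "detfun n (\<lambda>i j. Q i j (?y t)) * (?y t l - ?x l) =
          (\<Sum>j<n. adjfun n (\<lambda>i j. Q i j (?y t)) l j * (if j = k then t - z k else 0))" by simp
      also have "\<dots> = adjfun n (\<lambda>i j. Q i j (?y t)) l k * (t - z k)"
        using k by (subst sum.remove[of _ k]) auto
      finally show ?case using elim(2,3) by (simp add: field_simps)
    qed
    have "tendsto (\<lambda>t. adjfun n (\<lambda>i j. Q i j (?y t)) l k) (adjfun n (A ?x) l k) (at (z k))"
    proof -
      have "\<exists>b. (\<lambda>t. adjfun n (case_option (A ?x) (\<lambda>t i j. Q i j (?y t)) t) l k) None = b \<and>
          tendsto (\<lambda>t. adjfun n (case_option (A ?x) (\<lambda>t i j. Q i j (?y t)) (Some t)) l k) b (at (z k))"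
        by (rule adjfun_closed[where P = "\<lambda>f. \<exists>l. f None = l \<and> tendsto (\<lambda>t. f (Some t)) l (at (z k))"])
           (auto intro!: tendsto_intros limQ k l)
      then show ?thesis by simp
    qed
    then have "tendsto (\<lambda>t. adjfun n (\<lambda>i j. Q i j (?y t)) l k / detfun n (\<lambda>i j. Q i j (?y t)))
        (B l k ?x) (at (z k))"
      unfolding B_def by (rule tendsto_divide[OF _ limdet nz[OF x]])
    then show ?thesis
      unfolding has_field_derivative_iff fun_upd_triv
      by (rule Lim_transform_eventually) (use eq in simp)
  qed
  have gU: "?g ` ?V \<subseteq> U" using Fg by blast
  have "\<forall>l<n. Ck_on n k ?V (\<lambda>z. ?g z l)" for k
  proof (induction k)
    case 0
    have "continuous_on ?V (\<lambda>z. ?g z l)" for l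
      by (rule continuous_on_product_then_coordinatewise[OF cg])
    then show ?case using continuous_map_ES_real[OF openin_ES_subset[OF V]] by simp
  next
    case (Suc k)
    have "Ck_on n (Suc k) ?V (\<lambda>z. ?g z l)" if "l < n" for l
    proof (rule Ck_on_SucI[OF V, where g = "\<lambda>i z. B l i (?g z)"])
      show "continuous_on ?V (\<lambda>z. ?g z l)"
        by (rule continuous_on_product_then_coordinatewise[OF cg])
      show "((\<lambda>t. ?g (x(i := t)) l) has_real_derivative B l i (?g x)) (at (x i))" if "i < n" "x \<in> ?V" for i x
        by (rule D[OF that(2,1) \<open>l < n\<close>])
      show "Ck_on n k ?V (\<lambda>z. B l i (?g z))" if "i < n" for i
        by (rule Ck_on_compose[OF V U gU]) (use Suc.IH CB[OF \<open>l < n\<close> that] in auto)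
    qed
    then show ?case by blast
  qed
  then show "smooth_map_on n n ?V ?g" by (simp add: smooth_map_on_def)
qed

section \<open>Charts of a maximal atlas\<close>

lemma is_chartD:
  assumes "is_chart n M (V, k)"
  shows "openin M V" "openin (Euclidean_space n) (k ` V)" "inj_on k V" "k ` V \<subseteq> ES n"
    and "continuous_map (subtopology M V) (Euclidean_space n) k"
    and "\<And>W. openin M W \<Longrightarrow> W \<subseteq> V \<Longrightarrow> openin (Euclidean_space n) (k ` W)"
    and "\<And>X. openin (Euclidean_space n) X \<Longrightarrow> openin M {p \<in> V. k p \<in> X}"
proof -
  have h: "homeomorphic_map (subtopology M V) (subtopology (Euclidean_space n) (k ` V)) k"
    and V: "openin M V" and kV: "openin (Euclidean_space n) (k ` V)"
    using assms by (auto simp: is_chart_def)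
  then show "openin M V" "openin (Euclidean_space n) (k ` V)" by auto
  show "k ` V \<subseteq> ES n" by (rule openin_ES_subset[OF kV])
  have tV: "topspace (subtopology M V) = V" using openin_subset[OF V] by auto
  show "inj_on k V"
    using homeomorphic_imp_injective_map[OF h] tV by simp
  show c: "continuous_map (subtopology M V) (Euclidean_space n) k"
    using homeomorphic_imp_continuous_map[OF h] continuous_map_into_fulltopology by blast
  show "openin (Euclidean_space n) (k ` W)" if "openin M W" "W \<subseteq> V" for W
  proof -
    have "openin (subtopology M V) W" using that V by (simp add: openin_open_subtopology)
    then have "openin (subtopology (Euclidean_space n) (k ` V)) (k ` W)"
      using homeomorphic_imp_open_map[OF h] by (simp add: open_map_def)
    then show ?thesis using kV openin_trans_full by blast
  qed
  show "openin M {p \<in> V. k p \<in> X}" if "openin (Euclidean_space n) X" for X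
  proof -
    have "openin (subtopology M V) {p \<in> topspace (subtopology M V). k p \<in> X}"
      by (rule openin_continuous_map_preimage[OF c that])
    then show ?thesis using V tV openin_trans_full by metis
  qed
qed

lemma is_chartI:
  assumes V: "openin M V" and inj: "inj_on k V"
    and c: "\<And>X. openin (Euclidean_space n) X \<Longrightarrow> openin M {p \<in> V. k p \<in> X}"
    and op: "\<And>W. openin M W \<Longrightarrow> W \<subseteq> V \<Longrightarrow> openin (Euclidean_space n) (k ` W)"
  shows "is_chart n M (V, k)"
proof -
  have tV: "topspace (subtopology M V) = V" using openin_subset[OF V] by auto
  have kV: "openin (Euclidean_space n) (k ` V)" by (rule op[OF V order_refl])
  then have "k ` V \<subseteq> ES n" by (rule openin_ES_subset)
  then have tk: "topspace (subtopology (Euclidean_space n) (k ` V)) = k ` V" by auto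
  have "homeomorphic_map (subtopology M V) (subtopology (Euclidean_space n) (k ` V)) k"
  proof (rule bijective_open_imp_homeomorphic_map)
    have "continuous_map (subtopology M V) (Euclidean_space n) k"
      unfolding continuous_map tV
      using c V \<open>k ` V \<subseteq> ES n\<close> by (auto simp: openin_open_subtopology)
    then show "continuous_map (subtopology M V) (subtopology (Euclidean_space n) (k ` V)) k"
      by (rule continuous_map_into_subtopology) (auto simp: tV)
    show "open_map (subtopology M V) (subtopology (Euclidean_space n) (k ` V)) k"
      using op V kV by (auto simp: open_map_def openin_open_subtopology)
    show "k ` topspace (subtopology M V) = topspace (subtopology (Euclidean_space n) (k ` V))"
      unfolding tV tk ..
    show "inj_on k (topspace (subtopology M V))" unfolding tV by (rule inj)
  qed
  then show ?thesis using V kV by (simp add: is_chart_def)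
qed

text \<open>
  The last part is the maximality of the atlas, the only way to obtain new charts.
\<close>

lemma smooth_structureD:
  assumes "smooth_structure n M \<A>"
  shows "c \<in> \<A> \<Longrightarrow> is_chart n M c"
    and "p \<in> topspace M \<Longrightarrow> \<exists>V k. (V, k) \<in> \<A> \<and> p \<in> V"
    and "(V, k) \<in> \<A> \<Longrightarrow> (V', k') \<in> \<A> \<Longrightarrow> smooth_map_on n n (k ` (V \<inter> V')) (k' \<circ> inv_into V k)"
    and "is_chart n M c \<Longrightarrow> (\<And>c'. c' \<in> \<A> \<Longrightarrow> smooth_transition n c c') \<Longrightarrow>
         (\<And>c'. c' \<in> \<A> \<Longrightarrow> smooth_transition n c' c) \<Longrightarrow> c \<in> \<A>"
proof -
  have *: "\<forall>c\<in>\<A>. is_chart n M c" "topspace M = (\<Union>c\<in>\<A>. fst c)"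
    "\<forall>c\<in>\<A>. \<forall>c'\<in>\<A>. smooth_compatible n c c'"
    "\<forall>c. is_chart n M c \<and> (\<forall>c'\<in>\<A>. smooth_compatible n c c') \<longrightarrow> c \<in> \<A>"
    using assms unfolding smooth_structure_def by blast+
  show "c \<in> \<A> \<Longrightarrow> is_chart n M c" using *(1) by blast
  show "p \<in> topspace M \<Longrightarrow> \<exists>V k. (V, k) \<in> \<A> \<and> p \<in> V"
    unfolding *(2) by (metis UN_E prod.collapse)
  show "(V, k) \<in> \<A> \<Longrightarrow> (V', k') \<in> \<A> \<Longrightarrow> smooth_map_on n n (k ` (V \<inter> V')) (k' \<circ> inv_into V k)"
    using *(3) by (fastforce simp: smooth_compatible_def smooth_transition_def)
  show "is_chart n M c \<Longrightarrow> (\<And>c'. c' \<in> \<A> \<Longrightarrow> smooth_transition n c c') \<Longrightarrow>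
         (\<And>c'. c' \<in> \<A> \<Longrightarrow> smooth_transition n c' c) \<Longrightarrow> c \<in> \<A>"
    using *(4) unfolding smooth_compatible_def by blast
qed

text \<open>
  In each chart \<open>h\<close> the map \<open>h \<circ> f\<close> is a smooth injection between open sets of the same dimension
  with invertible Jacobian, so \<open>inverse_map_smooth\<close> applies to it.
\<close>

lemma embedding_chart:
  assumes S: "smooth_structure n M \<A>" and U: "openin (Euclidean_space n) U"
    and f: "smooth_embedding n n M \<A> U f"
  shows "(f ` U, inv_into U f) \<in> \<A>"
proof -
  let ?g = "inv_into U f"
  have tU: "topspace (subtopology (Euclidean_space n) U) = U" using openin_ES_subset[OF U] by auto
  have emb: "embedding_map (subtopology (Euclidean_space n) U) M f"
    using f by (simp add: smooth_embedding_def)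
  then have inj: "inj_on f U"
    using homeomorphic_imp_injective_map unfolding embedding_map_def by (metis tU)
  have cont: "continuous_map (subtopology (Euclidean_space n) U) M f"
    using homeomorphic_imp_continuous_map continuous_map_into_fulltopology emb
    unfolding embedding_map_def by blast
  then have fM: "f ` U \<subseteq> topspace M" using continuous_map_image_subset_topspace[OF cont] tU by simp
  have pre: "openin (Euclidean_space n) (U \<inter> f -` V)" if "openin M V" for V
  proof -
    have "openin (subtopology (Euclidean_space n) U) {x \<in> topspace (subtopology (Euclidean_space n) U). f x \<in> V}"
      by (rule openin_continuous_map_preimage[OF cont that])
    moreover have "{x \<in> topspace (subtopology (Euclidean_space n) U). f x \<in> V} = U \<inter> f -` V"
      unfolding tU by blast
    ultimately show ?thesis using U openin_trans_full by metis
  qed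
  have *: "smooth_map_on n n (U \<inter> f -` V) (h \<circ> f) \<and> (h \<circ> f) ` (U \<inter> f -` V) \<subseteq> ES n \<and> inj_on (h \<circ> f) (U \<inter> f -` V)
     \<and> openin (Euclidean_space n) (U \<inter> f -` V)"
    "openin (Euclidean_space n) ((h \<circ> f) ` (U \<inter> f -` V))"
    "smooth_map_on n n ((h \<circ> f) ` (U \<inter> f -` V)) (inv_into (U \<inter> f -` V) (h \<circ> f))"
    if Vh: "(V, h) \<in> \<A>" for V h
  proof -
    note ch = is_chartD[OF smooth_structureD(1)[OF S Vh]]
    have sm: "smooth_map_on n n (U \<inter> f -` V) (h \<circ> f)"
      and jac: "\<And>x v. x \<in> U \<inter> f -` V \<Longrightarrow> \<forall>i<n. (\<Sum>j<n. partial_deriv j (\<lambda>y. h (f y) i) x * v j) = 0 \<Longrightarrow> \<forall>j<n. v j = 0"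
      using f Vh unfolding smooth_embedding_def by fast+
    have im: "(h \<circ> f) ` (U \<inter> f -` V) \<subseteq> ES n" using ch(4) by auto
    have ij: "inj_on (h \<circ> f) (U \<inter> f -` V)"
      by (rule comp_inj_on) (use inj ch(3) in \<open>auto intro: inj_on_subset\<close>)
    show "smooth_map_on n n (U \<inter> f -` V) (h \<circ> f) \<and> (h \<circ> f) ` (U \<inter> f -` V) \<subseteq> ES n \<and> inj_on (h \<circ> f) (U \<inter> f -` V)
     \<and> openin (Euclidean_space n) (U \<inter> f -` V)"
      using sm im ij pre[OF ch(1)] by blast
    show "openin (Euclidean_space n) ((h \<circ> f) ` (U \<inter> f -` V))"
      "smooth_map_on n n ((h \<circ> f) ` (U \<inter> f -` V)) (inv_into (U \<inter> f -` V) (h \<circ> f))"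
      using inverse_map_smooth[OF pre[OF ch(1)] sm im ij] jac by (auto simp: o_def)
  qed
  have op: "openin M (f ` X)" if X: "openin (Euclidean_space n) X" "X \<subseteq> U" for X
  proof (subst openin_subopen, intro ballI)
    fix p assume "p \<in> f ` X"
    then obtain x where x: "x \<in> X" "p = f x" by blast
    then obtain V h where Vh: "(V, h) \<in> \<A>" "p \<in> V" using smooth_structureD(2)[OF S] fM X by blast
    note ch = is_chartD[OF smooth_structureD(1)[OF S Vh(1)]]
    let ?Y = "X \<inter> (U \<inter> f -` V)"
    have Y: "openin (Euclidean_space n) ?Y" using X pre[OF ch(1)] by blast
    have "openin (Euclidean_space n) ((h \<circ> f) ` ?Y)"
      using *(1)[OF Vh(1)]
      by (intro invariance_of_domain_Euclidean_space[OF Y] smooth_map_on_continuous_map[OF Y])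
         (auto intro: smooth_map_on_subset inj_on_subset)
    then have "openin M {q \<in> V. h q \<in> (h \<circ> f) ` ?Y}" by (rule ch(7))
    moreover have "{q \<in> V. h q \<in> (h \<circ> f) ` ?Y} = f ` ?Y"
      using ch(3) by (auto dest: inj_onD)
    ultimately show "\<exists>T. openin M T \<and> p \<in> T \<and> T \<subseteq> f ` X"
      using x Vh X by (intro exI[of _ "f ` ?Y"]) auto
  qed
  have gf: "?g (f x) = x" if "x \<in> U" for x using inj that by simp
  have chart: "is_chart n M (f ` U, ?g)"
  proof (rule is_chartI)
    show "openin M (f ` U)" by (rule op[OF U order_refl])
    show "inj_on ?g (f ` U)" by (rule inj_on_inv_into) simp
    show "openin M {p \<in> f ` U. ?g p \<in> X}" if X: "openin (Euclidean_space n) X" for X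
    proof -
      have "{p \<in> f ` U. ?g p \<in> X} = f ` (U \<inter> X)" using gf by auto
      then show ?thesis using op[of "U \<inter> X"] U X by auto
    qed
    show "openin (Euclidean_space n) (?g ` W)" if W: "openin M W" "W \<subseteq> f ` U" for W
    proof -
      have "?g ` W = U \<inter> f -` W" using gf W(2) by (auto simp: image_iff intro!: inv_into_into) (metis gf)
      then show ?thesis using pre[OF W(1)] by simp
    qed
  qed
  show ?thesis
  proof (rule smooth_structureD(4)[OF S chart])
    fix c' assume "c' \<in> \<A>"
    then obtain V h where c': "c' = (V, h)" and Vh: "(V, h) \<in> \<A>" by (cases c') auto
    note ch = is_chartD[OF smooth_structureD(1)[OF S Vh]]
    note s = *[OF Vh]
    have im: "?g ` (f ` U \<inter> V) = U \<inter> f -` V"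
    proof safe
      fix x assume "x \<in> U" "f x \<in> V"
      then show "x \<in> ?g ` (f ` U \<inter> V)" using gf by (intro image_eqI[of _ _ "f x"]) auto
    qed (use gf in auto)
    have inv: "inv_into (f ` U) ?g x = f x" if "x \<in> U" for x
      using gf[OF that] that by (metis imageI inj_on_inv_into inv_into_f_f order_refl)
    show "smooth_transition n (f ` U, ?g) c'"
      unfolding c' smooth_transition_def prod.case im
      by (rule smooth_map_on_cong[of _ _ _ "h \<circ> f"]) (use s(1) inv in auto)
    have im2: "h ` (V \<inter> f ` U) = (h \<circ> f) ` (U \<inter> f -` V)" by auto
    show "smooth_transition n c' (f ` U, ?g)"
      unfolding c' smooth_transition_def prod.case im2
    proof (rule smooth_map_on_cong[OF s(2) _ s(3)])
      fix x i assume "x \<in> (h \<circ> f) ` (U \<inter> f -` V)"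
      then obtain u where u: "u \<in> U" "f u \<in> V" "x = h (f u)" by auto
      have "inv_into (U \<inter> f -` V) (h \<circ> f) x = u"
        using inv_into_f_f[of "h \<circ> f" "U \<inter> f -` V" u] s(1) u by simp
      moreover have "inv_into V h x = f u" using inv_into_f_f[OF ch(3)] u by simp
      ultimately show "inv_into (U \<inter> f -` V) (h \<circ> f) x i = (?g \<circ> inv_into V h) x i"
        using gf u by simp
    qed
  qed
qed

text \<open>
  The inverse is part of the data because all functions are total: \<open>F\<close> and \<open>G\<close> are inverse to each
  other only between \<open>X\<close> and \<open>Y\<close>.
\<close>

definition diffeo :: "nat \<Rightarrow> (nat \<Rightarrow> real) set \<Rightarrow> (nat \<Rightarrow> real) set \<Rightarrow>
    ((nat \<Rightarrow> real) \<Rightarrow> nat \<Rightarrow> real) \<Rightarrow> ((nat \<Rightarrow> real) \<Rightarrow> nat \<Rightarrow> real) \<Rightarrow> bool" where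
  "diffeo n X Y F G \<longleftrightarrow> openin (Euclidean_space n) X \<and> openin (Euclidean_space n) Y \<and>
     F ` X \<subseteq> Y \<and> G ` Y \<subseteq> X \<and> (\<forall>x\<in>X. G (F x) = x) \<and> (\<forall>y\<in>Y. F (G y) = y) \<and>
     smooth_map_on n n X F \<and> smooth_map_on n n Y G"

lemma diffeo_sym: "diffeo n X Y F G \<Longrightarrow> diffeo n Y X G F"
  by (auto simp: diffeo_def)

lemma chart_compose_diffeo:
  assumes S: "smooth_structure n M \<A>" and V: "(V, k) \<in> \<A>" and W: "openin M W" "W \<subseteq> V"
    and d: "diffeo n (k ` W) Y F G"
  shows "(W, F \<circ> k) \<in> \<A>"
proof -
  note ch = is_chartD[OF smooth_structureD(1)[OF S V]]
  have X: "openin (Euclidean_space n) (k ` W)" and Y: "openin (Euclidean_space n) Y"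
    and FX: "F ` k ` W \<subseteq> Y" and GY: "G ` Y \<subseteq> k ` W"
    and GF: "\<And>p. p \<in> W \<Longrightarrow> G (F (k p)) = k p" and FG: "\<And>y. y \<in> Y \<Longrightarrow> F (G y) = y"
    and sF: "smooth_map_on n n (k ` W) F" and sG: "smooth_map_on n n Y G"
    using d by (auto simp: diffeo_def)
  have YE: "Y \<subseteq> ES n" using openin_ES_subset[OF Y] .
  have injk: "inj_on k W" using ch(3) W(2) by (rule inj_on_subset)
  have injF: "inj_on F (k ` W)" by (rule inj_onI) (metis GF image_iff)
  have inj: "inj_on (F \<circ> k) W" using injk injF by (rule comp_inj_on)
  have cF: "continuous_map (subtopology (Euclidean_space n) (k ` W)) (Euclidean_space n) F"
    using sF FX YE by (intro smooth_map_on_continuous_map[OF X]) auto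
  have cG: "continuous_map (subtopology (Euclidean_space n) Y) (Euclidean_space n) G"
    using sG GY openin_ES_subset[OF X] by (intro smooth_map_on_continuous_map[OF Y]) auto
  have preF: "openin (Euclidean_space n) {x \<in> k ` W. F x \<in> Z}" if "openin (Euclidean_space n) Z" for Z
  proof -
    have "topspace (subtopology (Euclidean_space n) (k ` W)) = k ` W"
      using openin_ES_subset[OF X] by auto
    then show ?thesis
      using openin_trans_full[OF openin_continuous_map_preimage[OF cF that] X] by simp
  qed
  have preG: "openin (Euclidean_space n) {x \<in> Y. G x \<in> Z}" if "openin (Euclidean_space n) Z" for Z
  proof -
    have "topspace (subtopology (Euclidean_space n) Y) = Y" using YE by auto
    then show ?thesis
      using openin_trans_full[OF openin_continuous_map_preimage[OF cG that] Y] by simp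
  qed
  have imF: "F ` k ` W' = {y \<in> Y. G y \<in> k ` W'}" if "W' \<subseteq> W" for W'
  proof safe
    fix p assume "p \<in> W'"
    then show "F (k p) \<in> Y" "G (F (k p)) \<in> k ` W'" using that FX GF by auto
  next
    fix y p assume "y \<in> Y" "G y = k p" "p \<in> W'"
    then have "y = F (k p)" using FG by metis
    then show "y \<in> F ` k ` W'" using \<open>p \<in> W'\<close> by blast
  qed
  have chart: "is_chart n M (W, F \<circ> k)"
  proof (rule is_chartI[OF W(1) inj])
    fix Z assume "openin (Euclidean_space n) Z"
    then have "openin M {p \<in> V. k p \<in> {x \<in> k ` W. F x \<in> Z}}" by (intro ch(7) preF)
    moreover have "{p \<in> V. k p \<in> {x \<in> k ` W. F x \<in> Z}} = {p \<in> W. (F \<circ> k) p \<in> Z}"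
      using ch(3) W(2) by (auto dest: inj_onD)
    ultimately show "openin M {p \<in> W. (F \<circ> k) p \<in> Z}" by simp
  next
    fix W' assume W': "openin M W'" "W' \<subseteq> W"
    then have "openin (Euclidean_space n) (k ` W')" using W(2) by (intro ch(6)) auto
    then show "openin (Euclidean_space n) ((F \<circ> k) ` W')"
      using preG[of "k ` W'"] imF[OF W'(2)] by (simp only: image_comp[symmetric])
  qed
  show ?thesis
  proof (rule smooth_structureD(4)[OF S chart])
    fix c' assume "c' \<in> \<A>"
    then obtain V' h where c': "c' = (V', h)" and Vh: "(V', h) \<in> \<A>" by (cases c') auto
    note ch' = is_chartD[OF smooth_structureD(1)[OF S Vh]]
    have op: "openin M (W \<inter> V')" using W(1) ch'(1) by blast
    have opk: "openin (Euclidean_space n) (k ` (W \<inter> V'))" using op W(2) by (intro ch(6)) auto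
    have opFk: "openin (Euclidean_space n) ((F \<circ> k) ` (W \<inter> V'))"
      using preG[OF opk] imF[OF inf_le1, of V'] by (simp only: image_comp[symmetric])
    have oph: "openin (Euclidean_space n) (h ` (V' \<inter> W))" using op by (intro ch'(6)) (auto simp: Int_commute)
    have "smooth_map_on n n ((F \<circ> k) ` (W \<inter> V')) ((h \<circ> inv_into V k) \<circ> G)"
    proof (rule smooth_map_on_compose[OF opFk opk])
      show "G ` (F \<circ> k) ` (W \<inter> V') \<subseteq> k ` (W \<inter> V')" using GF by auto
      show "smooth_map_on n n ((F \<circ> k) ` (W \<inter> V')) G"
        by (rule smooth_map_on_subset[OF _ sG]) (use FX in auto)
      show "smooth_map_on n n (k ` (W \<inter> V')) (h \<circ> inv_into V k)"
        by (rule smooth_map_on_subset[OF _ smooth_structureD(3)[OF S V Vh]]) (use W(2) in auto)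
    qed
    then show "smooth_transition n (W, F \<circ> k) c'"
      unfolding c' smooth_transition_def prod.case
    proof (rule smooth_map_on_cong[OF opFk, rotated])
      fix x i assume "x \<in> (F \<circ> k) ` (W \<inter> V')"
      then obtain p where p: "p \<in> W" "x = (F \<circ> k) p" by auto
      then have "inv_into W (F \<circ> k) x = p" using inv_into_f_f[OF inj] by simp
      moreover have "inv_into V k (G x) = p" using p GF W(2) inv_into_f_f[OF ch(3)] by auto
      ultimately show "((h \<circ> inv_into V k) \<circ> G) x i = (h \<circ> inv_into W (F \<circ> k)) x i" by simp
    qed
    have "smooth_map_on n n (h ` (V' \<inter> W)) (F \<circ> (k \<circ> inv_into V' h))"
    proof (rule smooth_map_on_compose[OF oph X _ _ sF])
      show "(k \<circ> inv_into V' h) ` h ` (V' \<inter> W) \<subseteq> k ` W"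
        using inv_into_f_f[OF ch'(3)] by auto
      show "smooth_map_on n n (h ` (V' \<inter> W)) (k \<circ> inv_into V' h)"
        by (rule smooth_map_on_subset[OF _ smooth_structureD(3)[OF S Vh V]]) (use W(2) in auto)
    qed
    then show "smooth_transition n c' (W, F \<circ> k)"
      unfolding c' smooth_transition_def prod.case by (simp add: comp_assoc)
  qed
qed

lemma diffeo_id: "openin (Euclidean_space n) X \<Longrightarrow> diffeo n X X (\<lambda>x. x) (\<lambda>x. x)"
  by (auto simp: diffeo_def smooth_map_on_def intro: Ck_on_coord)

lemma chart_restrict:
  assumes "smooth_structure n M \<A>" "(V, k) \<in> \<A>" "openin M W" "W \<subseteq> V"
  shows "(W, k) \<in> \<A>"
  using chart_compose_diffeo[OF assms diffeo_id] is_chartD(6)[OF smooth_structureD(1)[OF assms(1,2)]] assms(3,4)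
  by (simp add: o_def)

lemma chart_cong:
  assumes S: "smooth_structure n M \<A>" and V: "(V, k) \<in> \<A>" and eq: "\<And>p. p \<in> V \<Longrightarrow> k p = k' p"
  shows "(V, k') \<in> \<A>"
proof -
  note ch = is_chartD[OF smooth_structureD(1)[OF S V]]
  have im: "k' ` W = k ` W" if "W \<subseteq> V" for W using eq that by (intro image_cong) auto
  have inj: "inj_on k' V" using ch(3) eq inj_on_cong by metis
  have inv: "inv_into V k' x = inv_into V k x" if "x \<in> k ` V" for x
  proof -
    obtain p where p: "p \<in> V" "x = k p" using \<open>x \<in> k ` V\<close> by blast
    then show ?thesis using eq[OF p(1)] inv_into_f_f[OF inj p(1)] inv_into_f_f[OF ch(3) p(1)] by simp
  qed
  have "{p \<in> V. k' p \<in> X} = {p \<in> V. k p \<in> X}" for X using eq by auto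
  then have chart: "is_chart n M (V, k')"
    using ch im by (intro is_chartI inj) auto
  show ?thesis
  proof (rule smooth_structureD(4)[OF S chart])
    fix c' assume "c' \<in> \<A>"
    then obtain V' h where c': "c' = (V', h)" and Vh: "(V', h) \<in> \<A>" by (cases c') auto
    note ch' = is_chartD[OF smooth_structureD(1)[OF S Vh]]
    have op: "openin M (V \<inter> V')" using ch(1) ch'(1) by blast
    have i: "k' ` (V \<inter> V') = k ` (V \<inter> V')" by (rule im) auto
    show "smooth_transition n (V, k') c'"
      unfolding c' smooth_transition_def prod.case i
      by (rule smooth_map_on_cong[OF ch(6)[OF op] _ smooth_structureD(3)[OF S V Vh]]) (use inv in auto)
    show "smooth_transition n c' (V, k')"
      unfolding c' smooth_transition_def prod.case
    proof (rule smooth_map_on_cong[OF ch'(6) _ smooth_structureD(3)[OF S Vh V]])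
      fix x i assume "x \<in> h ` (V' \<inter> V)"
      then have "inv_into V' h x \<in> V" using inv_into_f_f[OF ch'(3)] by auto
      then show "(k \<circ> inv_into V' h) x i = (k' \<circ> inv_into V' h) x i" using eq by simp
    qed (use op in \<open>auto simp: Int_commute\<close>)
  qed
qed

text \<open>
  Openness and smoothness can be checked near each point; only injectivity is a global condition.
\<close>

lemma chart_glue:
  assumes S: "smooth_structure n M \<A>" and inj: "inj_on h C"
    and loc: "\<And>p. p \<in> C \<Longrightarrow> \<exists>N. p \<in> N \<and> N \<subseteq> C \<and> (N, h) \<in> \<A>"
  shows "(C, h) \<in> \<A>"
proof -
  obtain N where N: "\<And>p. p \<in> C \<Longrightarrow> p \<in> N p \<and> N p \<subseteq> C \<and> (N p, h) \<in> \<A>" using loc by metis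
  note ch = is_chartD[OF smooth_structureD(1)[OF S]]
  have C: "openin M C"
  proof (subst openin_subopen, intro ballI)
    fix p assume "p \<in> C"
    then show "\<exists>T. openin M T \<and> p \<in> T \<and> T \<subseteq> C"
      using N[of p] ch(1)[of "N p" h] by (intro exI[of _ "N p"]) auto
  qed
  have chart: "is_chart n M (C, h)"
  proof (rule is_chartI[OF C inj])
    fix X assume X: "openin (Euclidean_space n) X"
    show "openin M {p \<in> C. h p \<in> X}"
    proof (subst openin_subopen, intro ballI)
      fix p assume "p \<in> {p \<in> C. h p \<in> X}"
      then show "\<exists>T. openin M T \<and> p \<in> T \<and> T \<subseteq> {p \<in> C. h p \<in> X}"
        using N[of p] ch(7)[of "N p" h, OF _ X] by (intro exI[of _ "{q \<in> N p. h q \<in> X}"]) auto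
    qed
  next
    fix W assume W: "openin M W" "W \<subseteq> C"
    show "openin (Euclidean_space n) (h ` W)"
    proof (subst openin_subopen, intro ballI)
      fix y assume "y \<in> h ` W"
      then obtain p where p: "p \<in> W" "y = h p" by blast
      then have Np: "p \<in> N p" "(N p, h) \<in> \<A>" using N W by auto
      then have "openin (Euclidean_space n) (h ` (W \<inter> N p))"
        using W(1) ch(1)[OF Np(2)] by (intro ch(6)[OF Np(2)]) auto
      then show "\<exists>T. openin (Euclidean_space n) T \<and> y \<in> T \<and> T \<subseteq> h ` W"
        using p Np by (intro exI[of _ "h ` (W \<inter> N p)"]) auto
    qed
  qed
  show ?thesis
  proof (rule smooth_structureD(4)[OF S chart])
    fix c' assume "c' \<in> \<A>"
    then obtain V' k where c': "c' = (V', k)" and Vk: "(V', k) \<in> \<A>" by (cases c') auto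
    note ch' = is_chartD[OF smooth_structureD(1)[OF S Vk]]
    have inv: "inv_into (N p) h (h q) = inv_into C h (h q)" if "p \<in> C" "q \<in> N p" for p q
    proof -
      have "q \<in> C" "inj_on h (N p)" using N[OF that(1)] that inj inj_on_subset by blast+
      then show ?thesis using that inv_into_f_f[OF inj] inv_into_f_f[of h "N p" q] by simp
    qed
    show "smooth_transition n (C, h) c'"
      unfolding c' smooth_transition_def prod.case
    proof (rule smooth_map_on_Union)
      fix x assume "x \<in> h ` (C \<inter> V')"
      then obtain p where p: "p \<in> C" "p \<in> V'" "x = h p" by blast
      have Np: "p \<in> N p" "(N p, h) \<in> \<A>" "N p \<subseteq> C" using N p by auto
      have op: "openin (Euclidean_space n) (h ` (N p \<inter> V'))"
        using ch'(1) ch(1)[OF Np(2)] by (intro ch(6)[OF Np(2)]) auto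
      have "smooth_map_on n n (h ` (N p \<inter> V')) (k \<circ> inv_into C h)"
        by (rule smooth_map_on_cong[OF op _ smooth_structureD(3)[OF S Np(2) Vk]])
           (use inv p in auto)
      then show "\<exists>V. openin (Euclidean_space n) V \<and> x \<in> V \<and> V \<subseteq> h ` (C \<inter> V') \<and>
          smooth_map_on n n V (k \<circ> inv_into C h)"
        using op p Np by (intro exI[of _ "h ` (N p \<inter> V')"]) auto
    qed
    show "smooth_transition n c' (C, h)"
      unfolding c' smooth_transition_def prod.case
    proof (rule smooth_map_on_Union)
      fix x assume "x \<in> k ` (V' \<inter> C)"
      then obtain p where p: "p \<in> C" "p \<in> V'" "x = k p" by blast
      have Np: "p \<in> N p" "(N p, h) \<in> \<A>" "N p \<subseteq> C" using N p by auto
      have op: "openin (Euclidean_space n) (k ` (V' \<inter> N p))"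
        using ch'(1) ch(1)[OF Np(2)] by (intro ch'(6)) auto
      show "\<exists>V. openin (Euclidean_space n) V \<and> x \<in> V \<and> V \<subseteq> k ` (V' \<inter> C) \<and>
          smooth_map_on n n V (h \<circ> inv_into V' k)"
        using op p Np smooth_structureD(3)[OF S Vk Np(2)]
        by (intro exI[of _ "k ` (V' \<inter> N p)"]) auto
    qed
  qed
qed

lemma transition_diffeo:
  assumes S: "smooth_structure n M \<A>" and V: "(V, k) \<in> \<A>" and V': "(V', h) \<in> \<A>"
    and W: "openin M W" "W \<subseteq> V" "W \<subseteq> V'"
  shows "diffeo n (k ` W) (h ` W) (h \<circ> inv_into V k) (k \<circ> inv_into V' h)"
proof -
  note ch = is_chartD[OF smooth_structureD(1)[OF S V]] and ch' = is_chartD[OF smooth_structureD(1)[OF S V']]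
  have "smooth_map_on n n (k ` W) (h \<circ> inv_into V k)"
    by (rule smooth_map_on_subset[OF _ smooth_structureD(3)[OF S V V']]) (use W in auto)
  moreover have "smooth_map_on n n (h ` W) (k \<circ> inv_into V' h)"
    by (rule smooth_map_on_subset[OF _ smooth_structureD(3)[OF S V' V]]) (use W in auto)
  moreover have "inv_into V k (k p) = p" "inv_into V' h (h p) = p" if "p \<in> W" for p
    using that W inv_into_f_f[OF ch(3)] inv_into_f_f[OF ch'(3)] by auto
  ultimately show ?thesis
    using ch(6)[OF W(1,2)] ch'(6)[OF W(1,3)] by (auto simp: diffeo_def)
qed

section \<open>Barycentric coordinates\<close>

text \<open>
  The barycentric coordinates of a point with respect to the vertices \<open>vertex 0\<close>, \dots, \<open>vertex l\<close>
  of the standard simplex.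
\<close>

definition bary :: "nat \<Rightarrow> nat \<Rightarrow> (nat \<Rightarrow> real) \<Rightarrow> real" where
  "bary l k x = (case k of 0 \<Rightarrow> 1 - (\<Sum>i<l. x i) | Suc j \<Rightarrow> x j)"

lemma bary_simps [simp]: "bary l 0 x = 1 - (\<Sum>i<l. x i)" "bary l (Suc j) x = x j"
  by (simp_all add: bary_def)

lemma sum_bary: "(\<Sum>k\<le>l. bary l k x) = 1"
  by (simp add: sum.atMost_shift)

lemma bary_cong: "(\<And>j. j < l \<Longrightarrow> x j = y j) \<Longrightarrow> k \<le> l \<Longrightarrow> bary l k x = bary l k y"
  by (cases k) auto

lemma ES_bary_eqI:
  assumes "x \<in> ES l" "y \<in> ES l" "\<And>k. k \<le> l \<Longrightarrow> bary l k x = bary l k y"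
  shows "x = y"
proof
  fix j show "x j = y j"
    using assms(1,2) assms(3)[of "Suc j"] by (cases "j < l") (auto simp: ES_iff)
qed

lemma continuous_on_bary [continuous_intros]: "continuous_on S (bary l k)"
  unfolding bary_def by (cases k) (auto intro!: continuous_intros)

lemma Ck_on_bary: "openin (Euclidean_space d) U \<Longrightarrow> Ck_on d r U (bary l k)"
  unfolding bary_def by (cases k) (auto intro!: Ck_on_intros)

lemma bary_affine: "bary l k (\<lambda>j. (1 - s) * p j + s * q j) = (1 - s) * bary l k p + s * bary l k q"
proof (cases k)
  case 0
  have "(\<Sum>j<l. (1 - s) * p j + s * q j) = (1 - s) * (\<Sum>j<l. p j) + s * (\<Sum>j<l. q j)"
    by (simp add: sum.distrib sum_distrib_left)
  then show ?thesis unfolding 0 bary_simps by (simp add: algebra_simps)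
qed simp

lemma std_simplex_iff: "x \<in> std_simplex l \<longleftrightarrow> x \<in> ES l \<and> (\<forall>k\<le>l. 0 \<le> bary l k x)"
proof -
  have "x i \<le> 1" if "\<forall>k\<le>l. 0 \<le> bary l k x" "i < l" for i
  proof -
    have "x j \<ge> 0" if "j < l" for j
      using \<open>\<forall>k\<le>l. 0 \<le> bary l k x\<close>[rule_format, of "Suc j"] that by simp
    then have "x i \<le> (\<Sum>i<l. x i)" using that by (intro member_le_sum) auto
    then show ?thesis using that(1)[rule_format, of 0] by simp
  qed
  moreover have "0 \<le> bary l k x" if "\<forall>i<l. 0 \<le> x i" "(\<Sum>i<l. x i) \<le> 1" "k \<le> l" for k
    using that by (cases k) auto
  moreover have "0 \<le> x i" if "\<forall>k\<le>l. 0 \<le> bary l k x" "i < l" for i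
    using that(1)[rule_format, of "Suc i"] that(2) by auto
  moreover have "(\<Sum>i<l. x i) \<le> 1" if "\<forall>k\<le>l. 0 \<le> bary l k x"
    using that[rule_format, of 0] by simp
  ultimately show ?thesis unfolding std_simplex_def topspace_ES by blast
qed

definition osimplex :: "nat \<Rightarrow> (nat \<Rightarrow> real) set" where
  "osimplex l = {x \<in> ES l. \<forall>k\<le>l. 0 < bary l k x}"

lemma osimplex_subset: "osimplex l \<subseteq> std_simplex l"
  by (auto simp: osimplex_def std_simplex_iff less_imp_le)

lemma openin_osimplex: "openin (Euclidean_space l) (osimplex l)"
proof -
  have "openin (Euclidean_space l) {x \<in> ES l. \<forall>k<Suc l. 0 < bary l k x}"
    by (rule openin_ES_Collect_less) (auto intro: continuous_intros)
  then show ?thesis by (simp add: osimplex_def less_Suc_eq_le)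
qed

text \<open>
  At a point with a vanishing barycentric coordinate, moving one coordinate by an arbitrarily small
  amount leaves the simplex.
\<close>

lemma interior_std_simplex: "Euclidean_space l interior_of std_simplex l = osimplex l"
proof
  show "osimplex l \<subseteq> Euclidean_space l interior_of std_simplex l"
    by (rule interior_of_maximal[OF osimplex_subset openin_osimplex])
  show "Euclidean_space l interior_of std_simplex l \<subseteq> osimplex l"
  proof
    fix x assume x: "x \<in> Euclidean_space l interior_of std_simplex l"
    then have xs: "x \<in> std_simplex l" using interior_of_subset by fast
    then have xE: "x \<in> ES l" by (simp add: std_simplex_iff)
    obtain e where e: "e > 0" "\<And>y. y \<in> ES l \<Longrightarrow> (\<forall>i<l. \<bar>y i - x i\<bar> < e) \<Longrightarrow> y \<in> std_simplex l"
      using openin_ES_box[OF openin_interior_of x] interior_of_subset by (metis subsetD)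
    have "0 < bary l k x" if "k \<le> l" for k
    proof (cases k)
      case 0
      show ?thesis
      proof (cases l)
        case (Suc m)
        have "x(0 := x 0 + e/2) \<in> std_simplex l"
          by (rule e(2)) (use xE e(1) Suc in \<open>auto simp: ES_iff\<close>)
        then have "(\<Sum>i<l. (x(0 := x 0 + e/2)) i) \<le> 1" unfolding std_simplex_def by blast
        moreover have "(\<Sum>i<l. (x(0 := x 0 + e/2)) i) = (\<Sum>i<l. x i) + e/2"
          unfolding Suc by (simp only: sum.lessThan_Suc_shift) simp
        ultimately show ?thesis using 0 e(1) by simp
      qed (simp add: 0)
    next
      case (Suc j)
      have "x(j := x j - e/2) \<in> std_simplex l"
        by (rule e(2)) (use xE e(1) Suc that in \<open>auto simp: ES_iff\<close>)
      then have "0 \<le> bary l (Suc j) (x(j := x j - e/2))" using that Suc std_simplex_iff by blast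
      then show ?thesis using Suc e(1) by simp
    qed
    then show "x \<in> osimplex l" using xE by (simp add: osimplex_def)
  qed
qed

lemma std_simplex_subset_ES: "std_simplex l \<subseteq> ES l"
  by (auto simp: std_simplex_iff)

lemma closed_ES: "closed (ES d)"
  by (rule closedin_Euclidean_imp_closed[of d]) (metis closedin_topspace topspace_ES)

lemma compact_coord_box: "compact {x::nat \<Rightarrow> real. \<forall>i. x i \<in> {a i..b i}}"
proof -
  have "compactin (powertop_real UNIV) (Pi\<^sub>E UNIV (\<lambda>i. {a i..b i}))"
    by (subst compactin_PiE) auto
  moreover have "Pi\<^sub>E UNIV (\<lambda>i. {a i..b i}) = {x. \<forall>i. x i \<in> {a i..b i}}" by (auto simp: PiE_iff)
  ultimately show ?thesis by (simp add: euclidean_product_topology)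
qed

lemma compact_std_simplex: "compact (std_simplex l)"
proof -
  let ?B = "{x::nat \<Rightarrow> real. \<forall>i. x i \<in> {0..if i < l then 1 else 0}}"
  have "std_simplex l = ?B \<inter> {x. (\<Sum>i<l. x i) \<le> 1}"
  proof (intro equalityI subsetI IntI CollectI allI)
    fix x i assume "x \<in> std_simplex l"
    then show "x i \<in> {0..if i < l then 1 else 0}" "(\<Sum>i<l. x i) \<le> 1"
      by (auto simp: std_simplex_def ES_iff)
  next
    fix x assume x: "x \<in> ?B \<inter> {x. (\<Sum>i<l. x i) \<le> 1}"
    then have *: "x i \<in> {0..if i < l then 1 else 0}" for i by blast
    have "x i = 0" if "i \<ge> l" for i using *[of i] that by simp
    moreover have "0 \<le> x i \<and> x i \<le> 1" if "i < l" for i using *[of i] that by simp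
    ultimately show "x \<in> std_simplex l" using x by (auto simp: std_simplex_def ES_iff)
  qed
  moreover have "closed {x::nat \<Rightarrow> real. (\<Sum>i<l. x i) \<le> 1}"
    by (intro closed_Collect_le continuous_intros)
  ultimately show ?thesis using compact_coord_box by (simp only: compact_Int_closed)
qed

lemma skip_bij: "i \<le> Suc l \<Longrightarrow> bij_betw (skip i) {..l} ({..Suc l} - {i})"
proof (rule bij_betw_byWitness[where f' = "\<lambda>k. if k < i then k else k - 1"])
qed (auto simp: skip_def)

lemma skip_le: "k \<le> l \<Longrightarrow> skip i k \<le> Suc l" and skip_neq: "skip i k \<noteq> i"
  by (auto simp: skip_def)

lemma obtain_skip:
  assumes "k \<le> Suc l" "k \<noteq> i"
  obtains j where "j \<le> l" "k = skip i j" | "i > Suc l"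
proof (cases "i \<le> Suc l")
  case True
  then show ?thesis using bij_betw_imp_surj_on[OF skip_bij[OF True]] assms that(1) by (metis DiffI atMost_iff imageE singletonD)
qed (use that in auto)

lemma sum_skip:
  fixes g :: "nat \<Rightarrow> real"
  assumes "i \<le> Suc l"
  shows "(\<Sum>k\<le>l. g (skip i k)) = (\<Sum>k\<le>Suc l. g k) - g i"
proof -
  have "(\<Sum>k\<le>l. g (skip i k)) = (\<Sum>k\<in>{..Suc l} - {i}. g k)"
    using sum.reindex_bij_betw[OF skip_bij[OF assms]] .
  also have "\<dots> = (\<Sum>k\<le>Suc l. g k) - g i"
    using assms by (subst sum_diff1) auto
  finally show ?thesis .
qed

text \<open>
  A face map is the affine map that keeps barycentric coordinates and relabels vertices.
\<close>

lemma face_map_bary_sum: "face_map l i x k = (\<Sum>j\<le>l. bary l j x * vertex (skip i j) k)"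
  by (simp add: face_map_def sum.atMost_shift)

lemma face_map_in_ES: "i \<le> Suc l \<Longrightarrow> face_map l i x \<in> ES (Suc l)"
proof -
  have "vertex (skip i j) k = 0" if "j \<le> l" "k \<ge> Suc l" for j k
    using that by (auto simp: vertex_def skip_def)
  then show ?thesis by (auto simp: ES_iff face_map_bary_sum simp del: bary_simps intro!: sum.neutral)
qed

lemma bary_vertex: "i \<le> l \<Longrightarrow> bary l k (vertex i) = (if k = i then 1 else 0)" if "k \<le> l" for k
proof (cases k)
  case 0
  assume i: "i \<le> l"
  show ?thesis
  proof (cases i)
    case (Suc j)
    have "(\<Sum>a<l. vertex i a) = (\<Sum>a<l. if a = j then 1 else 0)"
      by (intro sum.cong) (auto simp: vertex_def Suc)
    then show ?thesis using 0 Suc i by simp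
  qed (simp add: 0 vertex_def)
qed (auto simp: vertex_def)

lemma bary_sum_comb:
  assumes "(\<Sum>j\<in>J. w j) = (1::real)" "finite J"
  shows "bary l k (\<lambda>a. \<Sum>j\<in>J. w j * p j a) = (\<Sum>j\<in>J. w j * bary l k (p j))"
proof (cases k)
  case 0
  have "(\<Sum>a<l. \<Sum>j\<in>J. w j * p j a) = (\<Sum>j\<in>J. w j * (\<Sum>a<l. p j a))"
    by (subst sum.swap) (simp add: sum_distrib_left)
  then show ?thesis using assms(1) by (simp add: 0 algebra_simps sum_subtractf)
qed simp

lemma bary_face:
  assumes i: "i \<le> Suc l" and k: "k \<le> Suc l"
  shows "bary (Suc l) k (face_map l i x) = (\<Sum>j\<le>l. if skip i j = k then bary l j x else 0)"
proof -
  have "bary (Suc l) k (face_map l i x) = (\<Sum>j\<le>l. bary l j x * bary (Suc l) k (vertex (skip i j)))"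
    unfolding face_map_bary_sum[abs_def] by (rule bary_sum_comb[OF sum_bary]) simp
  also have "\<dots> = (\<Sum>j\<le>l. if skip i j = k then bary l j x else 0)"
    using k by (intro sum.cong) (auto simp: bary_vertex skip_le simp del: bary_simps)
  finally show ?thesis .
qed

lemma skip_inj: "skip i j = skip i j' \<longleftrightarrow> j = j'"
  by (auto simp: skip_def split: if_splits)

lemma bary_face_skip: "i \<le> Suc l \<Longrightarrow> k \<le> l \<Longrightarrow> bary (Suc l) (skip i k) (face_map l i x) = bary l k x"
  by (simp add: bary_face skip_le skip_inj del: bary_simps)

lemma bary_face_self: "i \<le> Suc l \<Longrightarrow> bary (Suc l) i (face_map l i x) = 0"
  by (simp add: bary_face skip_neq del: bary_simps)

lemma face_map_simplex: "i \<le> Suc l \<Longrightarrow> x \<in> std_simplex l \<Longrightarrow> face_map l i x \<in> std_simplex (Suc l)"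
  unfolding std_simplex_iff
proof (intro conjI allI impI)
  fix k assume *: "i \<le> Suc l" "x \<in> ES l \<and> (\<forall>k\<le>l. 0 \<le> bary l k x)" "k \<le> Suc l"
  show "0 \<le> bary (Suc l) k (face_map l i x)"
  proof (cases "k = i")
    case True then show ?thesis using bary_face_self * by (simp del: bary_simps)
  next
    case False
    then obtain j where "j \<le> l" "k = skip i j" using obtain_skip[OF *(3) False] *(1) by (metis not_le)
    then show ?thesis using bary_face_skip * by simp
  qed
qed (simp add: face_map_in_ES)

text \<open>
  Dropping the vanishing coordinate gives the barycentric coordinates of the preimage.
\<close>

lemma bary_zero_imp_face:
  assumes x: "x \<in> ES (Suc l)" and i: "i \<le> Suc l" and 0: "bary (Suc l) i x = 0"
  shows "\<exists>y\<in>ES l. x = face_map l i y \<and> (\<forall>k\<le>l. bary l k y = bary (Suc l) (skip i k) x)"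
proof -
  define y where "y j = (if j < l then bary (Suc l) (skip i (Suc j)) x else 0)" for j
  have yE: "y \<in> ES l" by (simp add: ES_iff y_def)
  have b_y: "bary l k y = bary (Suc l) (skip i k) x" if "k \<le> l" for k
  proof (cases k)
    case 0
    have "(\<Sum>k\<le>l. bary (Suc l) (skip i k) x) = 1"
      using sum_skip[OF i, of "\<lambda>k. bary (Suc l) k x"] sum_bary[of "Suc l" x] \<open>bary (Suc l) i x = 0\<close> by simp
    then have "bary (Suc l) (skip i 0) x + (\<Sum>j<l. y j) = 1"
      by (simp add: sum.atMost_shift y_def del: bary_simps)
    then show ?thesis unfolding 0 bary_simps(1) by linarith
  qed (use that in \<open>simp add: y_def\<close>)
  have "x = face_map l i y"
  proof (rule ES_bary_eqI[OF x face_map_in_ES[OF i]])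
    fix k assume k: "k \<le> Suc l"
    show "bary (Suc l) k x = bary (Suc l) k (face_map l i y)"
    proof (cases "k = i")
      case True
      then show ?thesis using bary_face_self[OF i] 0 by simp
    next
      case False
      then obtain j where "j \<le> l" "k = skip i j" using obtain_skip[OF k False] i by (metis not_le)
      then show ?thesis using bary_face_skip[OF i] b_y by simp
    qed
  qed
  then show ?thesis using yE b_y by blast
qed

section \<open>Coordinates around a facet\<close>

text \<open>
  A point \<open>z\<close> of \<open>\<real>\<^sup>m\<^sup>+\<^sup>1\<close> encodes a point \<open>y\<close> of \<open>\<real>\<^sup>m\<close>, given by the first \<open>m\<close> coordinates, and a height
  \<open>z m\<close>.  It is sent to the point at height \<open>z m\<close> on the line from the point \<open>y\<close> of the \<open>i\<close>-th facet
  to the opposite vertex.  Negative heights lie beyond the facet.  The coordinates treat all facets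
  alike, and the whole open simplex has the heights between \<open>0\<close> and \<open>1\<close> over every point of the open
  facet.
\<close>

definition cone_pt :: "nat \<Rightarrow> nat \<Rightarrow> (nat \<Rightarrow> real) \<Rightarrow> nat \<Rightarrow> real" where
  "cone_pt m i z = (\<lambda>k. (1 - z m) * face_map m i z k + z m * vertex i k)"

definition cone_coord :: "nat \<Rightarrow> nat \<Rightarrow> (nat \<Rightarrow> real) \<Rightarrow> nat \<Rightarrow> real" where
  "cone_coord m i x = (\<lambda>j. if j < m then bary (Suc m) (skip i (Suc j)) x / (1 - bary (Suc m) i x)
      else if j = m then bary (Suc m) i x else 0)"

lemma vertex_in_ES: "i \<le> l \<Longrightarrow> vertex i \<in> ES l"
  by (auto simp: ES_iff vertex_def)

lemma cone_pt_ES: "i \<le> Suc m \<Longrightarrow> cone_pt m i z \<in> ES (Suc m)"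
  using face_map_in_ES[of i m z] vertex_in_ES[of i "Suc m"] by (auto simp: ES_iff cone_pt_def)

lemma cone_coord_ES: "cone_coord m i x \<in> ES (Suc m)"
  by (auto simp: ES_iff cone_coord_def)

lemma bary_cone_self: "i \<le> Suc m \<Longrightarrow> bary (Suc m) i (cone_pt m i z) = z m"
  unfolding cone_pt_def bary_affine by (simp add: bary_face_self bary_vertex del: bary_simps)

lemma bary_cone_skip:
  "i \<le> Suc m \<Longrightarrow> j \<le> m \<Longrightarrow> bary (Suc m) (skip i j) (cone_pt m i z) = (1 - z m) * bary m j z"
  unfolding cone_pt_def bary_affine by (simp add: bary_face_skip bary_vertex skip_le skip_neq del: bary_simps)

lemma cone_coord_pt:
  assumes "i \<le> Suc m" "z \<in> ES (Suc m)" "z m \<noteq> 1"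
  shows "cone_coord m i (cone_pt m i z) = z"
proof
  fix j show "cone_coord m i (cone_pt m i z) j = z j"
    using assms bary_cone_skip[OF assms(1), of "Suc j" z]
    by (auto simp: cone_coord_def bary_cone_self ES_iff)
qed

lemma bary_cone_coord:
  assumes i: "i \<le> Suc m" and nz: "bary (Suc m) i x \<noteq> 1" and j: "j \<le> m"
  shows "bary m j (cone_coord m i x) = bary (Suc m) (skip i j) x / (1 - bary (Suc m) i x)"
proof (cases j)
  case 0
  have "(\<Sum>k\<le>m. bary (Suc m) (skip i k) x) = 1 - bary (Suc m) i x"
    using sum_skip[OF i, of "\<lambda>k. bary (Suc m) k x"] sum_bary[of "Suc m" x] by simp
  then have "bary (Suc m) (skip i 0) x + (\<Sum>k<m. bary (Suc m) (skip i (Suc k)) x) = 1 - bary (Suc m) i x"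
    by (simp add: sum.atMost_shift del: bary_simps)
  moreover have "(\<Sum>k<m. cone_coord m i x k) = (\<Sum>k<m. bary (Suc m) (skip i (Suc k)) x) / (1 - bary (Suc m) i x)"
    by (simp add: cone_coord_def sum_divide_distrib)
  ultimately show ?thesis using nz unfolding 0 bary_simps(1) by (simp add: field_simps)
qed (use j in \<open>simp add: cone_coord_def\<close>)

lemma cone_pt_coord:
  assumes i: "i \<le> Suc m" and x: "x \<in> ES (Suc m)" and nz: "bary (Suc m) i x \<noteq> 1"
  shows "cone_pt m i (cone_coord m i x) = x"
proof (rule ES_bary_eqI[OF cone_pt_ES[OF i] x])
  fix k assume k: "k \<le> Suc m"
  have c: "cone_coord m i x m = bary (Suc m) i x" by (simp add: cone_coord_def)
  show "bary (Suc m) k (cone_pt m i (cone_coord m i x)) = bary (Suc m) k x"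
  proof (cases "k = i")
    case True
    then show ?thesis using bary_cone_self[OF i] c by simp
  next
    case False
    then obtain j where "j \<le> m" "k = skip i j" using obtain_skip[OF k False] i by (metis not_le)
    then show ?thesis using bary_cone_skip[OF i] bary_cone_coord[OF i nz] c nz by simp
  qed
qed

lemma smooth_cone_pt: "openin (Euclidean_space d) U \<Longrightarrow> smooth_map_on d e U (cone_pt m i)"
  unfolding smooth_map_on_def cone_pt_def face_map_def by (intro allI impI Ck_on_intros)

lemma smooth_cone_coord:
  assumes "openin (Euclidean_space d) U" "\<And>x. x \<in> U \<Longrightarrow> bary (Suc m) i x \<noteq> 1"
  shows "smooth_map_on d e U (cone_coord m i)"
  unfolding smooth_map_on_def
proof (intro allI impI)
  fix j k assume "j < e"
  consider "j < m" | "j = m" | "j > m" by linarith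
  then show "Ck_on d k U (\<lambda>x. cone_coord m i x j)"
  proof cases
    case 1
    then show ?thesis using assms unfolding cone_coord_def
      by (auto intro!: Ck_on_divide Ck_on_diff Ck_on_bary Ck_on_const simp del: bary_simps)
  qed (use assms(1) in \<open>auto simp: cone_coord_def intro!: Ck_on_bary simp del: bary_simps\<close>)
qed

lemma diffeo_cone:
  assumes i: "i \<le> Suc m"
  shows "diffeo (Suc m) {x \<in> ES (Suc m). bary (Suc m) i x < 1} {z \<in> ES (Suc m). z m < 1}
    (cone_coord m i) (cone_pt m i)"
proof -
  have "openin (Euclidean_space (Suc m)) {x \<in> ES (Suc m). bary (Suc m) i x < 1}"
    using openin_ES_Collect_less[of 1 "Suc m" "\<lambda>_. bary (Suc m) i" "\<lambda>_ _. 1"] by (simp add: continuous_on_bary)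
  moreover have "openin (Euclidean_space (Suc m)) {z \<in> ES (Suc m). z m < 1}"
    using openin_ES_Collect_less[of 1 "Suc m" "\<lambda>_ z. z m" "\<lambda>_ _. 1"] by (simp add: continuous_on_coord)
  moreover have "cone_coord m i x m = bary (Suc m) i x" for x by (simp add: cone_coord_def)
  ultimately show ?thesis
    unfolding diffeo_def
    using cone_coord_ES cone_pt_ES[OF i] bary_cone_self[OF i] cone_coord_pt[OF i] cone_pt_coord[OF i]
      smooth_cone_pt smooth_cone_coord[of "Suc m" "{x \<in> ES (Suc m). bary (Suc m) i x < 1}" m i "Suc m"]
    by (auto simp del: bary_simps)
qed

lemma diffeo_restrict:
  assumes d: "diffeo n X Y F G" and X': "openin (Euclidean_space n) X'" "X' \<subseteq> X"
  shows "diffeo n X' (F ` X') F G"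
proof -
  have Y: "openin (Euclidean_space n) Y" and G: "smooth_map_on n n Y G" "G ` Y \<subseteq> ES n"
    using d openin_ES_subset[of n X] by (auto simp: diffeo_def)
  have FX: "F ` X' = {y \<in> Y. G y \<in> X'}"
  proof safe
    fix x assume "x \<in> X'"
    then show "F x \<in> Y" "G (F x) \<in> X'" using d X'(2) by (auto simp: diffeo_def subset_iff)
  next
    fix y assume "y \<in> Y" "G y \<in> X'"
    then show "y \<in> F ` X'" using d by (intro image_eqI[of _ _ "G y"]) (auto simp: diffeo_def)
  qed
  have "topspace (subtopology (Euclidean_space n) Y) = Y" using openin_ES_subset[OF Y] by auto
  then have "openin (Euclidean_space n) (F ` X')"
    using openin_trans_full[OF openin_continuous_map_preimage[OF smooth_map_on_continuous_map[OF Y G] X'(1)] Y]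
    by (simp add: FX)
  then show ?thesis
    using d X' FX unfolding diffeo_def by (auto intro: smooth_map_on_subset)
qed

text \<open>
  The logarithms of the quotients of barycentric coordinates are a homeomorphism; its inverse is
  \<open>u \<mapsto> exp(u\<^sub>i) / (1 + \<Sum>\<^sub>j exp(u\<^sub>j))\<close>.
\<close>

lemma osimplex_homeomorphic: "subtopology (Euclidean_space l) (osimplex l) homeomorphic_space Euclidean_space l"
proof -
  define f where "f x = (\<lambda>i. if i < l then ln (x i / bary l 0 x) else 0)" for x
  define g where "g u = (\<lambda>i. if i < l then exp (u i) / (1 + (\<Sum>j<l. exp (u j))) else 0)" for u :: "nat \<Rightarrow> real"
  have oE: "osimplex l \<subseteq> ES l" by (auto simp: osimplex_def)
  have pos: "1 + (\<Sum>j<l. exp (u j)) > 0" for u :: "nat \<Rightarrow> real"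
    by (intro add_pos_nonneg sum_nonneg) auto
  have op: "0 < x i" if "x \<in> osimplex l" "i < l" for x i
    using that by (auto simp: osimplex_def dest!: spec[of _ "Suc i"])
  have op0: "0 < bary l 0 x" if "x \<in> osimplex l" for x
    using that by (auto simp: osimplex_def)
  have gb0: "bary l 0 (g u) = 1 / (1 + (\<Sum>j<l. exp (u j)))" for u
    using pos[of u] by (simp add: g_def sum_divide_distrib[symmetric] field_simps)
  have gO: "g u \<in> osimplex l" for u
  proof -
    have "0 < bary l k (g u)" if "k \<le> l" for k
      using that gb0[of u] pos[of u] by (cases k) (auto simp: g_def)
    then show ?thesis by (auto simp: osimplex_def ES_iff g_def)
  qed
  have "continuous_on (osimplex l) f"
  proof (rule continuous_on_ES_coords[of l])
    fix j assume j: "j < l"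
    have "continuous_on (osimplex l) (\<lambda>x. ln (x j / bary l 0 x))"
      by (intro continuous_intros ballI) (use op op0 j in \<open>force simp del: bary_simps\<close>)+
    then show "continuous_on (osimplex l) (\<lambda>x. f x j)" using j by (simp add: f_def)
  qed (auto simp: f_def ES_iff)
  then have cf: "continuous_map (subtopology (Euclidean_space l) (osimplex l)) (Euclidean_space l) f"
    using continuous_map_ES_ES[OF oE] by (auto simp: f_def ES_iff)
  have "continuous_on (ES l) g"
  proof (rule continuous_on_ES_coords[of l])
    fix j assume j: "j < l"
    have "continuous_on (ES l) (\<lambda>u. exp (u j) / (1 + (\<Sum>j<l. exp (u j))))"
      by (intro continuous_intros ballI) (use pos in \<open>metis less_irrefl\<close>)+
    then show "continuous_on (ES l) (\<lambda>x. g x j)" using j by (simp add: g_def)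
  qed (auto simp: g_def ES_iff)
  then have "continuous_map (subtopology (Euclidean_space l) (ES l)) (Euclidean_space l) g"
    using continuous_map_ES_ES[OF order_refl] by (auto simp: g_def ES_iff)
  then have cg: "continuous_map (Euclidean_space l) (subtopology (Euclidean_space l) (osimplex l)) g"
    using gO subtopology_topspace[of "Euclidean_space l"] by (intro continuous_map_into_subtopology) auto
  have gf: "g (f x) = x" if x: "x \<in> osimplex l" for x
  proof
    fix i
    have e: "exp (f x j) = x j / bary l 0 x" if "j < l" for j
      using op[OF x that] op0[OF x] that by (simp add: f_def del: bary_simps)
    have "1 + (\<Sum>j<l. exp (f x j)) = 1 + (\<Sum>j<l. x j) / bary l 0 x"
      by (simp add: e sum_divide_distrib del: bary_simps)
    also have "\<dots> = 1 / bary l 0 x" using op0[OF x] by (simp add: field_simps)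
    finally show "g (f x) i = x i"
      using e op0[OF x] x oE by (auto simp: g_def ES_iff simp del: bary_simps)
  qed
  have fg: "f (g u) = u" if u: "u \<in> ES l" for u
  proof
    fix i show "f (g u) i = u i"
      using gb0[of u] pos[of u] u by (auto simp: f_def g_def ES_iff simp del: bary_simps)
  qed
  show ?thesis unfolding homeomorphic_space_def homeomorphic_maps_def
    using cf cg gf fg by (intro exI[of _ f] exI[of _ g]) auto
qed

section \<open>Collars of a facet\<close>

lemma compact_tube_fun_upd:
  fixes K :: "(nat \<Rightarrow> real) set"
  assumes K: "compact K" and T: "open T" and KT: "\<And>z. z \<in> K \<Longrightarrow> z(m := 0) \<in> T"
  shows "\<exists>r>0. \<forall>z\<in>K. \<forall>s. \<bar>s\<bar> \<le> r \<longrightarrow> z(m := s) \<in> T"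
proof -
  let ?P = "prod_topology (euclidean :: (nat \<Rightarrow> real) topology) euclideanreal"
  let ?f = "\<lambda>w :: (nat \<Rightarrow> real) \<times> real. (fst w)(m := snd w)"
  have "continuous_map ?P (powertop_real UNIV) ?f"
    unfolding continuous_map_componentwise_UNIV
  proof
    fix j
    have "continuous_map ?P euclideanreal (\<lambda>w. fst w j)"
      using continuous_on_product_then_coordinatewise[OF continuous_on_fst[OF continuous_on_id], of UNIV j] by simp
    moreover have "continuous_map ?P euclideanreal snd" by (rule continuous_map_snd)
    ultimately show "continuous_map ?P euclideanreal (\<lambda>w. ?f w j)"
      by (cases "j = m") auto
  qed
  then have c: "continuous_map ?P euclidean ?f" by (simp add: euclidean_product_topology)
  have op: "openin ?P {w \<in> topspace ?P. ?f w \<in> T}"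
    by (rule openin_continuous_map_preimage[OF c]) (use T in simp)
  have "K \<times> {0} \<subseteq> {w \<in> topspace ?P. ?f w \<in> T}" using KT by auto
  from tube_lemma_left[OF op _ _ this]
  obtain A B where AB: "K \<subseteq> A" "open B" "0 \<in> B" "A \<times> B \<subseteq> {w \<in> topspace ?P. ?f w \<in> T}"
    using K by auto
  then obtain e where "e > 0" "ball 0 e \<subseteq> B" by (metis open_contains_ball)
  then have "z(m := s) \<in> T" if "z \<in> K" "\<bar>s\<bar> \<le> e/2" for z s
    using AB(1,4) that by (force simp: subset_iff dist_real_def)
  then show ?thesis using \<open>e > 0\<close> by (intro exI[of _ "e/2"]) auto
qed

text \<open>
  Positive on the open simplex, zero on its boundary, at most every barycentric coordinate, and
  polynomial: the thickness of a collar is a small multiple of it.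
\<close>

definition bary_prod :: "nat \<Rightarrow> (nat \<Rightarrow> real) \<Rightarrow> real" where
  "bary_prod m z = (\<Prod>j\<le>m. bary m j z)"

lemma bary_le_1:
  assumes "\<And>j. j \<le> m \<Longrightarrow> 0 \<le> bary m j z" "j \<le> m"
  shows "bary m j z \<le> 1"
  using member_le_sum[of j "{..m}" "\<lambda>j. bary m j z"] sum_bary[of m z] assms by simp

lemma bary_prod_le:
  assumes "\<And>j. j \<le> m \<Longrightarrow> 0 \<le> bary m j z" "j \<le> m"
  shows "bary_prod m z \<le> bary m j z"
proof -
  have "bary_prod m z = bary m j z * (\<Prod>j\<in>{..m} - {j}. bary m j z)"
    unfolding bary_prod_def using assms(2) by (simp add: prod.remove)
  moreover have "(\<Prod>j\<in>{..m} - {j}. bary m j z) \<le> 1"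
    using assms bary_le_1[OF assms(1)] by (intro prod_le_1) auto
  ultimately show ?thesis using assms by (simp add: mult_left_le del: bary_simps)
qed

lemma bary_prod_pos: "(\<And>j. j \<le> m \<Longrightarrow> 0 < bary m j z) \<Longrightarrow> 0 < bary_prod m z"
  unfolding bary_prod_def by (intro prod_pos) auto

lemma bary_prod_nonneg: "(\<And>j. j \<le> m \<Longrightarrow> 0 \<le> bary m j z) \<Longrightarrow> 0 \<le> bary_prod m z"
  unfolding bary_prod_def by (intro prod_nonneg) auto

lemma bary_prod_cong: "(\<And>j. j < m \<Longrightarrow> x j = y j) \<Longrightarrow> bary_prod m x = bary_prod m y"
  unfolding bary_prod_def by (intro prod.cong refl bary_cong) auto

text \<open>
  In the coordinates of \<open>cone_pt\<close> the set for \<open>h = 0\<close> is a collar of an open facet, on the outer side,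
  and the set for \<open>h = 1\<close> is the collar together with the open facet and the open simplex.
\<close>

definition slab :: "nat \<Rightarrow> real \<Rightarrow> real \<Rightarrow> (nat \<Rightarrow> real) set" where
  "slab m c h = {z \<in> ES (Suc m). (\<forall>j\<le>m. 0 < bary m j z) \<and> - (c * bary_prod m z) < z m \<and> z m < h}"

text \<open>
  The collar is path connected: rescaling the height by the thickness makes it convex.
\<close>

lemma slab_connected_sign:
  assumes B: "continuous_on (slab m c 0) B" and nz: "\<And>z. z \<in> slab m c 0 \<Longrightarrow> B z \<noteq> (0::real)"
    and c: "c > 0" and z: "z \<in> slab m c 0" "B z > 0" and w: "w \<in> slab m c 0"
  shows "B w > 0"
proof (rule ccontr)
  assume neg: "\<not> B w > 0"
  \<comment> \<open>the height in units of the thickness, between \<open>-1\<close> and \<open>0\<close>\<close>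
  define u where "u x = x m / (c * bary_prod m x)" for x
  define y where "y t = (\<lambda>j. (1 - t) * z j + t * w j)" for t
  define g where "g t = (y t)(m := c * bary_prod m (y t) * ((1 - t) * u z + t * u w))" for t
  have ub: "-1 < u x \<and> u x < 0" if "x \<in> slab m c 0" for x
    using that bary_prod_pos[of m x] c by (auto simp: slab_def u_def field_simps simp del: bary_simps)
  have conv: "(1 - t) * a + t * b < d" if "a < d" "b < d" "0 \<le> t" "t \<le> 1" for a b d t :: real
    using that convex_bound_lt[of a d b "1 - t" t] by simp
  have g_slab: "g t \<in> slab m c 0" if t: "0 \<le> t" "t \<le> 1" for t
  proof -
    have bg: "bary m j (g t) = bary m j (y t)" if "j \<le> m" for j
      using that by (intro bary_cong) (auto simp: g_def)
    have pos: "0 < bary m j (y t)" if "j \<le> m" for j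
      using conv[of "- bary m j z" 0 "- bary m j w" t] t z w that
      unfolding y_def bary_affine by (auto simp: slab_def simp del: bary_simps)
    then have p: "c * bary_prod m (y t) > 0" using c bary_prod_pos by simp
    have pg: "bary_prod m (g t) = bary_prod m (y t)"
      by (intro bary_prod_cong) (auto simp: g_def)
    have v: "(1 - t) * u z + t * u w < 0" "- ((1 - t) * u z + t * u w) < 1"
      using conv[of "u z" 0 "u w" t] conv[of "- u z" 1 "- u w" t] ub z(1) w t by auto
    have gm: "g t m = c * bary_prod m (y t) * ((1 - t) * u z + t * u w)" by (simp add: g_def)
    have "g t m < 0" unfolding gm using mult_pos_neg[OF p v(1)] .
    moreover have "- (c * bary_prod m (g t)) < g t m"
      using mult_strict_left_mono[OF v(2) p] unfolding gm pg by (simp only: mult_minus_right mult_1_right)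
    moreover have "g t \<in> ES (Suc m)" using z w by (auto simp: slab_def ES_iff g_def y_def)
    ultimately show ?thesis
      using pos bg unfolding slab_def by simp
  qed
  have "continuous_on {0..1} g"
  proof (rule continuous_on_coordinatewise_then_product)
    fix j
    have "continuous_on {0..1} (\<lambda>t. c * (\<Prod>j\<le>m. (1 - t) * bary m j z + t * bary m j w) * ((1 - t) * u z + t * u w))"
      "continuous_on {0..1} (\<lambda>t. (1 - t) * z j + t * w j)"
      by (intro continuous_intros)+
    then show "continuous_on {0..1} (\<lambda>t. g t j)"
      by (cases "j = m") (auto simp: g_def bary_prod_def y_def bary_affine simp del: bary_simps)
  qed
  then have "continuous_on {0..1} (\<lambda>t. B (g t))"
    by (rule continuous_on_compose2[OF B]) (use g_slab in auto)
  then have "connected ((\<lambda>t. B (g t)) ` {0..1})"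
    by (intro connected_continuous_image) auto
  moreover have "g 0 = z" "g 1 = w"
    using z(1) w bary_prod_pos[of m z] bary_prod_pos[of m w] c
    by (auto simp: g_def y_def u_def slab_def fun_eq_iff simp del: bary_simps)
  then have "B z \<in> (\<lambda>t. B (g t)) ` {0..1}" "B w \<in> (\<lambda>t. B (g t)) ` {0..1}"
    by (metis atLeastAtMost_iff image_eqI order_refl zero_le_one)+
  ultimately have "0 \<in> (\<lambda>t. B (g t)) ` {0..1}"
    using connectedD_interval[of _ "B w" "B z" 0] neg z(2) by simp
  then show False using nz g_slab by force
qed

section \<open>Simplices of a triangulated manifold\<close>

locale triangulated_manifold =
  fixes n :: nat and M :: "'a topology" and \<A> :: "'a chart set"
    and \<Phi> :: "nat \<Rightarrow> ((nat \<Rightarrow> real) \<Rightarrow> 'a) set"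
  assumes hausdorff: "Hausdorff_space M"
    and S: "smooth_structure n M \<A>"
    and tri: "smooth_triangulation n M \<A> \<Phi>"
begin

lemma finite_simplices: "l \<le> n \<Longrightarrow> finite (\<Phi> l)"
  using tri by (simp add: smooth_triangulation_def)

lemma simplex_extension:
  assumes "\<phi> \<in> \<Phi> l" "l \<le> n"
  obtains U f where "openin (Euclidean_space l) U" "std_simplex l \<subseteq> U" "smooth_embedding l n M \<A> U f"
    "\<And>x. x \<in> std_simplex l \<Longrightarrow> \<phi> x = f x" "inj_on f U"
    "continuous_map (subtopology (Euclidean_space l) U) M f"
proof -
  have "smooth_simplex l n M \<A> \<phi>"
    using tri assms by (auto simp: smooth_triangulation_def)
  then obtain U f where Uf: "openin (Euclidean_space l) U" "std_simplex l \<subseteq> U" "smooth_embedding l n M \<A> U f"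
    "\<phi> = restrict f (std_simplex l)"
    by (auto simp: smooth_simplex_def)
  have tU: "topspace (subtopology (Euclidean_space l) U) = U" using openin_ES_subset[OF Uf(1)] by auto
  have emb: "embedding_map (subtopology (Euclidean_space l) U) M f"
    using Uf(3) by (simp add: smooth_embedding_def)
  have "inj_on f U"
    using homeomorphic_imp_injective_map emb unfolding embedding_map_def by (metis tU)
  moreover have "continuous_map (subtopology (Euclidean_space l) U) M f"
    using homeomorphic_imp_continuous_map continuous_map_into_fulltopology emb
    unfolding embedding_map_def by blast
  ultimately show ?thesis using that Uf by simp
qed

lemma simplex_inj:
  assumes "\<phi> \<in> \<Phi> l" "l \<le> n"
  shows "inj_on \<phi> (std_simplex l)"
  using simplex_extension[OF assms] by (metis inj_on_cong inj_on_subset)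

lemma simplex_continuous:
  assumes "\<phi> \<in> \<Phi> l" "l \<le> n"
  shows "continuous_map (subtopology (Euclidean_space l) (std_simplex l)) M \<phi>"
proof -
  obtain U f where *: "std_simplex l \<subseteq> U" "\<And>x. x \<in> std_simplex l \<Longrightarrow> \<phi> x = f x"
    "continuous_map (subtopology (Euclidean_space l) U) M f"
    using simplex_extension[OF assms] by metis
  have "continuous_map (subtopology (Euclidean_space l) (std_simplex l)) M f"
    using continuous_map_from_subtopology_mono[OF *(3,1)] .
  then show ?thesis by (rule continuous_map_eq) (use *(2) in auto)
qed

lemma simplex_closedin:
  assumes "\<phi> \<in> \<Phi> l" "l \<le> n"
  shows "closedin M (\<phi> ` std_simplex l)"
proof (rule compactin_imp_closedin[OF hausdorff], rule image_compactin[OF _ simplex_continuous[OF assms]])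
  show "compactin (subtopology (Euclidean_space l) (std_simplex l)) (std_simplex l)"
    using compact_std_simplex[of l] subtopology_ES[OF std_simplex_subset_ES] by (simp add: compactin_subtopology)
qed

lemma simplex_in_topspace:
  assumes "\<phi> \<in> \<Phi> l" "l \<le> n" "x \<in> std_simplex l"
  shows "\<phi> x \<in> topspace M"
  using closedin_subset[OF simplex_closedin[OF assms(1,2)]] assms(3) by blast

lemma topspace_open_simplices:
  "p \<in> topspace M \<longleftrightarrow> (\<exists>l\<le>n. \<exists>\<phi>\<in>\<Phi> l. p \<in> \<phi> ` osimplex l)"
  using tri by (auto simp: smooth_triangulation_def interior_std_simplex)

lemma open_simplices_disjoint:
  assumes "\<phi> \<in> \<Phi> l" "l \<le> n" "x \<in> osimplex l" "\<psi> \<in> \<Phi> k" "k \<le> n" "y \<in> osimplex k" "\<phi> x = \<psi> y"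
  shows "l = k" "\<phi> = \<psi>" "x = y"
proof -
  have "disjoint_family_on (\<lambda>(l, \<phi>). \<phi> ` osimplex l) (SIGMA l:{..n}. \<Phi> l)"
    using tri by (simp add: smooth_triangulation_def interior_std_simplex)
  from disjoint_family_onD[OF this, of "(l, \<phi>)" "(k, \<psi>)"] have "(l, \<phi>) = (k, \<psi>)"
    using assms by fastforce
  then show "l = k" "\<phi> = \<psi>" by auto
  then show "x = y" using simplex_inj[OF assms(1,2)] assms osimplex_subset by (metis inj_onD subsetD)
qed

lemma face_simplex:
  assumes "\<phi> \<in> \<Phi> (Suc l)" "Suc l \<le> n" "i \<le> Suc l"
  shows "restrict (\<phi> \<circ> face_map l i) (std_simplex l) \<in> \<Phi> l"
  using tri assms by (auto simp: smooth_triangulation_def)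

lemma simplex_open_or_face:
  assumes "x \<in> std_simplex l"
  obtains "x \<in> osimplex l"
  | l' i y where "l = Suc l'" "i \<le> l" "bary l i x = 0" "y \<in> std_simplex l'" "x = face_map l' i y"
    "\<And>k. k \<le> l' \<Longrightarrow> bary l' k y = bary l (skip i k) x"
proof (cases "x \<in> osimplex l")
  case False
  then obtain i where i: "i \<le> l" "bary l i x = 0"
    using assms by (auto simp: osimplex_def std_simplex_iff less_le)
  then obtain l' where l: "l = Suc l'" by (cases l) auto
  obtain y where "y \<in> ES l'" "x = face_map l' i y" "\<forall>k\<le>l'. bary l' k y = bary l (skip i k) x"
    using bary_zero_imp_face[of x l' i] assms i l by (auto simp: std_simplex_iff)
  moreover have "y \<in> std_simplex l'"
    using calculation assms skip_le[of _ l' i] l by (auto simp: std_simplex_iff)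
  ultimately show ?thesis using that(2) l i by blast
qed (use that in blast)

text \<open>
  Going to a facet lowers the dimension, so descent along the faces ends in an open simplex.
\<close>

lemma simplex_carrier:
  assumes "\<phi> \<in> \<Phi> l" "l \<le> n" "x \<in> std_simplex l"
  shows "x \<in> osimplex l \<or> (\<exists>k<l. \<exists>\<psi>\<in>\<Phi> k. \<phi> x \<in> \<psi> ` osimplex k)"
  using assms
proof (induction l arbitrary: \<phi> x rule: less_induct)
  case (less l)
  from less.prems(3) show ?case
  proof (cases rule: simplex_open_or_face)
    case (2 l' i y)
    let ?\<psi> = "restrict (\<phi> \<circ> face_map l' i) (std_simplex l')"
    have \<psi>: "?\<psi> \<in> \<Phi> l'" using face_simplex less.prems 2 by auto
    have eq: "?\<psi> y = \<phi> x" using 2 by simp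
    have "y \<in> osimplex l' \<or> (\<exists>k<l'. \<exists>\<psi>\<in>\<Phi> k. ?\<psi> y \<in> \<psi> ` osimplex k)"
      using less.IH[OF _ \<psi> _ 2(4)] 2(1) less.prems(2) by (meson Suc_leD lessI)
    then show ?thesis
    proof
      assume "y \<in> osimplex l'"
      then have "\<phi> x \<in> ?\<psi> ` osimplex l'" using eq by (metis imageI)
      then show ?thesis using \<psi> 2(1) by blast
    next
      assume "\<exists>k<l'. \<exists>\<psi>\<in>\<Phi> k. ?\<psi> y \<in> \<psi> ` osimplex k"
      then show ?thesis unfolding eq using 2(1) less_SucI by blast
    qed
  qed simp
qed

text \<open>
  By \<open>simplex_carrier\<close> a closed simplex is a union of open ones, of which only the simplex itself can
  have the largest dimension; the open simplices of the triangulation are disjoint.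
\<close>

lemma open_simplex_meets_closed:
  assumes "\<phi> \<in> \<Phi> l" "l \<le> n" "x \<in> osimplex l" "\<psi> \<in> \<Phi> k" "k \<le> l" "y \<in> std_simplex k" "\<phi> x = \<psi> y"
  shows "l = k \<and> \<phi> = \<psi>"
proof -
  have kn: "k \<le> n" using assms by simp
  show ?thesis
    using simplex_carrier[OF assms(4) kn assms(6)]
  proof
    assume "y \<in> osimplex k"
    then show ?thesis using open_simplices_disjoint[OF assms(1,2,3) assms(4) kn _ assms(7)] by blast
  next
    assume "\<exists>j<k. \<exists>\<rho>\<in>\<Phi> j. \<psi> y \<in> \<rho> ` osimplex j"
    then obtain j \<rho> z where "j < k" "\<rho> \<in> \<Phi> j" "z \<in> osimplex j" "\<phi> x = \<rho> z" using assms(7) by auto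
    then have "l = j" using open_simplices_disjoint(1)[OF assms(1,2,3)] kn by simp
    then show ?thesis using \<open>j < k\<close> assms(5) by simp
  qed
qed

lemma top_simplex_chart:
  assumes "openin (Euclidean_space n) U" "smooth_embedding n n M \<A> U f"
  shows "(f ` U, inv_into U f) \<in> \<A>"
    and "\<And>X. openin (Euclidean_space n) X \<Longrightarrow> X \<subseteq> U \<Longrightarrow> openin M (f ` X)"
    and "\<And>W. openin M W \<Longrightarrow> openin (Euclidean_space n) (U \<inter> f -` W)"
proof -
  show c: "(f ` U, inv_into U f) \<in> \<A>" by (rule embedding_chart[OF S assms])
  note ch = is_chartD[OF smooth_structureD(1)[OF S c]]
  have tU: "topspace (subtopology (Euclidean_space n) U) = U" using openin_ES_subset[OF assms(1)] by auto
  have emb: "embedding_map (subtopology (Euclidean_space n) U) M f"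
    using assms(2) by (simp add: smooth_embedding_def)
  have inj: "inj_on f U"
    using homeomorphic_imp_injective_map emb unfolding embedding_map_def by (metis tU)
  have g: "inv_into U f (f x) = x" if "x \<in> U" for x using inj that by simp
  show "openin M (f ` X)" if X: "openin (Euclidean_space n) X" "X \<subseteq> U" for X
  proof -
    have "f ` X = {p \<in> f ` U. inv_into U f p \<in> X}" using g X(2) by (auto simp: subset_iff)
    then show ?thesis using ch(7)[OF X(1)] by simp
  qed
  show "openin (Euclidean_space n) (U \<inter> f -` W)" if "openin M W" for W
  proof -
    have "U \<inter> f -` W = inv_into U f ` (f ` U \<inter> W)"
    proof safe
      fix x assume "x \<in> U" "f x \<in> W"
      then show "x \<in> inv_into U f ` (f ` U \<inter> W)" using g by (intro image_eqI[of _ _ "f x"]) auto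
    qed (use g in auto)
    then show ?thesis using ch(6)[of "f ` U \<inter> W"] ch(1) that by auto
  qed
qed

lemma open_top_simplex:
  assumes "\<tau> \<in> \<Phi> n"
  shows "openin M (\<tau> ` osimplex n)"
proof -
  obtain U f where *: "openin (Euclidean_space n) U" "std_simplex n \<subseteq> U" "smooth_embedding n n M \<A> U f"
    "\<And>x. x \<in> std_simplex n \<Longrightarrow> \<tau> x = f x"
    using simplex_extension[OF assms order_refl] by metis
  have "\<tau> ` osimplex n = f ` osimplex n" using *(4) osimplex_subset by (intro image_cong) auto
  then show ?thesis
    using top_simplex_chart(2)[OF *(1,3) openin_osimplex] *(2) osimplex_subset by (metis order_trans)
qed

text \<open>
  Let \<open>H\<close> be the change from the coordinates of \<open>cone_pt\<close> around the common facet to those of the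
  simplex \<open>\<tau>0\<close>.  On the facet the barycentric coordinates of \<open>H z\<close> are those of \<open>z\<close>, except for the
  one of the vertex opposite to the facet, and by compactness of the facet they change at most by \<open>L |z m|\<close> when the
  height \<open>z m\<close> is introduced.  So they stay positive while \<open>|z m|\<close> is less than \<open>bary_prod m z / L\<close>.
  
  There remains the coordinate \<open>B i0\<close> of the opposite vertex.  It vanishes only on the facet, hence
  has a constant sign on the connected collar.  The sign is positive at some point: \<open>H\<close> is an open map,
  so it has positive values arbitrarily near a point of the facet; these are not attained at positive
  heights, since the open simplices of \<open>\<tau>\<close> and \<open>\<tau>0\<close> are disjoint.
\<close>

lemma facet_collar:
  assumes n: "n = Suc m" and i: "i \<le> n" "i0 \<le> n" and \<tau>: "\<tau>0 \<in> \<Phi> n" "\<tau> \<in> \<Phi> n" "\<tau>0 \<noteq> \<tau>"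
    and facet: "restrict (\<tau>0 \<circ> face_map m i0) (std_simplex m) = restrict (\<tau> \<circ> face_map m i) (std_simplex m)"
    and U: "openin (Euclidean_space n) U" "std_simplex n \<subseteq> U" "smooth_embedding n n M \<A> U f"
      "\<And>x. x \<in> std_simplex n \<Longrightarrow> \<tau> x = f x" "inj_on f U"
  shows "\<exists>c>0. c \<le> 1 \<and> (\<forall>z\<in>ES n. (\<forall>j\<le>m. 0 \<le> bary m j z) \<and> \<bar>z m\<bar> \<le> c * bary_prod m z \<longrightarrow> cone_pt m i z \<in> U) \<and>
    (\<forall>z\<in>slab m c 0. f (cone_pt m i z) \<in> \<tau>0 ` osimplex n)"
proof -
  have im: "i \<le> Suc m" "i0 \<le> Suc m" using i n by auto
  obtain U0 f0 where U0: "openin (Euclidean_space n) U0" "std_simplex n \<subseteq> U0" "smooth_embedding n n M \<A> U0 f0"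
    "\<And>x. x \<in> std_simplex n \<Longrightarrow> \<tau>0 x = f0 x" "inj_on f0 U0"
    using simplex_extension[OF \<tau>(1) order_refl] by metis
  let ?g0 = "inv_into U0 f0"
  note top = top_simplex_chart[OF U(1,3)] and top0 = top_simplex_chart[OF U0(1,3)]
  have g0: "?g0 (f0 x) = x" if "x \<in> U0" for x using U0(5) that by simp
  have gf: "inv_into U f (f x) = x" if "x \<in> U" for x using U(5) that by simp
  have W0: "openin M (f0 ` U0)" by (rule top0(2)[OF U0(1) order_refl])
  define X1 where "X1 = {x \<in> ES n. bary n i x < 1}"
  have dc: "diffeo n X1 {z \<in> ES n. z m < 1} (cone_coord m i) (cone_pt m i)"
    using diffeo_cone[OF im(1)] unfolding X1_def n .
  define U' where "U' = X1 \<inter> (U \<inter> f -` (f0 ` U0))"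
  have U'op: "openin (Euclidean_space n) U'"
    unfolding U'_def using dc top(3)[OF W0] by (auto simp: diffeo_def)
  define O' where "O' = cone_coord m i ` U'"
  have dO: "diffeo n U' O' (cone_coord m i) (cone_pt m i)"
    unfolding O'_def by (rule diffeo_restrict[OF dc U'op]) (auto simp: U'_def)
  then have Oop: "openin (Euclidean_space n) O'" and OU: "cone_pt m i ` O' \<subseteq> U'"
    by (auto simp: diffeo_def)
  have O'_iff: "z \<in> O' \<longleftrightarrow> z \<in> ES n \<and> z m < 1 \<and> cone_pt m i z \<in> U \<and> f (cone_pt m i z) \<in> f0 ` U0" for z
  proof
    assume "z \<in> O'"
    then show "z \<in> ES n \<and> z m < 1 \<and> cone_pt m i z \<in> U \<and> f (cone_pt m i z) \<in> f0 ` U0"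
      using OU openin_ES_subset[OF Oop] bary_cone_self[OF im(1), of z] n
      by (auto simp: U'_def X1_def image_subset_iff simp del: bary_simps)
  next
    assume z: "z \<in> ES n \<and> z m < 1 \<and> cone_pt m i z \<in> U \<and> f (cone_pt m i z) \<in> f0 ` U0"
    then have "cone_pt m i z \<in> U'"
      using bary_cone_self[OF im(1), of z] cone_pt_ES[OF im(1)] n by (auto simp: U'_def X1_def simp del: bary_simps)
    moreover have "cone_coord m i (cone_pt m i z) = z" using cone_coord_pt[OF im(1)] z n by auto
    ultimately show "z \<in> O'" unfolding O'_def by (metis imageI)
  qed
  define H where "H z = ?g0 (f (cone_pt m i z))" for z
  have HU0: "H z \<in> U0" "f0 (H z) = f (cone_pt m i z)" if "z \<in> O'" for z
    using that O'_iff unfolding H_def by (auto simp: inv_into_into f_inv_into_f)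
  have sH: "smooth_map_on n n O' H"
  proof -
    have d: "diffeo n (inv_into U f ` f ` U') (?g0 ` f ` U') (?g0 \<circ> inv_into (f ` U) (inv_into U f))
        (inv_into U f \<circ> inv_into (f0 ` U0) ?g0)"
      by (rule transition_diffeo[OF S top(1) top0(1)]) (use top(2)[OF U'op] in \<open>auto simp: U'_def\<close>)
    have im': "inv_into U f ` f ` U' = U'" using gf by (force simp: U'_def image_iff)
    have "smooth_map_on n n U' (?g0 \<circ> inv_into (f ` U) (inv_into U f))"
      using d im' by (simp add: diffeo_def)
    then have "smooth_map_on n n U' (\<lambda>x. ?g0 (f x))"
    proof (rule smooth_map_on_cong[OF U'op, rotated])
      fix x k assume "x \<in> U'"
      then have "x \<in> U" by (simp add: U'_def)
      then have "inv_into (f ` U) (inv_into U f) x = f x"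
        using gf by (metis imageI inj_on_inv_into inv_into_f_f order_refl)
      then show "(?g0 \<circ> inv_into (f ` U) (inv_into U f)) x k = ?g0 (f x) k" by simp
    qed
    then have "smooth_map_on n n O' ((\<lambda>x. ?g0 (f x)) \<circ> cone_pt m i)"
      by (rule smooth_map_on_compose[OF Oop U'op OU smooth_cone_pt[OF Oop]])
    then show ?thesis by (simp add: H_def[abs_def] o_def)
  qed
  have HE: "H ` O' \<subseteq> ES n" using HU0 openin_ES_subset[OF U0(1)] by auto
  have cH: "continuous_on O' H" by (rule smooth_map_on_continuous[OF Oop sH HE])
  \<comment> \<open>the barycentric coordinates with respect to \<open>\<tau>0\<close>\<close>
  define B where "B k z = bary n k (H z)" for k z
  have CB: "Ck_on n r O' (B k)" if "k \<le> n" for k r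
  proof (cases k)
    case 0
    have "Ck_on n r O' (\<lambda>z. 1 - (\<Sum>j<n. H z j))"
      using sH by (intro Ck_on_intros Oop) (auto simp: smooth_map_on_def)
    then show ?thesis by (simp add: B_def[abs_def] 0)
  next
    case (Suc j)
    then show ?thesis using sH that by (simp add: B_def[abs_def] smooth_map_on_def)
  qed
  have mn: "m < n" using n by simp
  define dB where "dB k = partial_deriv m (B k)" for k
  have dB: "((\<lambda>t. B k (z(m := t))) has_real_derivative dB k z) (at (z m))" if "k \<le> n" "z \<in> O'" for k z
    unfolding dB_def by (rule Ck_on_Suc_partial(2)[OF CB[OF that(1), of "Suc 0"] mn that(2)])
  have cdB: "continuous_on O' (dB k)" if "k \<le> n" for k
    unfolding dB_def by (rule Ck_on_imp_continuous_on[OF Oop Ck_on_Suc_partial(1)[OF CB[OF that, of "Suc 0"] mn]])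
  have face: "z \<in> O'" "H z = face_map m i0 z" if z: "z \<in> std_simplex m" for z
  proof -
    have zE: "z \<in> ES m" using z std_simplex_subset_ES by blast
    then have zm: "z m = 0" "z \<in> ES n" using n by (auto simp: ES_iff)
    have c: "cone_pt m i z = face_map m i z" by (simp add: cone_pt_def zm)
    have "f (face_map m i z) = \<tau> (face_map m i z)" using U(4) face_map_simplex[OF im(1) z] n by simp
    also have "\<dots> = \<tau>0 (face_map m i0 z)" using fun_cong[OF facet, of z] z by simp
    also have "\<dots> = f0 (face_map m i0 z)" using U0(4) face_map_simplex[OF im(2) z] n by simp
    finally have eq: "f (face_map m i z) = f0 (face_map m i0 z)" .
    have in0: "face_map m i0 z \<in> U0" "face_map m i z \<in> U"
      using U0(2) U(2) face_map_simplex[OF im(2) z] face_map_simplex[OF im(1) z] n by auto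
    show "z \<in> O'" unfolding O'_iff c eq using zm in0 by auto
    show "H z = face_map m i0 z" unfolding H_def c eq using g0 in0 by simp
  qed
  have compact: "compact (std_simplex m)" by (rule compact_std_simplex)
  obtain z0 where z0: "z0 \<in> osimplex m"
  proof
    let ?z = "\<lambda>j. if j < m then 1 / real (Suc m) else 0"
    have "0 < bary m k ?z" if "k \<le> m" for k
      using that by (cases k) (auto simp: field_simps)
    then show "?z \<in> osimplex m" by (auto simp: osimplex_def ES_iff)
  qed
  have z0s: "z0 \<in> std_simplex m" using z0 osimplex_subset by blast
  \<comment> \<open>a common bound of the derivatives of all \<open>B k\<close> in the direction of the height\<close>
  let ?h = "\<lambda>z. \<Sum>k\<le>n. \<bar>dB k z\<bar>"
  have ch: "continuous_on O' ?h" using cdB by (intro continuous_intros) auto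
  have subO: "std_simplex m \<subseteq> O'" using face by blast
  obtain zM where "\<And>z. z \<in> std_simplex m \<Longrightarrow> ?h z \<le> ?h zM"
    using continuous_attains_sup[OF compact _ continuous_on_subset[OF ch subO]] z0s by blast
  define L where "L = ?h zM + 1"
  have L: "?h z < L" if "z \<in> std_simplex m" for z
    using \<open>\<And>z. z \<in> std_simplex m \<Longrightarrow> ?h z \<le> ?h zM\<close>[OF that] by (simp add: L_def)
  have L0: "L > 0" unfolding L_def by (intro add_nonneg_pos sum_nonneg) auto
  have "openin (top_of_set O') (O' \<inter> ?h -` {..<L})"
    by (rule continuous_openin_preimage_gen[OF ch]) simp
  then obtain T0 where "open T0" "O' \<inter> ?h -` {..<L} = O' \<inter> T0" unfolding openin_open by blast
  moreover obtain T1 where "open T1" "O' = ES n \<inter> T1" using Oop openin_ES_iff by blast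
  ultimately have T: "open (T1 \<inter> T0)" "O' \<inter> ?h -` {..<L} = ES n \<inter> (T1 \<inter> T0)" by auto
  have "\<exists>r>0. \<forall>z\<in>std_simplex m. \<forall>s. \<bar>s\<bar> \<le> r \<longrightarrow> z(m := s) \<in> T1 \<inter> T0"
  proof (rule compact_tube_fun_upd[OF compact T(1)])
    fix z assume z: "z \<in> std_simplex m"
    then have "z(m := 0) = z" using std_simplex_subset_ES by (fastforce simp: ES_iff)
    moreover have "z \<in> O' \<inter> ?h -` {..<L}" using face(1)[OF z] L[OF z] by simp
    ultimately show "z(m := 0) \<in> T1 \<inter> T0" unfolding T(2) by simp
  qed
  then obtain r where r: "r > 0" "\<And>z s. z \<in> std_simplex m \<Longrightarrow> \<bar>s\<bar> \<le> r \<Longrightarrow> z(m := s) \<in> T1 \<inter> T0" by blast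
  have tube: "z(m := s) \<in> O'" "?h (z(m := s)) < L" if "z \<in> std_simplex m" "\<bar>s\<bar> \<le> r" for z s
  proof -
    have "z(m := s) \<in> ES n" using that(1) std_simplex_subset_ES n by (fastforce simp: ES_iff)
    then have "z(m := s) \<in> O' \<inter> ?h -` {..<L}" using r(2)[OF that] T(2) by blast
    then show "z(m := s) \<in> O'" "?h (z(m := s)) < L" by auto
  qed
  have lip: "\<bar>B k (z(m := s)) - B k z\<bar> \<le> L * \<bar>s\<bar>" if z: "z \<in> std_simplex m" and s: "\<bar>s\<bar> \<le> r" and k: "k \<le> n" for z s k
  proof -
    have "\<exists>t. min 0 s \<le> t \<and> t \<le> max 0 s \<and> B k (z(m := s)) - B k (z(m := 0)) = dB k (z(m := t)) * (s - 0)"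
    proof (rule MVT_abs)
      fix t assume "min 0 s \<le> t" "t \<le> max 0 s"
      then have "z(m := t) \<in> O'" using tube(1)[OF z, of t] s by auto
      from dB[OF k this] show "((\<lambda>a. B k (z(m := a))) has_real_derivative dB k (z(m := t))) (at t)" by simp
    qed
    then obtain t where t: "min 0 s \<le> t" "t \<le> max 0 s" "B k (z(m := s)) - B k (z(m := 0)) = dB k (z(m := t)) * s"
      by auto
    have z0: "z(m := 0) = z" using z std_simplex_subset_ES by (fastforce simp: ES_iff)
    have "\<bar>dB k (z(m := t))\<bar> \<le> ?h (z(m := t))"
      using k by (intro member_le_sum) auto
    moreover have "\<bar>t\<bar> \<le> r" using t(1,2) s by auto
    ultimately have "\<bar>dB k (z(m := t))\<bar> \<le> L" using tube(2)[OF z, of t] by linarith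
    with z0 show ?thesis using t(3) by (simp add: abs_mult mult_right_mono)
  qed
  \<comment> \<open>\<open>c \<le> r\<close> keeps the collar in the tube, \<open>c L \<le> 1\<close> keeps the other coordinates positive\<close>
  define c where "c = min (min r 1) (1 / L)"
  have c: "c > 0" "c \<le> 1" "c \<le> r" and "c \<le> 1 / L" unfolding c_def using r(1) L0 by auto
  then have c4: "c * L \<le> 1" using L0 by (simp add: field_simps)
  have proj: "z(m := 0) \<in> std_simplex m" "(z(m := 0))(m := z m) = z" "\<And>j. j \<le> m \<Longrightarrow> bary m j (z(m := 0)) = bary m j z"
    if "z \<in> ES n" "\<And>j. j \<le> m \<Longrightarrow> 0 \<le> bary m j z" for z
  proof -
    show b: "bary m j (z(m := 0)) = bary m j z" if "j \<le> m" for j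
      using that by (intro bary_cong) auto
    have "z(m := 0) \<in> ES m" using that(1) n by (auto simp: ES_iff)
    then show "z(m := 0) \<in> std_simplex m" using that(2) b by (simp add: std_simplex_iff)
  qed simp
  have P1: "bary_prod m z \<le> 1" if "\<And>j. j \<le> m \<Longrightarrow> 0 \<le> bary m j z" for z
    using bary_prod_le[OF that, of 0] bary_le_1[OF that, of 0] by linarith
  have near: "z \<in> O'" "\<And>j. j \<le> m \<Longrightarrow> bary m j z - L * \<bar>z m\<bar> \<le> B (skip i0 j) z"
    if "z \<in> ES n" "\<And>j. j \<le> m \<Longrightarrow> 0 \<le> bary m j z" "\<bar>z m\<bar> \<le> c * bary_prod m z" for z
  proof -
    note pz = proj[OF that(1,2)]
    have "c * bary_prod m z \<le> c * 1" using P1[OF that(2)] c(1) by (intro mult_left_mono) auto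
    then have zr: "\<bar>z m\<bar> \<le> r" using that(3) c(3) by simp
    show "z \<in> O'" using tube(1)[OF pz(1) zr] pz(2) by simp
    fix j assume j: "j \<le> m"
    have "\<bar>B (skip i0 j) z - B (skip i0 j) (z(m := 0))\<bar> \<le> L * \<bar>z m\<bar>"
      using lip[OF pz(1) zr, of "skip i0 j"] skip_le[OF j] n pz(2) by simp
    moreover have "B (skip i0 j) (z(m := 0)) = bary m j z"
      using bary_face_skip[OF im(2) j, of "z(m := 0)"] pz(3) j face(2)[OF pz(1)] unfolding B_def n by metis
    ultimately show "bary m j z - L * \<bar>z m\<bar> \<le> B (skip i0 j) z" by linarith
  qed
  have Bpos: "0 < B (skip i0 j) z"
    if "z \<in> ES n" "\<And>j. j \<le> m \<Longrightarrow> 0 < bary m j z" "\<bar>z m\<bar> < c * bary_prod m z" "j \<le> m" for z j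
  proof -
    have nn: "\<And>j. j \<le> m \<Longrightarrow> 0 \<le> bary m j z" using that(2) less_imp_le by blast
    have "L * \<bar>z m\<bar> < L * (c * bary_prod m z)" using that(3) L0 by (rule mult_strict_left_mono)
    also have "\<dots> = (c * L) * bary_prod m z" by simp
    also have "\<dots> \<le> 1 * bary_prod m z" using c4 bary_prod_nonneg[OF nn] by (intro mult_right_mono) auto
    also have "\<dots> \<le> bary m j z" using bary_prod_le[OF nn that(4)] by simp
    finally show ?thesis using near(2)[OF that(1) nn _ that(4)] that(3) by simp
  qed
  have slab_abs: "\<bar>z m\<bar> < c * bary_prod m z" if "z \<in> slab m c 0" for z
    using that by (auto simp: slab_def)
  have slab_E: "z \<in> ES n" "\<And>j. j \<le> m \<Longrightarrow> 0 < bary m j z" if "z \<in> slab m c 0" for z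
    using that n by (auto simp: slab_def)
  have slab_O: "z \<in> O'" if "z \<in> slab m c 0" for z
    using near(1)[of z] slab_E[OF that] slab_abs[OF that] less_imp_le by metis
  have all_k: "\<And>k. k \<le> n \<Longrightarrow> 0 < B k z"
    if "\<And>j. j \<le> m \<Longrightarrow> 0 < B (skip i0 j) z" "0 < B i0 z" for z
    using that obtain_skip[of _ m i0] im n by (metis not_le)
  have B_face: "z m = 0" if z: "z \<in> O'" "\<And>j. j \<le> m \<Longrightarrow> 0 < B (skip i0 j) z" "B i0 z = 0" for z
  proof -
    have "H z \<in> ES (Suc m)" using HE z(1) n by auto
    then obtain y where y: "y \<in> ES m" "H z = face_map m i0 y" "\<forall>k\<le>m. bary m k y = bary (Suc m) (skip i0 k) (H z)"
      using bary_zero_imp_face[OF _ im(2), of "H z"] z(3) unfolding B_def n by blast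
    then have ys: "y \<in> std_simplex m" using z(2) unfolding B_def n by (auto simp: std_simplex_iff less_imp_le)
    have "f (cone_pt m i z) = f0 (face_map m i0 y)" using HU0(2)[OF z(1)] y(2) by simp
    also have "\<dots> = f0 (H y)" using face(2)[OF ys] by simp
    also have "\<dots> = f (cone_pt m i y)" using HU0(2)[OF face(1)[OF ys]] .
    finally have "cone_pt m i z = cone_pt m i y"
      using U(5) z(1) face(1)[OF ys] O'_iff by (meson inj_onD)
    then have "z m = y m" using bary_cone_self[OF im(1)] by metis
    then show ?thesis using y(1) by (simp add: ES_iff)
  qed
  have nz: "B i0 z \<noteq> 0" if "z \<in> slab m c 0" for z
    using B_face[OF slab_O[OF that] Bpos[OF slab_E[OF that] slab_abs[OF that]]] that by (auto simp: slab_def)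
  have "\<exists>z\<in>slab m c 0. 0 < B i0 z"
  proof -
    define N where "N = {z \<in> O'. (\<forall>j\<le>m. 0 < bary m j z) \<and> \<bar>z m\<bar> < c * bary_prod m z}"
    have "openin (Euclidean_space n) {z \<in> ES n. \<forall>j<Suc m. 0 < bary m j z}"
      by (rule openin_ES_Collect_less) (auto intro: continuous_intros)
    moreover have "openin (Euclidean_space n) {z \<in> ES n. \<forall>j<Suc 0. \<bar>z m\<bar> < c * bary_prod m z}"
      unfolding bary_prod_def by (rule openin_ES_Collect_less) (intro continuous_intros)+
    ultimately have "openin (Euclidean_space n) (O' \<inter> ({z \<in> ES n. \<forall>j<Suc m. 0 < bary m j z} \<inter> {z \<in> ES n. \<forall>j<Suc 0. \<bar>z m\<bar> < c * bary_prod m z}))"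
      using Oop by blast
    moreover have "O' \<inter> ({z \<in> ES n. \<forall>j<Suc m. 0 < bary m j z} \<inter> {z \<in> ES n. \<forall>j<Suc 0. \<bar>z m\<bar> < c * bary_prod m z}) = N"
      using openin_ES_subset[OF Oop] by (auto simp: N_def less_Suc_eq_le simp del: bary_simps)
    ultimately have Nop: "openin (Euclidean_space n) N" by simp
    have injH: "inj_on H N"
    proof (rule inj_onI)
      fix a b assume ab: "a \<in> N" "b \<in> N" "H a = H b"
      then have O: "a \<in> O'" "b \<in> O'" by (auto simp: N_def)
      then have "cone_pt m i a = cone_pt m i b" using HU0(2)[OF O(1)] HU0(2)[OF O(2)] ab(3) U(5) O'_iff by (metis inj_onD)
      then show "a = b" using O O'_iff cone_coord_pt[OF im(1)] n by (metis less_irrefl)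
    qed
    have z0N: "z0 \<in> N"
    proof -
      have "z0 m = 0" "\<forall>j\<le>m. 0 < bary m j z0" using z0 by (auto simp: osimplex_def ES_iff)
      then show ?thesis using face(1)[OF z0s] bary_prod_pos[of m z0] c(1) by (simp add: N_def del: bary_simps)
    qed
    have "openin (Euclidean_space n) (H ` N)"
    proof (rule invariance_of_domain_Euclidean_space[OF Nop _ injH])
      show "continuous_map (subtopology (Euclidean_space n) N) (Euclidean_space n) H"
        using continuous_on_subset[OF cH, of N] HE continuous_map_ES_ES[OF openin_ES_subset[OF Nop]]
        by (auto simp: N_def)
    qed
    then obtain e where e: "e > 0" "\<And>y. y \<in> ES n \<Longrightarrow> (\<forall>j<n. \<bar>y j - H z0 j\<bar> < e) \<Longrightarrow> y \<in> H ` N"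
      using openin_ES_box[of n "H ` N" "H z0"] z0N by blast
    \<comment> \<open>a point near \<open>H z0\<close>, moved from the facet towards the opposite vertex\<close>
    define w where "w = (\<lambda>j. (1 - min 1 (e/2)) * H z0 j + min 1 (e/2) * vertex i0 j)"
    have Hz0: "H z0 \<in> std_simplex n" using face(2)[OF z0s] face_map_simplex[OF im(2) z0s] n by simp
    have "w \<in> ES n" using Hz0 vertex_in_ES[OF i(2)] std_simplex_subset_ES by (fastforce simp: w_def ES_iff)
    moreover have "\<bar>w j - H z0 j\<bar> < e" if "j < n" for j
    proof -
      have "w j - H z0 j = min 1 (e/2) * (vertex i0 j - H z0 j)" by (simp add: w_def algebra_simps)
      moreover have "0 \<le> H z0 j" "H z0 j \<le> 1" using Hz0 that by (auto simp: std_simplex_def)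
      then have "\<bar>vertex i0 j - H z0 j\<bar> \<le> 1" by (auto simp: vertex_def)
      then have "\<bar>min 1 (e/2)\<bar> * \<bar>vertex i0 j - H z0 j\<bar> \<le> \<bar>min 1 (e/2)\<bar> * 1" by (intro mult_left_mono) auto
      ultimately show ?thesis using e(1) by (simp add: abs_mult)
    qed
    ultimately obtain z where z: "z \<in> N" "H z = w" using e(2) by blast
    have "B i0 z = min 1 (e/2)"
    proof -
      have "bary n i0 (H z0) = 0" using bary_face_self[OF im(2)] face(2)[OF z0s] n by simp
      then show ?thesis unfolding B_def z(2) w_def bary_affine using bary_vertex[OF i(2) i(2)] by simp
    qed
    then have Bz: "B i0 z > 0" using e(1) by simp
    have zN: "z \<in> O'" "\<forall>j\<le>m. 0 < bary m j z" "\<bar>z m\<bar> < c * bary_prod m z" "z \<in> ES n" "z m < 1"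
      using z(1) O'_iff by (auto simp: N_def)
    have "B k z > 0" if "k \<le> n" for k
      using all_k[OF Bpos[OF zN(4)] Bz that] zN by blast
    then have Ho: "H z \<in> osimplex n" using HE zN(1) by (auto simp: osimplex_def B_def)
    then have f0: "f (cone_pt m i z) = \<tau>0 (H z)"
      using HU0(2)[OF zN(1)] U0(4)[OF subsetD[OF osimplex_subset]] by metis
    have "z m < 0"
    proof (rule ccontr)
      assume "\<not> z m < 0"
      then consider "z m = 0" | "z m > 0" by linarith
      then show False
      proof cases
        case 1
        then have "z \<in> std_simplex m" using proj(1)[OF zN(4)] zN(2) less_imp_le by (metis fun_upd_triv)
        then have "B i0 z = 0" unfolding B_def using face(2) bary_face_self[OF im(2)] n by simp
        then show False using Bz by simp
      next
        case 2
        have "0 < bary (Suc m) k (cone_pt m i z)" if k: "k \<le> Suc m" for k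
        proof (cases "k = i")
          case False
          then obtain j where "j \<le> m" "k = skip i j" using obtain_skip[OF k False] im by (metis not_le)
          then show ?thesis using bary_cone_skip[OF im(1)] zN(2,5) by simp
        qed (use bary_cone_self[OF im(1)] 2 in simp)
        then have co: "cone_pt m i z \<in> osimplex n" using cone_pt_ES[OF im(1)] n by (auto simp: osimplex_def simp del: bary_simps)
        then have "\<tau> (cone_pt m i z) = \<tau>0 (H z)" using f0 U(4)[OF subsetD[OF osimplex_subset co]] by simp
        then show False using open_simplices_disjoint(2)[OF \<tau>(2) order_refl co \<tau>(1) order_refl Ho] \<tau>(3) by simp
      qed
    qed
    then have "z \<in> slab m c 0" using zN n by (auto simp: slab_def)
    then show ?thesis using Bz by blast
  qed
  then obtain zp where zp: "zp \<in> slab m c 0" "0 < B i0 zp" by blast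
  have cB: "continuous_on (slab m c 0) (B i0)"
    by (rule continuous_on_subset[OF Ck_on_imp_continuous_on[OF Oop CB[OF i(2), of 0]]]) (use slab_O in blast)
  have "f (cone_pt m i z) \<in> \<tau>0 ` osimplex n" if z: "z \<in> slab m c 0" for z
  proof -
    have "0 < B i0 z" by (rule slab_connected_sign[OF cB nz c(1) zp z])
    then have "0 < B k z" if "k \<le> n" for k
      using all_k[OF Bpos[OF slab_E[OF z] slab_abs[OF z]] _ that] by blast
    then have Ho: "H z \<in> osimplex n" using HE slab_O[OF z] by (auto simp: osimplex_def B_def)
    moreover have "f (cone_pt m i z) = \<tau>0 (H z)" using HU0(2)[OF slab_O[OF z]] U0(4)[OF subsetD[OF osimplex_subset Ho]] by metis
    ultimately show ?thesis by blast
  qed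
  moreover have "cone_pt m i z \<in> U" if "z \<in> ES n" "\<forall>j\<le>m. 0 \<le> bary m j z" "\<bar>z m\<bar> \<le> c * bary_prod m z" for z
    using near(1)[OF that(1) _ that(3)] that(2) O'_iff by blast
  ultimately show ?thesis using c(1,2) by blast
qed

end

section \<open>A smooth push across a facet\<close>

text \<open>
  For \<open>p = 1\<close> this is the standard smooth function that vanishes for \<open>x \<le> 0\<close>.  The polynomial factor
  makes the family closed under differentiation.
\<close>

definition flat :: "real poly \<Rightarrow> real \<Rightarrow> real" where
  "flat p x = (if x > 0 then poly p (1 / x) * exp (- 1 / x) else 0)"

lemma poly_times_exp_tendsto_0: "((\<lambda>y. poly p y * exp (- y :: real)) \<longlongrightarrow> 0) at_top"
proof -
  have "((\<lambda>y. \<Sum>i\<le>Polynomial.degree p. Polynomial.coeff p i * (y ^ i / exp y)) \<longlongrightarrow> (\<Sum>i\<le>Polynomial.degree p. Polynomial.coeff p i * 0)) at_top"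
    by (intro tendsto_intros tendsto_power_div_exp_0)
  then show ?thesis
    by (simp add: poly_altdef sum_distrib_right exp_minus divide_inverse mult.assoc)
qed

lemma flat_DERIV: "(flat p has_real_derivative flat ([:0, 0, 1:] * (p - pderiv p)) x) (at x)"
proof -
  consider "x > 0" | "x < 0" | "x = 0" by linarith
  then show ?thesis
  proof cases
    case 1
    have "((\<lambda>x. poly p (1 / x) * exp (- 1 / x)) has_real_derivative
        flat ([:0, 0, 1:] * (p - pderiv p)) x) (at x)"
      using 1 by (auto intro!: derivative_eq_intros DERIV_chain'[OF _ poly_DERIV] simp: flat_def field_simps power2_eq_square)
    moreover
    have "\<forall>\<^sub>F y in nhds x. poly p (1 / y) * exp (- 1 / y) = flat p y"
      using eventually_nhds_in_open[of "{0<..}" x] 1 by (auto elim!: eventually_mono simp: flat_def)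
    then have "((\<lambda>x. poly p (1 / x) * exp (- 1 / x)) has_real_derivative
        flat ([:0, 0, 1:] * (p - pderiv p)) x) (at x) \<longleftrightarrow>
        (flat p has_real_derivative flat ([:0, 0, 1:] * (p - pderiv p)) x) (at x)"
      by (intro DERIV_cong_ev) auto
    ultimately show ?thesis by blast
  next
    case 2
    have "\<forall>\<^sub>F y in nhds x. 0 = flat p y"
      using eventually_nhds_in_open[of "{..<0}" x] 2 by (auto elim!: eventually_mono simp: flat_def)
    then have "((\<lambda>_. 0) has_real_derivative 0) (at x) \<longleftrightarrow> (flat p has_real_derivative 0) (at x)"
      by (intro DERIV_cong_ev) auto
    then show ?thesis using 2 by (simp add: flat_def[of _ x])
  next
    case 3
    have "((\<lambda>h. flat p h / h) \<longlongrightarrow> 0) (at_left 0)"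
      by (rule tendsto_eventually) (auto simp: eventually_at_left_field flat_def intro!: exI[of _ "-1"])
    moreover have "((\<lambda>h. flat p h / h) \<longlongrightarrow> 0) (at_right 0)"
    proof (rule Lim_transform_eventually)
      show "((\<lambda>h. poly (pCons 0 p) (inverse h) * exp (- inverse h)) \<longlongrightarrow> 0) (at_right (0::real))"
        by (rule filterlim_compose[OF poly_times_exp_tendsto_0 filterlim_inverse_at_top_right])
      show "\<forall>\<^sub>F h in at_right 0. poly (pCons 0 p) (inverse h) * exp (- inverse h) = flat p h / h"
        by (auto simp: eventually_at_right_field flat_def divide_inverse intro!: exI[of _ 1])
    qed
    ultimately have "((\<lambda>h. flat p h / h) \<longlongrightarrow> 0) (at 0)" by (rule filterlim_split_at)
    then have "(flat p has_real_derivative 0) (at 0)"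
      by (simp add: has_field_derivative_iff flat_def[of _ 0])
    then show ?thesis using 3 by (simp add: flat_def[of _ 0])
  qed
qed

lemma Ck_on_flat:
  assumes U: "openin (Euclidean_space d) U"
  shows "Ck_on d k U f \<Longrightarrow> Ck_on d k U (\<lambda>x. flat p (f x))"
proof (induction k arbitrary: p)
  case (0 p)
  have "continuous_on UNIV (flat p)"
    using DERIV_isCont[OF flat_DERIV[of p]] by (simp add: continuous_on_eq_continuous_at)
  then have "continuous_on U (\<lambda>x. flat p (f x))"
    using Ck_on_imp_continuous_on[OF U 0] by (auto intro: continuous_on_compose2)
  then show ?case using continuous_map_ES_real[OF openin_ES_subset[OF U]] by simp
next
  case (Suc k p)
  have cf: "continuous_on UNIV (flat p)"
    using DERIV_isCont[OF flat_DERIV[of p]] by (simp add: continuous_on_eq_continuous_at)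
  show ?case
  proof (rule Ck_on_SucI[OF U, where g = "\<lambda>i x. flat ([:0, 0, 1:] * (p - pderiv p)) (f x) * partial_deriv i f x"])
    show "continuous_on U (\<lambda>x. flat p (f x))"
      using Ck_on_imp_continuous_on[OF U Suc.prems] cf by (auto intro: continuous_on_compose2)
    show "((\<lambda>t. flat p (f (x(i := t)))) has_real_derivative
        flat ([:0, 0, 1:] * (p - pderiv p)) (f x) * partial_deriv i f x) (at (x i))" if "i < d" "x \<in> U" for i x
    proof -
      have "((\<lambda>t. f (x(i := t))) has_real_derivative partial_deriv i f x) (at (x i))"
        by (rule Ck_on_Suc_partial(2)[OF Suc.prems that])
      from DERIV_chain2[where f = "flat p", OF _ this] show ?thesis
        using flat_DERIV by (metis fun_upd_triv)
    qed
    show "Ck_on d k U (\<lambda>x. flat ([:0, 0, 1:] * (p - pderiv p)) (f x) * partial_deriv i f x)" if "i < d" for i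
      by (rule Ck_on_mult[OF U Suc.IH[OF Ck_on_Suc_imp[OF Suc.prems]] Ck_on_Suc_partial(1)[OF Suc.prems that]])
  qed
qed

text \<open>
  A smooth nondecreasing function that vanishes up to \<open>-1/2\<close> and reaches the value \<open>1\<close> at \<open>0\<close>; it is
  used only for negative arguments.
\<close>

definition push_profile :: "real \<Rightarrow> real" where
  "push_profile u = exp 2 * flat 1 (u + 1/2)"

lemma push_profile_props:
  "u \<le> -1/2 \<Longrightarrow> push_profile u = 0" "0 \<le> push_profile u" "push_profile 0 = 1"
  "u < 0 \<Longrightarrow> push_profile u < 1" "u \<le> v \<Longrightarrow> push_profile u \<le> push_profile v"
proof -
  show "u \<le> -1/2 \<Longrightarrow> push_profile u = 0" "0 \<le> push_profile u" "push_profile 0 = 1"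
    by (auto simp: push_profile_def flat_def simp flip: exp_add)
  show "push_profile u < 1" if "u < 0"
  proof (cases "u > -1/2")
    case True
    then have "2 + - 1 / (u + 1/2) < 0" using that by (simp add: field_simps)
    then have "exp (2 + - 1 / (u + 1/2)) < 1" by simp
    then show ?thesis using True by (simp add: push_profile_def flat_def flip: exp_add)
  qed (simp add: push_profile_def flat_def)
  show "push_profile u \<le> push_profile v" if "u \<le> v"
  proof (cases "u > -1/2")
    case True
    then have "- 1 / (u + 1/2) \<le> - 1 / (v + 1/2)" using that by (simp add: field_simps)
    then show ?thesis using True that by (simp add: push_profile_def flat_def)
  qed (auto simp: push_profile_def flat_def)
qed

lemma push_profile_DERIV: "\<exists>D\<ge>0. (push_profile has_real_derivative D) (at u)"
proof -
  let ?D = "exp 2 * flat ([:0, 0, 1:] * (1 - pderiv 1)) (u + 1/2)"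
  have "((\<lambda>u. flat 1 (u + 1/2)) has_real_derivative flat ([:0, 0, 1:] * (1 - pderiv 1)) (u + 1/2) * 1) (at u)"
    by (rule DERIV_chain2[OF flat_DERIV]) (auto intro!: derivative_eq_intros)
  then have "(push_profile has_real_derivative ?D) (at u)"
    unfolding push_profile_def[abs_def] by (auto intro!: derivative_eq_intros)
  moreover have "?D \<ge> 0" by (auto simp: flat_def)
  ultimately show ?thesis by blast
qed

lemma Ck_on_bary_prod: "openin (Euclidean_space d) U \<Longrightarrow> Ck_on d r U (bary_prod m)"
  unfolding bary_prod_def[abs_def] by (intro Ck_on_prod Ck_on_bary)

text \<open>
  With \<open>e = c * bary_prod m z\<close> and \<open>u = z m / e\<close>, a height \<open>e u\<close> between \<open>-e\<close> and \<open>0\<close> becomes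
  \<open>e u + push_profile u\<close>, which runs through all heights between \<open>-e\<close> and \<open>1\<close>, and equals \<open>e u\<close> on the
  outer half of the collar.
\<close>

definition push :: "nat \<Rightarrow> real \<Rightarrow> (nat \<Rightarrow> real) \<Rightarrow> nat \<Rightarrow> real" where
  "push m c z = z(m := z m + push_profile (z m / (c * bary_prod m z)))"

lemma openin_slab: "openin (Euclidean_space (Suc m)) (slab m c h)"
proof -
  let ?A = "{z \<in> ES (Suc m). \<forall>j<Suc m. 0 < bary m j z}"
    and ?B = "{z \<in> ES (Suc m). \<forall>j<Suc 0. - (c * bary_prod m z) < z m}"
    and ?C = "{z \<in> ES (Suc m). \<forall>j<Suc 0. z m < h}"
  have "openin (Euclidean_space (Suc m)) ?A" "openin (Euclidean_space (Suc m)) ?B" "openin (Euclidean_space (Suc m)) ?C"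
    unfolding bary_prod_def by (rule openin_ES_Collect_less; intro continuous_intros)+
  then have "openin (Euclidean_space (Suc m)) (?A \<inter> ?B \<inter> ?C)" by blast
  moreover have "?A \<inter> ?B \<inter> ?C = slab m c h" by (auto simp: slab_def less_Suc_eq_le simp del: bary_simps)
  ultimately show ?thesis by simp
qed

lemma slab_bary_prod_pos: "z \<in> slab m c h \<Longrightarrow> 0 < bary_prod m z"
  by (rule bary_prod_pos) (simp add: slab_def del: bary_simps)

lemma bary_fun_upd [simp]: "j \<le> m \<Longrightarrow> bary m j (z(m := t)) = bary m j z"
  by (rule bary_cong) auto

lemma bary_prod_fun_upd [simp]: "bary_prod m (z(m := t)) = bary_prod m z"
  by (rule bary_prod_cong) auto

lemma slab_fun_upd:
  "z \<in> slab m c h \<Longrightarrow> z(m := t) \<in> slab m c h' \<longleftrightarrow> - (c * bary_prod m z) < t \<and> t < h'"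
  by (auto simp: slab_def ES_iff simp del: bary_simps)

text \<open>
  On each line over a point of the facet the map is strictly increasing, and onto by the intermediate
  value theorem.  Its Jacobian is triangular, with the positive entry \<open>1 + D / e\<close> in the last
  row.
\<close>

lemma push_diffeo:
  assumes c: "c > 0"
  shows "diffeo (Suc m) (slab m c 0) (slab m c 1) (push m c) (inv_into (slab m c 0) (push m c))"
    and "z \<in> slab m c 0 \<Longrightarrow> z m \<le> - (c / 2 * bary_prod m z) \<Longrightarrow> push m c z = z"
proof -
  let ?D = "slab m c 0" and ?e = "\<lambda>z. c * bary_prod m z"
  have e: "?e z > 0" if "z \<in> slab m c h" for z h using slab_bary_prod_pos[OF that] c by simp
  have into: "push m c z \<in> slab m c 1" if z: "z \<in> ?D" for z
  proof -
    have "z m / ?e z < 0" using e[OF z] z by (auto simp: slab_def divide_neg_pos)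
    then show ?thesis unfolding push_def slab_fun_upd[OF z]
      using push_profile_props(2,4)[of "z m / ?e z"] z by (auto simp: slab_def)
  qed
  have strict: "s + push_profile (s / e) < t + push_profile (t / e)" if "s < t" "e > 0" for s t e :: real
    using push_profile_props(5)[of "s / e" "t / e"] that by (simp add: divide_right_mono)
  have inj: "inj_on (push m c) ?D"
  proof (rule inj_onI)
    fix z w assume zw: "z \<in> ?D" "w \<in> ?D" "push m c z = push m c w"
    have j: "z j = w j" if "j \<noteq> m" for j
      using fun_cong[OF zw(3), of j] that by (simp add: push_def)
    then have "bary_prod m z = bary_prod m w" by (intro bary_prod_cong) auto
    moreover have "z m + push_profile (z m / ?e z) = w m + push_profile (w m / ?e w)"
      using fun_cong[OF zw(3), of m] by (simp add: push_def)
    ultimately have "z m = w m"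
      using strict[of "z m" "w m" "?e z"] strict[of "w m" "z m" "?e z"] e[OF zw(1)] by (metis linorder_neqE order_less_irrefl)
    then show "z = w" using j by (metis ext)
  qed
  have surj: "slab m c 1 \<subseteq> push m c ` ?D"
  proof
    fix w assume w: "w \<in> slab m c 1"
    let ?g = "\<lambda>s. s + push_profile (s / ?e w)"
    have wb: "- ?e w < w m" "w m < 1" using w by (auto simp: slab_def)
    have "isCont push_profile u" for u using push_profile_DERIV DERIV_isCont by blast
    then have "isCont ?g s" for s using e[OF w] by (intro continuous_intros isCont_o2[of s "\<lambda>s. s / ?e w" push_profile]) auto
    moreover have "?g (- ?e w) \<le> w m" "w m \<le> ?g 0"
      using wb e[OF w] push_profile_props(1)[of "- 1"] push_profile_props(3) by (auto simp: less_imp_le)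
    ultimately obtain s where s: "- ?e w \<le> s" "s \<le> 0" "?g s = w m"
      using IVT[of ?g "- ?e w" "w m" 0] e[OF w] by auto
    have "?e w \<noteq> 0" using e[OF w] by linarith
    then have q: "- ?e w / ?e w = - 1" by (metis divide_self minus_divide_left)
    have "?g (- ?e w) = - ?e w" unfolding q using push_profile_props(1)[of "- 1"] by simp
    moreover have "?g 0 = 1" using push_profile_props(3) by simp
    ultimately have "s \<noteq> - ?e w" "s \<noteq> 0" using s(3) wb by auto
    then have "w(m := s) \<in> ?D" using s slab_fun_upd[OF w] by auto
    moreover have "push m c (w(m := s)) = w" using s(3) by (simp add: push_def)
    ultimately show "w \<in> push m c ` ?D" by (metis imageI)
  qed
  have im: "push m c ` ?D = slab m c 1" using into surj by auto
  note op = openin_slab[of m c 0]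
  have sm: "smooth_map_on (Suc m) (Suc m) ?D (push m c)"
    unfolding smooth_map_on_def
  proof (intro allI impI)
    fix i k
    show "Ck_on (Suc m) k ?D (\<lambda>x. push m c x i)"
    proof (cases "i = m")
      case True
      have "Ck_on (Suc m) k ?D (\<lambda>z. z m + exp 2 * flat 1 (z m / ?e z + 1/2))"
        using e by (intro Ck_on_intros op Ck_on_flat Ck_on_bary_prod) (metis less_irrefl)
      then show ?thesis by (simp add: push_def push_profile_def True)
    qed (simp add: push_def Ck_on_coord[OF op])
  qed
  have jac: "\<forall>j<Suc m. v j = 0"
    if x: "x \<in> ?D" and v: "\<And>i. i < Suc m \<Longrightarrow> (\<Sum>j<Suc m. partial_deriv j (\<lambda>y. push m c y i) x * v j) = 0" for x v
  proof -
    have p: "partial_deriv j (\<lambda>y. push m c y i) x = (if i = j then 1 else 0)" if "i \<noteq> m" for i j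
      by (rule partial_deriv_eqI)
         (use that in \<open>auto simp: push_def intro!: derivative_eq_intros\<close>)
    have vj: "v i = 0" if "i < m" for i
    proof -
      have "(\<Sum>j<Suc m. partial_deriv j (\<lambda>y. push m c y i) x * v j) = (\<Sum>j<Suc m. if j = i then v j else 0)"
        using that p[of i] by (intro sum.cong) auto
      then show ?thesis using v[of i] that by simp
    qed
    obtain D where D: "D \<ge> 0" "(push_profile has_real_derivative D) (at (x m / ?e x))"
      using push_profile_DERIV by blast
    have "partial_deriv m (\<lambda>y. push m c y m) x = 1 + D * (1 / ?e x)"
    proof (rule partial_deriv_eqI)
      have "((\<lambda>t. push_profile (t / ?e x)) has_real_derivative D * (1 / ?e x)) (at (x m))"
        by (rule DERIV_chain2[where f = push_profile and g = "\<lambda>t. t / ?e x", OF D(2)]) (rule DERIV_cdivide[OF DERIV_ident])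
      then have "((\<lambda>t. t + push_profile (t / ?e x)) has_real_derivative 1 + D * (1 / ?e x)) (at (x m))"
        by (intro DERIV_add DERIV_ident)
      then show "((\<lambda>t. push m c (x(m := t)) m) has_real_derivative 1 + D * (1 / ?e x)) (at (x m))"
        by (simp add: push_def)
    qed
    moreover have "1 + D * (1 / ?e x) > 0" using D(1) e[OF x] by (intro add_pos_nonneg mult_nonneg_nonneg) auto
    moreover have "partial_deriv m (\<lambda>y. push m c y m) x * v m = 0" using v[of m] vj by simp
    ultimately have "v m = 0" by simp
    then show ?thesis using vj less_Suc_eq by blast
  qed
  have ES: "push m c ` ?D \<subseteq> ES (Suc m)" using into openin_ES_subset[OF openin_slab] by blast
  have "smooth_map_on (Suc m) (Suc m) (push m c ` ?D) (inv_into ?D (push m c))"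
    by (rule inverse_map_smooth(2)[OF op sm ES inj]) (use jac in blast)
  then show "diffeo (Suc m) (slab m c 0) (slab m c 1) (push m c) (inv_into (slab m c 0) (push m c))"
    unfolding diffeo_def using op openin_slab sm im inj by (auto simp: f_inv_into_f inv_into_into)
  show "push m c z = z" if "z \<in> ?D" "z m \<le> - (c / 2 * bary_prod m z)"
  proof -
    have "z m / ?e z \<le> - 1 / 2" using that(2) e[OF that(1)] by (simp add: field_simps)
    then show ?thesis using push_profile_props(1) by (simp add: push_def)
  qed
qed

context triangulated_manifold
begin

text \<open>
  Let \<open>e\<close> be the parametrisation by the coordinates of \<open>cone_pt\<close>, \<open>D\<close> the collar and \<open>D'\<close> the collar
  with the open facet and the open simplex.  The map \<open>\<rho>\<close> from the enlarged cell to \<open>C\<close> undoes the push on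
  \<open>e ` D'\<close> and is the identity elsewhere; the new chart is \<open>h \<circ> \<rho>\<close>.  It is a chart on \<open>e ` D'\<close>, being
  composed of charts and diffeomorphisms.  It agrees with \<open>h\<close> outside the image of the compact set \<open>Z\<close>,
  the closure of the inner half of \<open>D'\<close>.  Points of this image that are not in \<open>e ` D'\<close> lie on the
  boundary of \<open>\<tau>\<close>, outside \<open>C\<close>; so both regions together cover the enlarged cell.
\<close>

lemma grow_cell:
  assumes n: "n = Suc m" and i: "i \<le> n" "i0 \<le> n" and \<tau>: "\<tau>0 \<in> \<Phi> n" "\<tau> \<in> \<Phi> n" "\<tau>0 \<noteq> \<tau>"
    and facet: "restrict (\<tau>0 \<circ> face_map m i0) (std_simplex m) = restrict (\<tau> \<circ> face_map m i) (std_simplex m)"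
    and C: "(C, h) \<in> \<A>" "\<tau>0 ` osimplex n \<subseteq> C" "C \<inter> \<tau> ` std_simplex n = {}"
  shows "\<exists>h'. (C \<union> \<tau> ` osimplex n \<union> \<tau> ` face_map m i ` osimplex m, h') \<in> \<A> \<and>
     h' ` (C \<union> \<tau> ` osimplex n \<union> \<tau> ` face_map m i ` osimplex m) = h ` C"
proof -
  have im: "i \<le> Suc m" using i n by auto
  obtain U f where U: "openin (Euclidean_space n) U" "std_simplex n \<subseteq> U" "smooth_embedding n n M \<A> U f"
    "\<And>x. x \<in> std_simplex n \<Longrightarrow> \<tau> x = f x" "inj_on f U" "continuous_map (subtopology (Euclidean_space n) U) M f"
    using simplex_extension[OF \<tau>(2) order_refl] by metis
  obtain c where c: "c > 0" "c \<le> 1"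
    and cU: "\<And>z. z \<in> ES n \<Longrightarrow> \<forall>j\<le>m. 0 \<le> bary m j z \<Longrightarrow> \<bar>z m\<bar> \<le> c * bary_prod m z \<Longrightarrow> cone_pt m i z \<in> U"
    and c\<tau>: "\<And>z. z \<in> slab m c 0 \<Longrightarrow> f (cone_pt m i z) \<in> \<tau>0 ` osimplex n"
    using facet_collar[OF n i \<tau> facet U(1-5)] by blast
  define e where "e z = f (cone_pt m i z)" for z
  define D where "D = slab m c 0"
  define D' where "D' = slab m c 1"
  define X1 where "X1 = {x \<in> ES n. bary n i x < 1}"
  define W where "W = f ` (U \<inter> X1)"
  define k where "k = cone_coord m i \<circ> inv_into U f"
  have gf: "inv_into U f (f x) = x" if "x \<in> U" for x using U(5) that by simp
  have dc: "diffeo n X1 {z \<in> ES n. z m < 1} (cone_coord m i) (cone_pt m i)"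
    using diffeo_cone[OF im] unfolding X1_def n .
  have UX: "openin (Euclidean_space n) (U \<inter> X1)" using U(1) dc by (auto simp: diffeo_def)
  note top = top_simplex_chart[OF U(1,3)]
  have W: "openin M W" unfolding W_def by (rule top(2)[OF UX]) auto
  have kW: "(W, k) \<in> \<A>"
    unfolding k_def
  proof (rule chart_compose_diffeo[OF S top(1) W])
    have "inv_into U f ` W = U \<inter> X1" unfolding W_def using gf by (force simp: image_iff)
    then show "diffeo n (inv_into U f ` W) (cone_coord m i ` (U \<inter> X1)) (cone_coord m i) (cone_pt m i)"
      using diffeo_restrict[OF dc UX] by simp
  qed (auto simp: W_def)
  have ke: "e z \<in> W" "k (e z) = z" if "z \<in> ES n" "z m < 1" "cone_pt m i z \<in> U" for z
  proof -
    have "cone_pt m i z \<in> X1"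
      using cone_pt_ES[OF im] bary_cone_self[OF im] that n by (simp add: X1_def del: bary_simps)
    then show "e z \<in> W" using that by (auto simp: e_def W_def)
    show "k (e z) = z" unfolding k_def e_def o_def gf[OF that(3)]
      by (rule cone_coord_pt[OF im]) (use that n in auto)
  qed
  have cone_std: "cone_pt m i z \<in> std_simplex n" if "\<forall>j\<le>m. 0 \<le> bary m j z" "0 \<le> z m" "z m \<le> 1" for z
  proof -
    have "0 \<le> bary (Suc m) j (cone_pt m i z)" if j: "j \<le> Suc m" for j
    proof (cases "j = i")
      case False
      then obtain a where "a \<le> m" "j = skip i a" using obtain_skip[OF j False] im by (metis not_le)
      then show ?thesis using bary_cone_skip[OF im] that by (simp del: bary_simps add: \<open>\<forall>j\<le>m. _\<close> \<open>z m \<le> 1\<close>)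
    qed (use bary_cone_self[OF im] \<open>0 \<le> z m\<close> in \<open>simp del: bary_simps\<close>)
    then show ?thesis using cone_pt_ES[OF im] n by (simp add: std_simplex_iff del: bary_simps)
  qed
  have D'E: "z \<in> ES n" "z m < 1" "cone_pt m i z \<in> U" if z: "z \<in> D'" for z
  proof -
    show zE: "z \<in> ES n" "z m < 1" using z n by (auto simp: D'_def slab_def)
    have b: "\<forall>j\<le>m. 0 \<le> bary m j z" using z by (auto simp: D'_def slab_def less_imp_le simp del: bary_simps)
    show "cone_pt m i z \<in> U"
    proof (cases "z m \<ge> 0")
      case True
      then show ?thesis using cone_std[OF b] zE U(2) by auto
    next
      case False
      then have "\<bar>z m\<bar> \<le> c * bary_prod m z" using z by (auto simp: D'_def slab_def)
      then show ?thesis by (rule cU[OF zE(1) b])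
    qed
  qed
  have DD': "D \<subseteq> D'" by (auto simp: D_def D'_def slab_def)
  have keD: "k (e z) = z" "e z \<in> W" if "z \<in> D'" for z using ke D'E[OF that] by auto
  have kD': "k ` e ` D' = D'" "k ` e ` D = D" using keD DD' by (force simp: image_iff)+
  have eopen: "openin M (e ` Z)" if Z: "openin (Euclidean_space n) Z" "Z \<subseteq> D'" for Z
  proof -
    note ch = is_chartD[OF smooth_structureD(1)[OF S kW]]
    have "e ` Z = {p \<in> W. k p \<in> Z}"
    proof safe
      fix p assume p: "p \<in> W" "k p \<in> Z"
      have "k (e (k p)) = k p" "e (k p) \<in> W" using keD p(2) Z(2) by auto
      then have "e (k p) = p" using ch(3) p(1) by (meson inj_onD)
      then show "p \<in> e ` Z" using p(2) by (metis imageI)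
    qed (use keD Z(2) in auto)
    then show ?thesis using ch(7)[OF Z(1)] by simp
  qed
  have Dop: "openin (Euclidean_space n) D" "openin (Euclidean_space n) D'"
    using openin_slab n by (auto simp: D_def D'_def)
  have eD: "openin M (e ` D)" "openin M (e ` D')" using eopen Dop DD' by auto
  have eDC: "e ` D \<subseteq> C" using c\<tau> C(2) by (auto simp: e_def D_def)
  define F where "F = \<tau> ` face_map m i ` osimplex m"
  have eD': "e ` D' = e ` D \<union> \<tau> ` osimplex n \<union> F"
  proof (intro equalityI subsetI)
    fix p assume "p \<in> e ` D'"
    then obtain z where z: "z \<in> D'" "p = e z" by blast
    have b: "\<forall>j\<le>m. 0 < bary m j z" using z(1) by (auto simp: D'_def slab_def simp del: bary_simps)
    then have b': "\<forall>j\<le>m. 0 \<le> bary m j z" using less_imp_le by blast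
    consider "z m < 0" | "z m = 0" | "z m > 0" by linarith
    then show "p \<in> e ` D \<union> \<tau> ` osimplex n \<union> F"
    proof cases
      case 1
      then have "z \<in> D" using z(1) by (auto simp: D_def D'_def slab_def)
      then show ?thesis using z(2) by blast
    next
      case 2
      have "cone_pt m i z = face_map m i z" by (simp add: cone_pt_def 2)
      moreover have "z \<in> osimplex m" using b D'E(1)[OF z(1)] 2 n
        by (auto simp: osimplex_def ES_iff le_Suc_eq simp del: bary_simps) (metis le_neq_implies_less Suc_leI)
      ultimately have "p = \<tau> (face_map m i z)"
        using U(4)[OF cone_std[OF b']] z 2 by (simp add: e_def)
      then show ?thesis using \<open>z \<in> osimplex m\<close> by (auto simp: F_def)
    next
      case 3
      have "0 < bary (Suc m) j (cone_pt m i z)" if j: "j \<le> Suc m" for j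
      proof (cases "j = i")
        case False
        then obtain a where "a \<le> m" "j = skip i a" using obtain_skip[OF j False] im by (metis not_le)
        then show ?thesis using bary_cone_skip[OF im] b D'E(2)[OF z(1)] by (simp del: bary_simps)
      qed (use bary_cone_self[OF im] 3 in \<open>simp del: bary_simps\<close>)
      then have o: "cone_pt m i z \<in> osimplex n" using cone_pt_ES[OF im] n by (auto simp: osimplex_def simp del: bary_simps)
      then have "p = \<tau> (cone_pt m i z)" using U(4)[OF subsetD[OF osimplex_subset o]] z by (simp add: e_def)
      then show ?thesis using o by blast
    qed
  next
    fix p assume "p \<in> e ` D \<union> \<tau> ` osimplex n \<union> F"
    then consider "p \<in> e ` D" | x where "x \<in> osimplex n" "p = \<tau> x" | y where "y \<in> osimplex m" "p = \<tau> (face_map m i y)"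
      by (auto simp: F_def)
    then show "p \<in> e ` D'"
    proof cases
      case 1
      then show ?thesis using DD' by blast
    next
      case 2
      have xE: "x \<in> ES (Suc m)" and xb: "\<And>j. j \<le> Suc m \<Longrightarrow> 0 < bary (Suc m) j x"
        using 2(1) n by (auto simp: osimplex_def simp del: bary_simps)
      have "(\<Sum>j\<le>m. bary (Suc m) (skip i j) x) > 0"
        by (intro sum_pos xb skip_le) auto
      then have lt: "bary (Suc m) i x < 1"
        using sum_skip[OF im, of "\<lambda>j. bary (Suc m) j x"] sum_bary[of "Suc m" x] by linarith
      let ?z = "cone_coord m i x"
      have zm: "?z m = bary (Suc m) i x" by (simp add: cone_coord_def)
      have b: "0 < bary m j ?z" if "j \<le> m" for j
        using bary_cone_coord[OF im _ that] xb[OF skip_le[OF that]] lt by simp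
      then have "c * bary_prod m ?z > 0" using bary_prod_pos c(1) by simp
      then have "?z \<in> D'"
        using b zm lt xb[OF im] cone_coord_ES[of m i x] by (simp add: D'_def slab_def del: bary_simps)
      moreover have "e ?z = p"
        using cone_pt_coord[OF im xE] lt U(4)[OF subsetD[OF osimplex_subset 2(1)]] 2(2) by (simp add: e_def del: bary_simps)
      ultimately show ?thesis by (metis imageI)
    next
      case 3
      then have y: "y m = 0" "y \<in> ES (Suc m)" "\<forall>j\<le>m. 0 < bary m j y"
        by (auto simp: osimplex_def ES_iff simp del: bary_simps)
      then have "y \<in> D'" using c(1) bary_prod_pos[of m y] by (simp add: D'_def slab_def del: bary_simps)
      moreover have "e y = p"
        using 3 U(4)[of "face_map m i y"] face_map_simplex[OF im subsetD[OF osimplex_subset 3(1)]] n y(1)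
        by (simp add: e_def cone_pt_def)
      ultimately show ?thesis by (metis imageI)
    qed
  qed
  have F_std: "F \<subseteq> \<tau> ` std_simplex n"
    using face_map_simplex[OF im] osimplex_subset n by (fastforce simp: F_def)
  have CeD': "C \<inter> e ` D' = e ` D"
    using C(3) F_std eDC osimplex_subset[of n] unfolding eD' by blast
  define C' where "C' = C \<union> e ` D'"
  have C'_eq: "C \<union> \<tau> ` osimplex n \<union> \<tau> ` face_map m i ` osimplex m = C'"
    unfolding C'_def eD' F_def using eDC by blast
  define G where "G = inv_into D (push m c)"
  have dp: "diffeo n D D' (push m c) G" and push_id: "\<And>z. z \<in> D \<Longrightarrow> z m \<le> - (c / 2 * bary_prod m z) \<Longrightarrow> push m c z = z"
    using push_diffeo[OF c(1), where m = m] n by (auto simp: D_def D'_def G_def)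
  then have GD: "G z \<in> D" "push m c (G z) = z" if "z \<in> D'" for z using that by (auto simp: diffeo_def)
  have Gp: "push m c z \<in> D'" "G (push m c z) = z" if "z \<in> D" for z using that dp by (auto simp: diffeo_def)
  \<comment> \<open>the inverse of the push, extended by the identity\<close>
  define \<rho> where "\<rho> p = (if p \<in> e ` D' then e (G (k p)) else p)" for p
  have \<rho>e: "\<rho> (e z) = e (G z)" if "z \<in> D'" for z using that keD by (simp add: \<rho>_def)
  have ch_h: "inj_on h C" using is_chartD(3)[OF smooth_structureD(1)[OF S C(1)]] .
  have \<rho>C: "\<rho> ` C' = C"
  proof (intro equalityI subsetI)
    fix q assume "q \<in> \<rho> ` C'"
    then obtain p where p: "p \<in> C'" "q = \<rho> p" by blast
    show "q \<in> C"
    proof (cases "p \<in> e ` D'")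
      case True
      then show ?thesis using p \<rho>e GD eDC by auto
    next
      case False
      then show ?thesis using p by (simp add: \<rho>_def C'_def)
    qed
  next
    fix q assume q: "q \<in> C"
    show "q \<in> \<rho> ` C'"
    proof (cases "q \<in> e ` D'")
      case True
      then obtain z where z: "z \<in> D" "q = e z" using CeD' q by blast
      then have "\<rho> (e (push m c z)) = q" using \<rho>e Gp by simp
      then show ?thesis using Gp(1)[OF z(1)] by (force simp: C'_def)
    next
      case False
      then show ?thesis using q by (intro image_eqI[of _ _ q]) (auto simp: \<rho>_def C'_def)
    qed
  qed
  have \<rho>inj: "inj_on \<rho> C'"
  proof (rule inj_onI)
    fix p q assume pq: "p \<in> C'" "q \<in> C'" "\<rho> p = \<rho> q"
    have inD: "\<rho> a \<in> e ` D \<longleftrightarrow> a \<in> e ` D'" if "a \<in> C'" for a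
    proof (cases "a \<in> e ` D'")
      case True
      then show ?thesis using \<rho>e GD by auto
    next
      case False
      then show ?thesis using DD' by (auto simp: \<rho>_def)
    qed
    show "p = q"
    proof (cases "p \<in> e ` D'")
      case True
      then have "q \<in> e ` D'" using inD[OF pq(1)] inD[OF pq(2)] pq(3) by simp
      then obtain z w where zw: "z \<in> D'" "p = e z" "w \<in> D'" "q = e w" using True by blast
      then have "e (G z) = e (G w)" using \<rho>e pq(3) by simp
      then have "G z = G w" using keD(1) GD(1) zw DD' by (metis subsetD)
      then show ?thesis using GD(2) zw by metis
    next
      case False
      then have "q \<notin> e ` D'" using inD pq by metis
      then show ?thesis using False pq(3) by (simp add: \<rho>_def)
    qed
  qed
  define h' where "h' = h \<circ> \<rho>"
  have h'inj: "inj_on h' C'" unfolding h'_def by (rule comp_inj_on[OF \<rho>inj]) (simp add: \<rho>C ch_h)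
  have h'C: "h' ` C' = h ` C" unfolding h'_def image_comp[symmetric] \<rho>C ..
  have N1: "(e ` D', h') \<in> \<A>"
  proof -
    have "(e ` D', G \<circ> k) \<in> \<A>"
    proof (rule chart_compose_diffeo[OF S kW eD(2)])
      show "diffeo n (k ` e ` D') D G (push m c)" unfolding kD' by (rule diffeo_sym[OF dp])
    qed (use keD in auto)
    moreover have "diffeo n D (h ` e ` D) (h \<circ> inv_into W k) (k \<circ> inv_into C h)"
      using transition_diffeo[OF S kW C(1) eD(1)] keD DD' eDC kD'(2) by auto
    moreover have "(G \<circ> k) ` e ` D' = D"
      unfolding image_comp[symmetric] kD' using GD(1) Gp by (force simp: image_iff)
    ultimately have "(e ` D', (h \<circ> inv_into W k) \<circ> (G \<circ> k)) \<in> \<A>"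
      using chart_compose_diffeo[OF S _ eD(2) order_refl] by metis
    then show ?thesis
    proof (rule chart_cong[OF S])
      fix p assume "p \<in> e ` D'"
      then obtain z where z: "z \<in> D'" "p = e z" by blast
      have "e (G z) \<in> W" "k (e (G z)) = G z" using keD GD(1)[OF z(1)] DD' by auto
      then have "inv_into W k (G z) = e (G z)"
        using inv_into_f_f[OF is_chartD(3)[OF smooth_structureD(1)[OF S kW]]] by metis
      then show "((h \<circ> inv_into W k) \<circ> (G \<circ> k)) p = h' p" using z \<rho>e keD by (simp add: h'_def)
    qed
  qed
  \<comment> \<open>outside \<open>e ` Z\<close> the push is the identity\<close>
  define Z where "Z = {z \<in> ES n. (\<forall>j\<le>m. 0 \<le> bary m j z) \<and> - (c / 2 * bary_prod m z) \<le> z m \<and> z m \<le> 1}"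
  have ZU: "cone_pt m i z \<in> U" if "z \<in> Z" for z
  proof (cases "z m \<ge> 0")
    case True
    then show ?thesis using cone_std that U(2) by (auto simp: Z_def)
  next
    case False
    have b: "\<forall>j\<le>m. 0 \<le> bary m j z" "z \<in> ES n" using that by (auto simp: Z_def simp del: bary_simps)
    have "c / 2 * bary_prod m z \<le> c * bary_prod m z"
      using bary_prod_nonneg[of m z] b c(1) by (intro mult_right_mono) auto
    then have "\<bar>z m\<bar> \<le> c * bary_prod m z" using that False by (auto simp: Z_def)
    then show ?thesis by (rule cU[OF b(2,1)])
  qed
  have compactZ: "compact Z"
  proof -
    let ?Bx = "{x::nat \<Rightarrow> real. \<forall>j. x j \<in> {(if j = m then -1 else 0)..(if j < n then 1 else 0)}}"
    let ?C1 = "\<Inter>j\<in>{..m}. {z. 0 \<le> bary m j z}" and ?C2 = "{z. - (c / 2 * bary_prod m z) \<le> z m}"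
      and ?C3 = "{z::nat\<Rightarrow>real. z m \<le> 1}"
    have "closed ?C1" "closed ?C2" "closed ?C3" unfolding bary_prod_def
      by (intro closed_INT ballI closed_Collect_le continuous_intros)+
    then have cl: "closed (ES n \<inter> ?C1 \<inter> ?C2 \<inter> ?C3)" using closed_ES by blast
    have Zeq: "Z = ES n \<inter> ?C1 \<inter> ?C2 \<inter> ?C3" by (auto simp: Z_def simp del: bary_simps)
    have "Z \<subseteq> ?Bx"
    proof (intro subsetI CollectI allI)
      fix z j assume z: "z \<in> Z"
      have b: "\<And>a. a \<le> m \<Longrightarrow> 0 \<le> bary m a z" using z by (auto simp: Z_def simp del: bary_simps)
      consider "j < m" | "j = m" | "j \<ge> n" using n by linarith
      then show "z j \<in> {(if j = m then -1 else 0)..(if j < n then 1 else 0)}"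
      proof cases
        case 1
        then show ?thesis using b[of "Suc j"] bary_le_1[OF b, of "Suc j"] n by simp
      next
        case 2
        have "bary_prod m z \<le> 1" using bary_prod_le[OF b, of 0] bary_le_1[OF b, of 0] by linarith
        then have "c / 2 * bary_prod m z \<le> 1 * 1" using c bary_prod_nonneg[OF b] by (intro mult_mono) auto
        then show ?thesis using z 2 n by (auto simp: Z_def)
      next
        case 3
        then show ?thesis using z n by (auto simp: Z_def ES_iff)
      qed
    qed
    then have "Z = ?Bx \<inter> (ES n \<inter> ?C1 \<inter> ?C2 \<inter> ?C3)" using Zeq by blast
    then show ?thesis by (rule ssubst) (rule compact_Int_closed[OF compact_coord_box cl])
  qed
  have clZ: "closedin M (e ` Z)"
  proof (rule compactin_imp_closedin[OF hausdorff])
    have cc: "continuous_on Z (cone_pt m i)"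
    proof (rule continuous_on_coordinatewise_then_product)
      fix j show "continuous_on Z (\<lambda>z. cone_pt m i z j)"
        unfolding cone_pt_def face_map_def by (intro continuous_intros)
    qed
    have "continuous_map (top_of_set Z) (subtopology (Euclidean_space n) U) (cone_pt m i)"
      unfolding subtopology_ES[OF openin_ES_subset[OF U(1)]] using cc ZU by auto
    from continuous_map_compose[OF this U(6)] have "continuous_map (top_of_set Z) M e"
      by (simp add: e_def[abs_def] o_def)
    moreover have "compactin (top_of_set Z) Z" using compactZ by (simp add: compactin_subtopology)
    ultimately show "compactin M (e ` Z)" by (rule image_compactin[rotated])
  qed
  have C'op: "openin M C'" using is_chartD(1)[OF smooth_structureD(1)[OF S C(1)]] eD(2) by (auto simp: C'_def)
  have N2op: "openin M (C' - e ` Z)" using C'op clZ by (rule openin_diff)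
  have N2: "p \<in> C \<and> \<rho> p = p" if p: "p \<in> C' - e ` Z" for p
  proof (cases "p \<in> e ` D'")
    case True
    then obtain z where z: "z \<in> D'" "p = e z" by blast
    have "z \<notin> Z" using p z by blast
    then have zl: "z m < - (c / 2 * bary_prod m z)"
      using z(1) n by (auto simp: Z_def D'_def slab_def less_imp_le simp del: bary_simps)
    moreover have "0 < bary_prod m z" using z(1) slab_bary_prod_pos by (simp add: D'_def)
    then have "0 < c / 2 * bary_prod m z" using c(1) by simp
    ultimately have zD: "z \<in> D" using z(1) by (auto simp: D_def D'_def slab_def)
    then have "push m c z = z" using push_id zl by simp
    then have "G z = z" using Gp(2)[OF zD] by simp
    then show ?thesis using \<rho>e z zD eDC by auto
  next
    case False
    then show ?thesis using p by (auto simp: C'_def \<rho>_def)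
  qed
  have N2A: "(C' - e ` Z, h') \<in> \<A>"
  proof (rule chart_cong[OF S])
    show "(C' - e ` Z, h) \<in> \<A>" by (rule chart_restrict[OF S C(1) N2op]) (use N2 in blast)
  qed (use N2 in \<open>simp add: h'_def\<close>)
  have "(C', h') \<in> \<A>"
  proof (rule chart_glue[OF S h'inj])
    fix p assume p: "p \<in> C'"
    show "\<exists>N. p \<in> N \<and> N \<subseteq> C' \<and> (N, h') \<in> \<A>"
    proof (cases "p \<in> e ` D'")
      case True
      then show ?thesis using N1 by (intro exI[of _ "e ` D'"]) (simp add: C'_def)
    next
      case False
      then have pC: "p \<in> C" using p by (simp add: C'_def)
      have "p \<notin> e ` Z"
      proof
        assume "p \<in> e ` Z"
        then obtain z where z: "z \<in> Z" "p = e z" by blast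
        have b: "\<forall>j\<le>m. 0 \<le> bary m j z" using z(1) by (auto simp: Z_def simp del: bary_simps)
        have "z m \<ge> 0"
        proof (cases "\<exists>j\<le>m. bary m j z = 0")
          case True
          then have "bary_prod m z = 0" unfolding bary_prod_def by (auto simp del: bary_simps)
          then show ?thesis using z(1) by (simp add: Z_def)
        next
          case all: False
          have "z m = 1"
          proof (rule ccontr)
            assume "z m \<noteq> 1"
            have "\<forall>j\<le>m. 0 < bary m j z" using b all by (metis less_le)
            then have "0 < c * bary_prod m z" using bary_prod_pos c(1) by simp
            then have "z \<in> D'" using z(1) \<open>z m \<noteq> 1\<close> \<open>\<forall>j\<le>m. 0 < bary m j z\<close> n
              by (auto simp: Z_def D'_def slab_def simp del: bary_simps)
            then show False using False z(2) by blast
          qed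
          then show ?thesis by simp
        qed
        moreover have "z m \<le> 1" using z(1) by (simp add: Z_def)
        ultimately have "cone_pt m i z \<in> std_simplex n" using cone_std b by blast
        then have "p \<in> \<tau> ` std_simplex n" using U(4) z(2) by (metis e_def imageI)
        then show False using pC C(3) by blast
      qed
      then show ?thesis using N2A p by (intro exI[of _ "C' - e ` Z"]) auto
    qed
  qed
  then show ?thesis unfolding C'_eq using h'C by blast
qed

end

section \<open>Sets of small dimension\<close>

text \<open>
  The upper Minkowski content of dimension \<open>m\<close> of \<open>A\<close> is finite.  Only the coordinates below \<open>n\<close> are
  looked at, and the centres \<open>P\<close> need not belong to \<open>A\<close>.
\<close>

definition thin :: "nat \<Rightarrow> nat \<Rightarrow> (nat \<Rightarrow> real) set \<Rightarrow> bool" where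
  "thin n m A \<longleftrightarrow> (\<exists>K. \<forall>N\<ge>1. \<exists>P. finite P \<and> card P \<le> K * N ^ m \<and>
     (\<forall>a\<in>A. \<exists>p\<in>P. \<forall>i<n. \<bar>a i - p i\<bar> \<le> 1 / real N))"

lemma thin_subset: "thin n m A \<Longrightarrow> B \<subseteq> A \<Longrightarrow> thin n m B"
  unfolding thin_def by (meson subsetD)

text \<open>
  A cover by cubes of size \<open>L/N\<close> is as good as one of size \<open>1/N\<close>, at the price of a larger constant
  \<open>K\<close>.
\<close>

lemma thin_rescale:
  assumes "\<And>N. N \<ge> 1 \<Longrightarrow> \<exists>P. finite P \<and> card P \<le> K * N ^ m \<and>
     (\<forall>a\<in>A. \<exists>p\<in>P. \<forall>i<n. \<bar>a i - p i\<bar> \<le> L / real N)"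
  shows "thin n m A"
proof -
  define L' where "L' = nat \<lceil>L\<rceil> + 1"
  have L': "L \<le> real L'" "L' \<ge> 1" unfolding L'_def by linarith+
  show ?thesis unfolding thin_def
  proof (intro exI[of _ "K * L' ^ m"] allI impI)
    fix N :: nat assume N: "1 \<le> N"
    have "L' * N \<ge> 1" using N L' by simp
    from assms[OF this] obtain P where P: "finite P" "card P \<le> K * (L' * N) ^ m"
      "\<And>a. a \<in> A \<Longrightarrow> \<exists>p\<in>P. \<forall>i<n. \<bar>a i - p i\<bar> \<le> L / real (L' * N)"
      by blast
    have le: "L / real (L' * N) \<le> 1 / real N"
      using L' N by (simp add: field_simps)
    have "\<exists>p\<in>P. \<forall>i<n. \<bar>a i - p i\<bar> \<le> 1 / real N" if "a \<in> A" for a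
      using P(3)[OF that] le order_trans by blast
    then show "\<exists>P. finite P \<and> card P \<le> K * L' ^ m * N ^ m \<and>
        (\<forall>a\<in>A. \<exists>p\<in>P. \<forall>i<n. \<bar>a i - p i\<bar> \<le> 1 / real N)"
      using P(1,2) by (intro exI[of _ P]) (auto simp: power_mult_distrib mult.assoc)
  qed
qed

lemma thin_mono: "thin n m A \<Longrightarrow> m \<le> m' \<Longrightarrow> thin n m' A"
proof -
  assume A: "thin n m A" and m: "m \<le> m'"
  obtain K where K: "\<And>N. N \<ge> 1 \<Longrightarrow> \<exists>P. finite P \<and> card P \<le> K * N ^ m \<and>
     (\<forall>a\<in>A. \<exists>p\<in>P. \<forall>i<n. \<bar>a i - p i\<bar> \<le> 1 / real N)"
    using A unfolding thin_def by blast
  show ?thesis unfolding thin_def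
  proof (intro exI[of _ K] allI impI)
    fix N :: nat assume N: "1 \<le> N"
    have "K * N ^ m \<le> K * N ^ m'" using N m by (intro mult_left_mono power_increasing) auto
    then show "\<exists>P. finite P \<and> card P \<le> K * N ^ m' \<and> (\<forall>a\<in>A. \<exists>p\<in>P. \<forall>i<n. \<bar>a i - p i\<bar> \<le> 1 / real N)"
      using K[OF N] order_trans by blast
  qed
qed

lemma thin_Un: "thin n m A \<Longrightarrow> thin n m B \<Longrightarrow> thin n m (A \<union> B)"
proof -
  assume "thin n m A" "thin n m B"
  then obtain K K' where K: "\<And>N. N \<ge> 1 \<Longrightarrow> \<exists>P. finite P \<and> card P \<le> K * N ^ m \<and>
     (\<forall>a\<in>A. \<exists>p\<in>P. \<forall>i<n. \<bar>a i - p i\<bar> \<le> 1 / real N)"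
    and K': "\<And>N. N \<ge> 1 \<Longrightarrow> \<exists>P. finite P \<and> card P \<le> K' * N ^ m \<and>
     (\<forall>a\<in>B. \<exists>p\<in>P. \<forall>i<n. \<bar>a i - p i\<bar> \<le> 1 / real N)"
    unfolding thin_def by blast
  show ?thesis unfolding thin_def
  proof (intro exI[of _ "K + K'"] allI impI)
    fix N :: nat assume N: "1 \<le> N"
    obtain P P' where P: "finite P" "card P \<le> K * N ^ m" "\<forall>a\<in>A. \<exists>p\<in>P. \<forall>i<n. \<bar>a i - p i\<bar> \<le> 1 / real N"
      "finite P'" "card P' \<le> K' * N ^ m" "\<forall>a\<in>B. \<exists>p\<in>P'. \<forall>i<n. \<bar>a i - p i\<bar> \<le> 1 / real N"
      using K[OF N] K'[OF N] by blast
    have "card (P \<union> P') \<le> (K + K') * N ^ m"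
      using card_Un_le[of P P'] P(2,5) by (simp add: add_mult_distrib)
    then show "\<exists>P. finite P \<and> card P \<le> (K + K') * N ^ m \<and>
        (\<forall>a\<in>A \<union> B. \<exists>p\<in>P. \<forall>i<n. \<bar>a i - p i\<bar> \<le> 1 / real N)"
      using P by (intro exI[of _ "P \<union> P'"]) blast
  qed
qed

lemma thin_empty: "thin n m {}"
  unfolding thin_def by (intro exI[of _ 0] allI impI exI[of _ "{}"]) auto

lemma thin_UN: "finite I \<Longrightarrow> (\<And>i. i \<in> I \<Longrightarrow> thin n m (A i)) \<Longrightarrow> thin n m (\<Union>i\<in>I. A i)"
  by (induction I rule: finite_induct) (auto intro: thin_empty thin_Un)

text \<open>
  The images of the points of a grid of width \<open>1/N\<close> serve as centres.
\<close>

lemma thin_Lipschitz_cube: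
  fixes g :: "(nat \<Rightarrow> real) \<Rightarrow> nat \<Rightarrow> real"
  assumes Q: "Q = {x \<in> ES d. \<forall>j<d. \<bar>x j - a j\<bar> \<le> r}"
    and L: "L \<ge> 0" "\<And>x y i. x \<in> Q \<Longrightarrow> y \<in> Q \<Longrightarrow> i < n \<Longrightarrow> \<bar>g x i - g y i\<bar> \<le> L * (\<Sum>j<d. \<bar>x j - y j\<bar>)"
  shows "thin n d (g ` Q)"
proof (rule thin_rescale)
  fix N :: nat assume N: "N \<ge> 1"
  define R where "R = nat \<lceil>2 * r\<rceil>"
  have R: "2 * r \<le> real R" unfolding R_def by linarith
  define I where "I = Pi\<^sub>E {..<d} (\<lambda>_. {..R * N})"
  define y where "y k = (\<lambda>j. if j < d then a j - r + real (k j) / real N else 0)" for k :: "nat \<Rightarrow> nat"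
  have fin: "finite I" unfolding I_def by (intro finite_PiE) auto
  have "card I = (R * N + 1) ^ d" unfolding I_def by (subst card_PiE) auto
  also have "\<dots> \<le> ((R + 1) * N) ^ d" using N by (intro power_mono) auto
  also have "\<dots> = (R + 1) ^ d * N ^ d" by (simp only: power_mult_distrib)
  finally have "card ((\<lambda>k. g (y k)) ` I) \<le> (R + 1) ^ d * N ^ d"
    using card_image_le[OF fin, of "\<lambda>k. g (y k)"] by linarith
  moreover have "\<exists>p\<in>(\<lambda>k. g (y k)) ` I. \<forall>i<n. \<bar>b i - p i\<bar> \<le> (L * d) / real N" if b: "b \<in> g ` Q" for b
  proof -
    obtain x where x: "x \<in> Q" "b = g x" using b by blast
    define k where "k = restrict (\<lambda>j. nat \<lfloor>(x j - a j + r) * real N\<rfloor>) {..<d}"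
    have kj: "0 \<le> x j - y k j" "x j - y k j \<le> 1 / real N" "k j \<le> R * N" if j: "j < d" for j
    proof -
      have xa: "0 \<le> x j - a j + r" "x j - a j + r \<le> 2 * r" using x(1) j Q by (auto simp: abs_le_iff dest!: spec)
      have kr: "real (k j) = of_int \<lfloor>(x j - a j + r) * real N\<rfloor>"
        using j xa(1) by (simp add: k_def)
      then have lo: "real (k j) \<le> (x j - a j + r) * real N" "(x j - a j + r) * real N \<le> real (k j) + 1"
        by linarith+
      have xy: "x j - y k j = ((x j - a j + r) * real N - real (k j)) / real N"
        using N j by (simp add: y_def diff_divide_distrib)
      show "0 \<le> x j - y k j" unfolding xy using lo by simp
      show "x j - y k j \<le> 1 / real N" unfolding xy using lo by (intro divide_right_mono) auto
      have "(x j - a j + r) * real N \<le> real R * real N" using xa R by (intro mult_right_mono) auto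
      then have "real (k j) \<le> real (R * N)" using lo by simp
      then show "k j \<le> R * N" by linarith
    qed
    have kI: "k \<in> I" using kj(3) by (auto simp: I_def k_def)
    \<comment> \<open>rounding down moves each coordinate towards the lower face of the cube, never out of it\<close>
    have yQ: "y k \<in> Q"
    proof -
      have "\<bar>y k j - a j\<bar> \<le> r" if j: "j < d" for j
      proof -
        have "y k j \<ge> a j - r" using j by (simp add: y_def)
        moreover have "\<bar>x j - a j\<bar> \<le> r" using x(1) Q j by auto
        ultimately show ?thesis using kj(1)[OF j] by linarith
      qed
      then show ?thesis unfolding Q by (auto simp: ES_iff y_def)
    qed
    have "\<bar>b i - g (y k) i\<bar> \<le> (L * d) / real N" if "i < n" for i
    proof -
      have "(\<Sum>j<d. \<bar>x j - y k j\<bar>) \<le> (\<Sum>j<d. 1 / real N)"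
        using kj by (intro sum_mono) auto
      then have "L * (\<Sum>j<d. \<bar>x j - y k j\<bar>) \<le> L * (d * (1 / real N))"
        using L(1) by (intro mult_left_mono) auto
      then show ?thesis using L(2)[OF x(1) yQ that] x(2) by simp
    qed
    then show ?thesis using kI by blast
  qed
  ultimately show "\<exists>P. finite P \<and> card P \<le> (R + 1) ^ d * N ^ d \<and>
      (\<forall>a\<in>g ` Q. \<exists>p\<in>P. \<forall>i<n. \<bar>a i - p i\<bar> \<le> (L * d) / real N)"
    using fin by (intro exI[of _ "(\<lambda>k. g (y k)) ` I"]) auto
qed

text \<open>
  A grid of \<open>t\<^sup>n\<close> points in the open set, so wide that a cube of the cover contains at most one of them,
  needs at least \<open>t\<^sup>n\<close> cubes, which exceeds \<open>O(t\<^sup>m)\<close> for large \<open>t\<close>.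
\<close>

lemma not_thin_open:
  assumes A: "openin (Euclidean_space n) A" "A \<noteq> {}" and mn: "m < n"
  shows "\<not> thin n m A"
proof
  assume "thin n m A"
  then obtain K where K: "\<And>N. N \<ge> 1 \<Longrightarrow> \<exists>P. finite P \<and> card P \<le> K * N ^ m \<and>
     (\<forall>a\<in>A. \<exists>p\<in>P. \<forall>i<n. \<bar>a i - p i\<bar> \<le> 1 / real N)"
    unfolding thin_def by blast
  obtain b e where b: "b \<in> A" "e > 0" "\<And>y. y \<in> ES n \<Longrightarrow> (\<forall>i<n. \<bar>y i - b i\<bar> < e) \<Longrightarrow> y \<in> A"
    using openin_ES_box[OF A(1)] A(2) by blast
  \<comment> \<open>cubes of size \<open>1/(tZ)\<close> are smaller than half of the grid width \<open>e/t\<close>\<close>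
  define Z where "Z = nat \<lceil>2 / e\<rceil> + 1"
  have Z: "2 / e < real Z" unfolding Z_def by linarith
  \<comment> \<open>any \<open>t\<close> with \<open>t\<^sup>m\<^sup>+\<^sup>1 > K (tZ)\<^sup>m\<close> will do\<close>
  define t where "t = K * Z ^ m + 1"
  have t: "t \<ge> 1" by (simp add: t_def)
  have Z1: "Z \<ge> 1" by (simp add: Z_def)
  then have "t * Z \<ge> 1" using t by simp
  from K[OF this] obtain P where P: "finite P" "card P \<le> K * (t * Z) ^ m"
    "\<And>a. a \<in> A \<Longrightarrow> \<exists>p\<in>P. \<forall>i<n. \<bar>a i - p i\<bar> \<le> 1 / real (t * Z)"
    by blast
  define I where "I = Pi\<^sub>E {..<n} (\<lambda>_. {..<t})"
  define y where "y k = (\<lambda>j. if j < n then b j + e * real (k j) / real t else 0)" for k :: "nat \<Rightarrow> nat"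
  have yA: "y k \<in> A" if "k \<in> I" for k
  proof (rule b(3))
    show "\<forall>i<n. \<bar>y k i - b i\<bar> < e"
    proof (intro allI impI)
      fix i assume "i < n"
      then have "k i < t" using that by (auto simp: I_def PiE_iff)
      then show "\<bar>y k i - b i\<bar> < e" using \<open>i < n\<close> b(2) by (simp add: y_def field_simps)
    qed
  qed (auto simp: y_def ES_iff)
  then have "\<forall>k\<in>I. \<exists>p. p \<in> P \<and> (\<forall>i<n. \<bar>y k i - p i\<bar> \<le> 1 / real (t * Z))"
    using P(3) by blast
  from bchoice[OF this]
  obtain q where q: "\<And>k. k \<in> I \<Longrightarrow> q k \<in> P \<and> (\<forall>i<n. \<bar>y k i - q k i\<bar> \<le> 1 / real (t * Z))"
    by blast
  have "inj_on q I"
  proof (rule inj_onI)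
    fix k k' assume k: "k \<in> I" "k' \<in> I" "q k = q k'"
    have "k i = k' i" if i: "i < n" for i
    proof (rule ccontr)
      assume "k i \<noteq> k' i"
      then have "1 \<le> \<bar>real (k i) - real (k' i)\<bar>" by linarith
      then have "e / real t * 1 \<le> e / real t * \<bar>real (k i) - real (k' i)\<bar>"
        using b(2) by (intro mult_left_mono) auto
      also have "\<dots> = \<bar>e / real t * (real (k i) - real (k' i))\<bar>"
        using b(2) by (simp add: abs_mult)
      also have "\<dots> = \<bar>y k i - y k' i\<bar>"
        using i by (simp add: y_def right_diff_distrib)
      also have "\<dots> \<le> \<bar>y k i - q k i\<bar> + \<bar>y k' i - q k i\<bar>" by linarith
      also have "\<dots> \<le> 1 / real (t * Z) + 1 / real (t * Z)"
        using q[OF k(1)] q[OF k(2)] i k(3) by (intro add_mono) auto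
      also have "\<dots> = (2 / real Z) / real t" by simp
      also have "\<dots> < e / real t"
        using Z b(2) t Z1 by (intro divide_strict_right_mono) (auto simp: field_simps)
      finally show False by simp
    qed
    then show "k = k'" using k(1,2) unfolding I_def by (auto intro: PiE_ext)
  qed
  then have "card I \<le> card P" using q P(1) by (intro card_inj_on_le[of q]) auto
  moreover have "card I = t ^ n" unfolding I_def by (subst card_PiE) auto
  ultimately have "t ^ n \<le> K * (t * Z) ^ m" using P(2) by linarith
  moreover have "t ^ Suc m \<le> t ^ n" using mn t by (intro power_increasing) auto
  moreover have "K * (t * Z) ^ m = t ^ m * (K * Z ^ m)" by (simp add: power_mult_distrib)
  ultimately have "t ^ m * t \<le> t ^ m * (K * Z ^ m)" by (simp only: power_Suc2)
  then have "t \<le> K * Z ^ m" using nat_mult_le_cancel1[of "t ^ m"] t by simp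
  then show False by (simp add: t_def)
qed

text \<open>
  Discretise the parameter \<open>s\<close> in steps of \<open>1/N\<close>; this multiplies the number of cubes by \<open>O(N)\<close>.
\<close>

lemma thin_cone:
  assumes A: "thin n m A" and R: "\<And>a i. a \<in> A \<Longrightarrow> i < n \<Longrightarrow> \<bar>a i - r i\<bar> \<le> R"
  shows "thin n (Suc m) {b. \<exists>a\<in>A. \<exists>s. 0 \<le> s \<and> s \<le> real S \<and> (\<forall>i<n. b i = r i + s * (a i - r i))}" (is "thin _ _ ?B")
proof -
  obtain K where K: "\<And>N. N \<ge> 1 \<Longrightarrow> \<exists>P. finite P \<and> card P \<le> K * N ^ m \<and>
     (\<forall>a\<in>A. \<exists>p\<in>P. \<forall>i<n. \<bar>a i - p i\<bar> \<le> 1 / real N)"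
    using A unfolding thin_def by blast
  show ?thesis
  proof (rule thin_rescale)
    fix N :: nat assume N: "N \<ge> 1"
    obtain P where P: "finite P" "card P \<le> K * N ^ m"
      "\<And>a. a \<in> A \<Longrightarrow> \<exists>p\<in>P. \<forall>i<n. \<bar>a i - p i\<bar> \<le> 1 / real N"
      using K[OF N] by blast
    let ?f = "\<lambda>(p, k) i. r i + real k / real N * (p i - r i)"
    have fin: "finite (P \<times> {..S * N})" using P(1) by simp
    have "card (?f ` (P \<times> {..S * N})) \<le> card (P \<times> {..S * N})" by (rule card_image_le[OF fin])
    also have "\<dots> = card P * (S * N + 1)" by (simp add: card_cartesian_product)
    also have "\<dots> \<le> (K * N ^ m) * ((S + 1) * N)" using P(2) N by (intro mult_mono) auto
    also have "\<dots> = K * (S + 1) * N ^ Suc m" by (simp add: algebra_simps)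
    finally have card: "card (?f ` (P \<times> {..S * N})) \<le> K * (S + 1) * N ^ Suc m" .
    have "\<exists>p\<in>?f ` (P \<times> {..S * N}). \<forall>i<n. \<bar>b i - p i\<bar> \<le> (R + real S) / real N" if "b \<in> ?B" for b
    proof -
      obtain a s where a: "a \<in> A" "0 \<le> s" "s \<le> real S" "\<And>i. i < n \<Longrightarrow> b i = r i + s * (a i - r i)"
        using \<open>b \<in> ?B\<close> by blast
      obtain p where p: "p \<in> P" "\<And>i. i < n \<Longrightarrow> \<bar>a i - p i\<bar> \<le> 1 / real N" using P(3)[OF a(1)] by blast
      define k where "k = nat \<lfloor>s * real N\<rfloor>"
      have kr: "real k = of_int \<lfloor>s * real N\<rfloor>" using a(2) by (simp add: k_def)
      then have k: "real k \<le> s * real N" "s * real N \<le> real k + 1" by linarith+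
      have "s * real N \<le> real S * real N" using a(3) by (intro mult_right_mono) auto
      then have "real k \<le> real (S * N)" using k by simp
      then have kS: "k \<le> S * N" by linarith
      define u where "u = real k / real N"
      have su: "s - u = (s * real N - real k) / real N" using N by (simp add: u_def diff_divide_distrib)
      have u0: "0 \<le> s - u" unfolding su using k by simp
      have u1: "s - u \<le> 1 / real N" unfolding su using k by (intro divide_right_mono) auto
      have u2: "0 \<le> u" by (simp add: u_def)
      have uS: "u \<le> real S" using u0 a(3) by linarith
      have "\<bar>b i - ?f (p, k) i\<bar> \<le> (R + real S) / real N" if i: "i < n" for i
      proof -
        have "?f (p, k) i = r i + u * (p i - r i)" by (simp add: u_def)
        then have "b i - ?f (p, k) i = (s - u) * (a i - r i) + u * (a i - p i)"
          unfolding a(4)[OF i] by (simp only:) (simp add: algebra_simps)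
        then have "\<bar>b i - ?f (p, k) i\<bar> \<le> (s - u) * \<bar>a i - r i\<bar> + u * \<bar>a i - p i\<bar>"
          using u0 u2 abs_triangle_ineq[of "(s - u) * (a i - r i)" "u * (a i - p i)"] by (simp add: abs_mult)
        also have "\<dots> \<le> 1 / real N * R + real S * (1 / real N)"
          using u0 u1 u2 uS R[OF a(1) i] p(2)[OF i] by (intro add_mono mult_mono) auto
        finally show ?thesis by (simp add: add_divide_distrib)
      qed
      then show ?thesis using p(1) kS by (intro bexI[of _ "?f (p, k)"]) auto
    qed
    then show "\<exists>P. finite P \<and> card P \<le> K * (S + 1) * N ^ Suc m \<and>
        (\<forall>a\<in>?B. \<exists>p\<in>P. \<forall>i<n. \<bar>a i - p i\<bar> \<le> (R + real S) / real N)"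
      using fin card by (intro exI[of _ "?f ` (P \<times> {..S * N})"]) blast
  qed
qed

lemma compact_cube: "compact {y \<in> ES l. \<forall>j<l. \<bar>y j - x j\<bar> \<le> r}"
proof -
  have "{y \<in> ES l. \<forall>j<l. \<bar>y j - x j\<bar> \<le> r} =
      {y::nat \<Rightarrow> real. \<forall>j. y j \<in> {(if j < l then x j - r else 0)..(if j < l then x j + r else 0)}}"
    (is "?A = ?B")
  proof (intro equalityI subsetI CollectI conjI allI impI)
    fix y j assume y: "y \<in> ?A"
    show "y j \<in> {(if j < l then x j - r else 0)..(if j < l then x j + r else 0)}"
    proof (cases "j < l")
      case True
      then have "\<bar>y j - x j\<bar> \<le> r" using y by blast
      then show ?thesis using True by (simp add: abs_le_iff)
    qed (use y in \<open>simp add: ES_iff\<close>)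
  next
    fix y assume y: "y \<in> ?B"
    have yj: "y j \<in> {(if j < l then x j - r else 0)..(if j < l then x j + r else 0)}" for j using y by blast
    show "y \<in> ES l" unfolding ES_iff
    proof (intro allI impI)
      fix i assume "l \<le> i" then show "y i = 0" using yj[of i] by simp
    qed
    show "\<bar>y j - x j\<bar> \<le> r" if "j < l" for j using yj[of j] that by (simp add: abs_le_iff)
  qed
  then show ?thesis by (rule ssubst) (rule compact_coord_box)
qed

text \<open>
  By \<open>C1_telescope\<close> a smooth map is Lipschitz on a small closed cube, where its partial derivatives
  are bounded.
\<close>

lemma smooth_image_locally_thin:
  assumes O: "openin (Euclidean_space l) W" and F: "smooth_map_on l n W F" and x: "x \<in> W"
  shows "\<exists>r>0. thin n l (F ` {y \<in> ES l. \<forall>j<l. \<bar>y j - x j\<bar> \<le> r})"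
proof -
  obtain e where e: "e > 0" "\<And>y. y \<in> ES l \<Longrightarrow> (\<forall>j<l. \<bar>y j - x j\<bar> < e) \<Longrightarrow> y \<in> W"
    using openin_ES_box[OF O x] by blast
  define Q where "Q = {y \<in> ES l. \<forall>j<l. \<bar>y j - x j\<bar> \<le> e / 2}"
  have QW: "Q \<subseteq> W"
  proof
    fix y assume y: "y \<in> Q"
    show "y \<in> W"
    proof (rule e(2))
      show "\<forall>j<l. \<bar>y j - x j\<bar> < e" using y e(1) by (fastforce simp: Q_def)
    qed (use y in \<open>simp add: Q_def\<close>)
  qed
  have C1: "Ck_on l (Suc 0) W (\<lambda>y. F y i)" if "i < n" for i using F that unfolding smooth_map_on_def by blast
  let ?s = "\<lambda>y. \<Sum>i<n. \<Sum>j<l. \<bar>partial_deriv j (\<lambda>y. F y i) y\<bar>"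
  have "continuous_on W (partial_deriv j (\<lambda>y. F y i))" if "i < n" "j < l" for i j
    by (rule Ck_on_imp_continuous_on[OF O Ck_on_Suc_partial(1)[OF C1[OF that(1)] that(2)]])
  then have "continuous_on W ?s" by (intro continuous_intros) auto
  then have "continuous_on Q ?s" using QW continuous_on_subset by blast
  moreover have "x \<in> Q" using x openin_ES_subset[OF O] e(1) by (auto simp: Q_def)
  ultimately obtain y0 where y0: "\<And>y. y \<in> Q \<Longrightarrow> ?s y \<le> ?s y0"
    using continuous_attains_sup[OF compact_cube[of l x "e / 2"], folded Q_def] by blast
  have "thin n l (F ` Q)"
  proof (rule thin_Lipschitz_cube[OF Q_def])
    show "0 \<le> ?s y0" by (intro sum_nonneg) auto
    fix y z i assume yz: "y \<in> Q" "z \<in> Q" and i: "i < n"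
    have yzE: "z \<in> ES l" "y \<in> ES l" using yz by (auto simp: Q_def)
    have box: "w \<in> Q" if "w \<in> ES l" "\<And>i. min (z i) (y i) \<le> w i \<and> w i \<le> max (z i) (y i)" for w
    proof -
      have "\<bar>w j - x j\<bar> \<le> e / 2" if "j < l" for j
      proof -
        have "\<bar>z j - x j\<bar> \<le> e / 2" "\<bar>y j - x j\<bar> \<le> e / 2" using yz that by (auto simp: Q_def)
        moreover have "z j \<le> w j \<and> w j \<le> y j \<or> y j \<le> w j \<and> w j \<le> z j"
          using \<open>\<And>i. min (z i) (y i) \<le> w i \<and> w i \<le> max (z i) (y i)\<close>[of j] by linarith
        ultimately show ?thesis by linarith
      qed
      then show ?thesis using that(1) by (simp add: Q_def)
    qed
    have "Ck_on l 1 W (\<lambda>y. F y i)" using C1[OF i] by simp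
    from C1_telescope[OF O this yzE] obtain \<eta> where
      \<eta>: "\<forall>j<l. \<eta> j \<in> ES l \<and> (\<forall>i. min (z i) (y i) \<le> \<eta> j i \<and> \<eta> j i \<le> max (z i) (y i))"
      "F y i - F z i = (\<Sum>j<l. partial_deriv j (\<lambda>y. F y i) (\<eta> j) * (y j - z j))"
      using box QW by blast
    have "\<bar>partial_deriv j (\<lambda>y. F y i) (\<eta> j)\<bar> \<le> ?s y0" if j: "j < l" for j
    proof -
      have "\<eta> j \<in> Q" using \<eta>(1) j box by blast
      have "\<bar>partial_deriv j (\<lambda>y. F y i) (\<eta> j)\<bar> \<le> (\<Sum>j'<l. \<bar>partial_deriv j' (\<lambda>y. F y i) (\<eta> j)\<bar>)"
        using j by (intro member_le_sum) auto
      also have "\<dots> \<le> ?s (\<eta> j)"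
        using i by (intro member_le_sum[of i "{..<n}" "\<lambda>i. \<Sum>j'<l. \<bar>partial_deriv j' (\<lambda>y. F y i) (\<eta> j)\<bar>"] sum_nonneg) auto
      also have "\<dots> \<le> ?s y0" by (rule y0[OF \<open>\<eta> j \<in> Q\<close>])
      finally show ?thesis .
    qed
    then have "\<bar>F y i - F z i\<bar> \<le> (\<Sum>j<l. ?s y0 * \<bar>y j - z j\<bar>)"
      unfolding \<eta>(2) by (intro order_trans[OF sum_abs] sum_mono) (auto simp: abs_mult intro!: mult_right_mono)
    then show "\<bar>F y i - F z i\<bar> \<le> ?s y0 * (\<Sum>j<l. \<bar>y j - z j\<bar>)" by (simp add: sum_distrib_left)
  qed
  then show ?thesis using e(1) unfolding Q_def by (intro exI[of _ "e / 2"]) auto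
qed

lemma smooth_image_compact_thin:
  assumes O: "openin (Euclidean_space l) W" and F: "smooth_map_on l n W F" and K: "compact K" "K \<subseteq> W"
  shows "thin n l (F ` K)"
proof -
  have "\<forall>x\<in>K. \<exists>r>0. thin n l (F ` {y \<in> ES l. \<forall>j<l. \<bar>y j - x j\<bar> \<le> r})"
    using smooth_image_locally_thin[OF O F] K(2) by blast
  from bchoice[OF this]
  obtain r where r: "\<And>x. x \<in> K \<Longrightarrow> r x > 0 \<and> thin n l (F ` {y \<in> ES l. \<forall>j<l. \<bar>y j - x j\<bar> \<le> r x})"
    by blast
  have "\<forall>x. \<exists>T. open T \<and> {y \<in> ES l. \<forall>j<l. \<bar>y j - x j\<bar> < r x} = ES l \<inter> T"
  proof
    fix x show "\<exists>T. open T \<and> {y \<in> ES l. \<forall>j<l. \<bar>y j - x j\<bar> < r x} = ES l \<inter> T"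
      using openin_ES_cube[of l x "r x"] unfolding openin_ES_iff .
  qed
  from choice[OF this]
  obtain T where T: "\<And>x. open (T x)" "\<And>x. {y \<in> ES l. \<forall>j<l. \<bar>y j - x j\<bar> < r x} = ES l \<inter> T x" by blast
  have KE: "K \<subseteq> ES l" using K(2) openin_ES_subset[OF O] by blast
  have "x \<in> T x" if "x \<in> K" for x
    using T(2)[of x] r[OF that] KE that by auto
  then have "K \<subseteq> (\<Union>x\<in>K. T x)" by blast
  then obtain D where D: "D \<subseteq> K" "finite D" "K \<subseteq> (\<Union>x\<in>D. T x)"
    using compactE_image[OF K(1), of K T] T(1) by metis
  have "F ` K \<subseteq> (\<Union>x\<in>D. F ` {y \<in> ES l. \<forall>j<l. \<bar>y j - x j\<bar> \<le> r x})"
  proof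
    fix b assume "b \<in> F ` K"
    then obtain y x where y: "y \<in> K" "b = F y" "x \<in> D" "y \<in> T x" using D(3) by blast
    then have "y \<in> {y \<in> ES l. \<forall>j<l. \<bar>y j - x j\<bar> < r x}" using T(2) KE by blast
    then show "b \<in> (\<Union>x\<in>D. F ` {y \<in> ES l. \<forall>j<l. \<bar>y j - x j\<bar> \<le> r x})"
      using y by (fastforce intro: less_imp_le)
  qed
  moreover have "thin n l (\<Union>x\<in>D. F ` {y \<in> ES l. \<forall>j<l. \<bar>y j - x j\<bar> \<le> r x})"
    using D r by (intro thin_UN) auto
  ultimately show ?thesis by (rule thin_subset[rotated])
qed

section \<open>The dual graph is connected\<close>

lemma chart_inverse_continuous:
  assumes "is_chart n M (V, h)"
  shows "continuous_map (subtopology (Euclidean_space n) (h ` V)) M (inv_into V h)"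
proof -
  note ch = is_chartD[OF assms]
  have t: "topspace (subtopology (Euclidean_space n) (h ` V)) = h ` V" using ch(4) by auto
  have VM: "V \<subseteq> topspace M" using openin_subset[OF ch(1)] .
  show ?thesis unfolding continuous_map t
  proof (intro conjI allI impI)
    show "inv_into V h ` h ` V \<subseteq> topspace M" using VM ch(3) by auto
    fix W assume W: "openin M W"
    have "{y \<in> h ` V. inv_into V h y \<in> W} = h ` (V \<inter> W)" using ch(3) by auto
    then show "openin (subtopology (Euclidean_space n) (h ` V)) {y \<in> h ` V. inv_into V h y \<in> W}"
      using ch(6)[of "V \<inter> W"] ch(1,2) W by (auto simp: openin_open_subtopology)
  qed
qed

text \<open>
  Move slightly towards the barycentre.
\<close>

lemma osimplex_dense:
  assumes U: "openin (Euclidean_space l) U" and x: "x \<in> U" "x \<in> std_simplex l"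
  shows "U \<inter> osimplex l \<noteq> {}"
proof -
  obtain e where e: "e > 0" "\<And>y. y \<in> ES l \<Longrightarrow> (\<forall>i<l. \<bar>y i - x i\<bar> < e) \<Longrightarrow> y \<in> U"
    using openin_ES_box[OF U x(1)] by blast
  define b where "b = (\<lambda>j. if j < l then 1 / real (Suc l) else 0)"
  have bb: "0 < bary l k b" if "k \<le> l" for k
    using that by (cases k) (auto simp: b_def field_simps)
  define s where "s = min (1/2) (e / 2)"
  have s: "0 < s" "s < 1" "s < e" using e(1) by (auto simp: s_def)
  define y where "y = (\<lambda>j. (1 - s) * x j + s * b j)"
  have "y \<in> ES l" using x(2) by (auto simp: std_simplex_iff ES_iff y_def b_def)
  moreover have "0 < bary l k y" if "k \<le> l" for k
    unfolding y_def bary_affine using bb[OF that] s x(2) that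
    by (intro add_nonneg_pos mult_nonneg_nonneg mult_pos_pos) (auto simp: std_simplex_iff simp del: bary_simps)
  ultimately have yo: "y \<in> osimplex l" by (simp add: osimplex_def del: bary_simps)
  have "\<bar>y j - x j\<bar> < e" if "j < l" for j
  proof -
    have yx: "y j - x j = s * (b j - x j)" by (simp add: y_def algebra_simps)
    have "0 \<le> x j" "x j \<le> 1" using x(2) that by (auto simp: std_simplex_def)
    moreover have "0 \<le> b j" "b j \<le> 1" using that by (auto simp: b_def)
    ultimately have "\<bar>b j - x j\<bar> \<le> 1" by linarith
    then have "s * \<bar>b j - x j\<bar> \<le> s * 1" using s by (intro mult_left_mono) auto
    moreover have "\<bar>y j - x j\<bar> = s * \<bar>b j - x j\<bar>" using yx s by (simp add: abs_mult)
    ultimately show ?thesis using s by linarith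
  qed
  then have "y \<in> U" using e(2) \<open>y \<in> ES l\<close> by blast
  then show ?thesis using yo by blast
qed

context triangulated_manifold
begin

lemma open_meets_open_simplex:
  assumes \<tau>: "\<tau> \<in> \<Phi> n" and N: "openin M N" and x: "x \<in> std_simplex n" "\<tau> x \<in> N"
  shows "N \<inter> \<tau> ` osimplex n \<noteq> {}"
proof -
  obtain U f where U: "openin (Euclidean_space n) U" "std_simplex n \<subseteq> U" "smooth_embedding n n M \<A> U f"
    "\<And>x. x \<in> std_simplex n \<Longrightarrow> \<tau> x = f x"
    using simplex_extension[OF \<tau> order_refl] by metis
  have "openin (Euclidean_space n) (U \<inter> f -` N)" by (rule top_simplex_chart(3)[OF U(1,3) N])
  then have "(U \<inter> f -` N) \<inter> osimplex n \<noteq> {}"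
    using x U by (intro osimplex_dense[of _ _ x]) auto
  then obtain y where y: "y \<in> osimplex n" "f y \<in> N" by blast
  then have "\<tau> y \<in> N" using U(4)[OF subsetD[OF osimplex_subset y(1)]] by simp
  then show ?thesis using y(1) by blast
qed

lemma simplex_chart_image_thin:
  assumes \<phi>: "\<phi> \<in> \<Phi> l" "l \<le> n" and V: "(V, h) \<in> \<A>" and Q: "closedin M Q" "Q \<subseteq> V"
  shows "thin n l (h ` (Q \<inter> \<phi> ` std_simplex l))"
proof -
  obtain U f where U: "openin (Euclidean_space l) U" "std_simplex l \<subseteq> U" "smooth_embedding l n M \<A> U f"
    "\<And>x. x \<in> std_simplex l \<Longrightarrow> \<phi> x = f x" "continuous_map (subtopology (Euclidean_space l) U) M f"
    using simplex_extension[OF \<phi>] by metis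
  have tU: "topspace (subtopology (Euclidean_space l) U) = U" using openin_ES_subset[OF U(1)] by auto
  have Vop: "openin M V" using is_chartD(1)[OF smooth_structureD(1)[OF S V]] .
  have "openin (subtopology (Euclidean_space l) U) {x \<in> U. f x \<in> V}"
    using openin_continuous_map_preimage[OF U(5) Vop] unfolding tU .
  then have W: "openin (Euclidean_space l) (U \<inter> f -` V)"
    using U(1) openin_trans_full by (simp add: Collect_conj_eq vimage_def)
  have F: "smooth_map_on l n (U \<inter> f -` V) (h \<circ> f)"
    using U(3) V unfolding smooth_embedding_def by fast
  define K where "K = {x \<in> std_simplex l. f x \<in> Q}"
  have "closedin (subtopology (Euclidean_space l) U) {x \<in> U. f x \<in> Q}"
    using closedin_continuous_map_preimage[OF U(5) Q(1)] unfolding tU .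
  then have "closedin (top_of_set U) {x \<in> U. f x \<in> Q}" unfolding subtopology_ES[OF openin_ES_subset[OF U(1)]] .
  then obtain T where T: "closed T" "{x \<in> U. f x \<in> Q} = U \<inter> T" unfolding closedin_closed by blast
  have "K = std_simplex l \<inter> T" using T(2) U(2) unfolding K_def by blast
  then have "compact K" using compact_Int_closed[OF compact_std_simplex T(1)] by simp
  moreover have "K \<subseteq> U \<inter> f -` V" using U(2) Q(2) by (auto simp: K_def)
  ultimately have "thin n l ((h \<circ> f) ` K)" by (rule smooth_image_compact_thin[OF W F])
  moreover have "h ` (Q \<inter> \<phi> ` std_simplex l) \<subseteq> (h \<circ> f) ` K"
    using U(4) by (auto simp: K_def)
  ultimately show ?thesis by (rule thin_subset)
qed

text \<open>
  The index is one more than the dimension: \<open>skeleton (n - 1)\<close> has codimension two, and \<open>skeleton 0\<close>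
  is empty.
\<close>

definition skeleton :: "nat \<Rightarrow> 'a set" where
  "skeleton k = (\<Union>l\<in>{..<k}. \<Union>\<phi>\<in>\<Phi> l. \<phi> ` std_simplex l)"

lemma skeleton_chart_image_thin:
  assumes k: "k \<le> n" and V: "(V, h) \<in> \<A>" and Q: "closedin M Q" "Q \<subseteq> V"
  shows "thin n k (h ` (Q \<inter> skeleton (Suc k)))"
proof -
  have "thin n k (\<Union>l\<in>{..<Suc k}. \<Union>\<phi>\<in>\<Phi> l. h ` (Q \<inter> \<phi> ` std_simplex l))"
    using k by (intro thin_UN finite_simplices thin_mono[OF simplex_chart_image_thin[OF _ _ V Q]]) auto
  moreover have "h ` (Q \<inter> skeleton (Suc k)) \<subseteq> (\<Union>l\<in>{..<Suc k}. \<Union>\<phi>\<in>\<Phi> l. h ` (Q \<inter> \<phi> ` std_simplex l))"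
    unfolding skeleton_def by blast
  ultimately show ?thesis by (rule thin_subset)
qed

text \<open>
  The closed box has to be closed in \<open>M\<close>, not only in the chart; it is, being compact.
\<close>

lemma chart_box:
  assumes p: "p \<in> topspace M"
  obtains V h e where "(V, h) \<in> \<A>" "p \<in> V" "e > 0" "{y \<in> ES n. \<forall>i<n. \<bar>y i - h p i\<bar> \<le> e} \<subseteq> h ` V"
    "closedin M {q \<in> V. \<forall>i<n. \<bar>h q i - h p i\<bar> \<le> e}" "openin M {q \<in> V. \<forall>i<n. \<bar>h q i - h p i\<bar> < e}"
proof -
  obtain V h where V: "(V, h) \<in> \<A>" "p \<in> V" using smooth_structureD(2)[OF S p] by blast
  note ch = is_chartD[OF smooth_structureD(1)[OF S V(1)]]
  obtain e where e: "e > 0" "\<And>y. y \<in> ES n \<Longrightarrow> (\<forall>i<n. \<bar>y i - h p i\<bar> < e) \<Longrightarrow> y \<in> h ` V"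
    using openin_ES_box[OF ch(2), of "h p"] V(2) by blast
  define Q where "Q = {y \<in> ES n. \<forall>i<n. \<bar>y i - h p i\<bar> \<le> e / 2}"
  have QV: "Q \<subseteq> h ` V"
  proof
    fix y assume y: "y \<in> Q"
    show "y \<in> h ` V"
    proof (rule e(2))
      show "\<forall>i<n. \<bar>y i - h p i\<bar> < e" using y e(1) by (fastforce simp: Q_def)
    qed (use y in \<open>simp add: Q_def\<close>)
  qed
  have "compactin (subtopology (Euclidean_space n) (h ` V)) Q"
    using compact_cube[of n "h p" "e / 2"] QV unfolding subtopology_ES[OF ch(4)] Q_def[symmetric]
    by (simp add: compactin_subtopology)
  from image_compactin[OF this chart_inverse_continuous[OF smooth_structureD(1)[OF S V(1)]]]
  have "closedin M (inv_into V h ` Q)" by (rule compactin_imp_closedin[OF hausdorff])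
  moreover have "inv_into V h ` Q = {q \<in> V. \<forall>i<n. \<bar>h q i - h p i\<bar> \<le> e / 2}"
  proof (intro equalityI subsetI)
    fix q assume "q \<in> inv_into V h ` Q"
    then obtain y where "y \<in> Q" "q = inv_into V h y" by blast
    then have "q \<in> V" "h q = y" using QV by (auto simp: inv_into_into f_inv_into_f subset_iff)
    then show "q \<in> {q \<in> V. \<forall>i<n. \<bar>h q i - h p i\<bar> \<le> e / 2}" using \<open>y \<in> Q\<close> by (simp add: Q_def)
  next
    fix q assume q: "q \<in> {q \<in> V. \<forall>i<n. \<bar>h q i - h p i\<bar> \<le> e / 2}"
    then have "h q \<in> Q" using ch(4) by (auto simp: Q_def)
    moreover have "inv_into V h (h q) = q" using ch(3) q by simp
    ultimately show "q \<in> inv_into V h ` Q" by (metis imageI)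
  qed
  ultimately have "closedin M {q \<in> V. \<forall>i<n. \<bar>h q i - h p i\<bar> \<le> e / 2}" by simp
  moreover have "openin M {q \<in> V. \<forall>i<n. \<bar>h q i - h p i\<bar> < e / 2}"
  proof -
    have "openin M {q \<in> V. h q \<in> {y \<in> ES n. \<forall>i<n. \<bar>y i - h p i\<bar> < e / 2}}"
      by (rule ch(7)[OF openin_ES_cube])
    moreover have "{q \<in> V. h q \<in> {y \<in> ES n. \<forall>i<n. \<bar>y i - h p i\<bar> < e / 2}} = {q \<in> V. \<forall>i<n. \<bar>h q i - h p i\<bar> < e / 2}"
      using ch(4) by auto
    ultimately show ?thesis by simp
  qed
  ultimately show ?thesis using that[OF V, of "e / 2"] e(1) QV unfolding Q_def by simp
qed

lemma closedin_union_top_simplices: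
  assumes "T \<subseteq> \<Phi> n"
  shows "closedin M (\<Union>\<tau>\<in>T. \<tau> ` std_simplex n)"
  using assms finite_subset[OF assms finite_simplices[OF order_refl]]
  by (intro closedin_Union) (auto intro: simplex_closedin)

text \<open>
  The union of the closed \<open>n\<close>-simplices is closed.  A point outside it would have a neighbourhood that
  consists of points of lower simplices, hence is thin.
\<close>

lemma top_simplices_cover:
  assumes p: "p \<in> topspace M"
  shows "p \<in> (\<Union>\<tau>\<in>\<Phi> n. \<tau> ` std_simplex n)"
proof (rule ccontr)
  let ?Y = "\<Union>\<tau>\<in>\<Phi> n. \<tau> ` std_simplex n"
  assume np: "p \<notin> ?Y"
  obtain l \<phi> where "l \<le> n" "\<phi> \<in> \<Phi> l" "p \<in> \<phi> ` osimplex l"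
    using p topspace_open_simplices by blast
  then have "l < n" using np osimplex_subset[of l] by (cases "l = n") auto
  then obtain m where n: "n = Suc m" by (cases n) auto
  obtain V h e where V: "(V, h) \<in> \<A>" "p \<in> V" and e: "e > 0"
    and QV: "{y \<in> ES n. \<forall>i<n. \<bar>y i - h p i\<bar> \<le> e} \<subseteq> h ` V"
    and Q: "closedin M {q \<in> V. \<forall>i<n. \<bar>h q i - h p i\<bar> \<le> e}" and N: "openin M {q \<in> V. \<forall>i<n. \<bar>h q i - h p i\<bar> < e}"
    by (rule chart_box[OF p])
  note ch = is_chartD[OF smooth_structureD(1)[OF S V(1)]]
  let ?Q = "{q \<in> V. \<forall>i<n. \<bar>h q i - h p i\<bar> \<le> e}" and ?N = "{q \<in> V. \<forall>i<n. \<bar>h q i - h p i\<bar> < e}"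
  have op: "openin M (?N - ?Y)" using N closedin_union_top_simplices[OF order_refl] by (rule openin_diff)
  have "thin n m (h ` (?Q \<inter> skeleton (Suc m)))"
    by (rule skeleton_chart_image_thin[OF _ V(1) Q]) (use n in auto)
  moreover have "?N - ?Y \<subseteq> ?Q \<inter> skeleton (Suc m)"
  proof
    fix q assume q: "q \<in> ?N - ?Y"
    then have "q \<in> topspace M" using op openin_subset by blast
    then obtain l \<phi> where l: "l \<le> n" "\<phi> \<in> \<Phi> l" "q \<in> \<phi> ` osimplex l"
      using topspace_open_simplices by blast
    then have "l < n" using q osimplex_subset[of l] by (cases "l = n") auto
    then show "q \<in> ?Q \<inter> skeleton (Suc m)"
      using q l n osimplex_subset[of l] unfolding skeleton_def by (auto intro: less_imp_le)
  qed
  ultimately have "thin n m (h ` (?N - ?Y))" by (meson image_mono thin_subset)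
  moreover have "openin (Euclidean_space n) (h ` (?N - ?Y))" by (rule ch(6)[OF op]) auto
  moreover have "p \<in> ?N - ?Y" using np V(2) e by simp
  then have "h ` (?N - ?Y) \<noteq> {}" by blast
  ultimately show False using not_thin_open[of n "h ` (?N - ?Y)" m] n by simp
qed

text \<open>
  A common point of two \<open>n\<close>-simplices lies on a facet of each.  If it is interior to the first facet,
  then the second facet is the same simplex by \<open>open_simplex_meets_closed\<close>; otherwise it belongs to a
  simplex of codimension two.
\<close>

lemma shared_facet:
  assumes \<tau>: "\<tau>0 \<in> \<Phi> n" "\<tau> \<in> \<Phi> n" "\<tau>0 \<noteq> \<tau>" and q: "q \<in> \<tau>0 ` std_simplex n" "q \<in> \<tau> ` std_simplex n"
    and sk: "q \<notin> skeleton (n - 1)"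
  shows "\<exists>m i i0. n = Suc m \<and> i \<le> n \<and> i0 \<le> n \<and>
     restrict (\<tau>0 \<circ> face_map m i0) (std_simplex m) = restrict (\<tau> \<circ> face_map m i) (std_simplex m)"
proof -
  obtain x y where x: "x \<in> std_simplex n" "q = \<tau>0 x" and y: "y \<in> std_simplex n" "q = \<tau> y" using q by blast
  have "x \<notin> osimplex n" using open_simplex_meets_closed[OF \<tau>(1) order_refl _ \<tau>(2) order_refl y(1)] x y \<tau>(3) by metis
  with x(1) obtain m i0 x' where m: "n = Suc m" "i0 \<le> n" "x' \<in> std_simplex m" "x = face_map m i0 x'"
    by (cases rule: simplex_open_or_face) auto
  have "y \<notin> osimplex n" using open_simplex_meets_closed[OF \<tau>(2) order_refl _ \<tau>(1) order_refl x(1)] x y \<tau>(3) by metis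
  with y(1) obtain m' i y' where "n = Suc m'" "i \<le> n" "y' \<in> std_simplex m'" "y = face_map m' i y'"
    by (cases rule: simplex_open_or_face) auto
  then have y': "i \<le> n" "y' \<in> std_simplex m" "y = face_map m i y'" using m by auto
  let ?\<sigma>a = "restrict (\<tau>0 \<circ> face_map m i0) (std_simplex m)" and ?\<sigma> = "restrict (\<tau> \<circ> face_map m i) (std_simplex m)"
  have \<sigma>: "?\<sigma>a \<in> \<Phi> m" "?\<sigma> \<in> \<Phi> m" using face_simplex m y' \<tau> by auto
  have eq: "?\<sigma>a x' = q" "?\<sigma> y' = q" using x(2) y(2) m(3,4) y'(2,3) by simp_all
  from m(3) show ?thesis
  proof (cases rule: simplex_open_or_face)
    case 1
    have "?\<sigma>a = ?\<sigma>"
      using open_simplex_meets_closed[OF \<sigma>(1) _ 1 \<sigma>(2) order_refl y'(2)] eq m(1) by simp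
    then show ?thesis using m y' by blast
  next
    case (2 k j z)
    let ?\<rho> = "restrict (?\<sigma>a \<circ> face_map k j) (std_simplex k)"
    have "?\<rho> \<in> \<Phi> k" using face_simplex[of ?\<sigma>a k j] \<sigma>(1) 2 m(1) by simp
    moreover have "?\<rho> z = q" using 2 eq(1) by simp
    moreover have "k < n - 1" using m(1) 2(1) by simp
    ultimately have "q \<in> skeleton (n - 1)"
      unfolding skeleton_def using 2(4) by (intro UN_I[of k] UN_I[of ?\<rho>] image_eqI[of _ _ z]) auto
    then show ?thesis using sk by blast
  qed
qed

text \<open>
  Otherwise the closed sets \<open>X\<close> and \<open>Y\<close>, made up of the simplices in \<open>T\<close> and not in \<open>T\<close>, meet in the
  skeleton of codimension two only.  Take a box around a common point, an open set \<open>A\<close> in an open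
  simplex of \<open>X\<close> and a point \<open>r\<close> of an open simplex of \<open>Y\<close> in the box.  A segment from \<open>r\<close> to a point
  \<open>a\<close> of \<open>A\<close> has a point in \<open>X \<inter> Y\<close>, so \<open>a\<close> belongs to the cone with apex \<open>r\<close> over the skeleton.  The
  cone is too thin to contain the open set \<open>A\<close>.
\<close>

lemma adjacent_simplex:
  assumes conn: "connected_space M" and T: "T \<subseteq> \<Phi> n" "T \<noteq> {}" "T \<noteq> \<Phi> n"
  shows "\<exists>\<tau>0\<in>T. \<exists>\<tau>\<in>\<Phi> n - T. \<exists>m i i0. n = Suc m \<and> i \<le> n \<and> i0 \<le> n \<and>
     restrict (\<tau>0 \<circ> face_map m i0) (std_simplex m) = restrict (\<tau> \<circ> face_map m i) (std_simplex m)"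
proof (rule ccontr)
  assume no: "\<not> ?thesis"
  define X where "X = (\<Union>\<tau>\<in>T. \<tau> ` std_simplex n)"
  define Y where "Y = (\<Union>\<tau>\<in>\<Phi> n - T. \<tau> ` std_simplex n)"
  have cl: "closedin M X" "closedin M Y"
    unfolding X_def Y_def using T(1) by (auto intro!: closedin_union_top_simplices)
  have cov: "topspace M \<subseteq> X \<union> Y"
  proof
    fix q assume "q \<in> topspace M"
    then obtain \<tau> where "\<tau> \<in> \<Phi> n" "q \<in> \<tau> ` std_simplex n" using top_simplices_cover by blast
    then show "q \<in> X \<union> Y" unfolding X_def Y_def by (cases "\<tau> \<in> T") blast+
  qed
  have XY: "X \<inter> Y \<subseteq> skeleton (n - 1)"
  proof
    fix q assume "q \<in> X \<inter> Y"
    then obtain \<tau>0 \<tau> where t: "\<tau>0 \<in> T" "\<tau> \<in> \<Phi> n - T" "q \<in> \<tau>0 ` std_simplex n" "q \<in> \<tau> ` std_simplex n"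
      by (auto simp: X_def Y_def)
    then show "q \<in> skeleton (n - 1)"
      using shared_facet[of \<tau>0 \<tau> q] no T(1) by blast
  qed
  have v: "(\<lambda>_. 0) \<in> std_simplex n" by (simp add: std_simplex_def ES_iff)
  have "X \<noteq> {}" "Y \<noteq> {}" using T v by (auto simp: X_def Y_def)
  then have "X \<inter> Y \<noteq> {}"
    using conn cl cov unfolding connected_space_closedin by blast
  then obtain p where p: "p \<in> X" "p \<in> Y" by blast
  have pM: "p \<in> topspace M" using p(1) closedin_subset[OF cl(1)] by blast
  have "p \<in> skeleton (n - 1)" using XY p by blast
  then have "n \<ge> 2" by (auto simp: skeleton_def)
  define k where "k = n - 2"
  have n: "n = Suc (Suc k)" using \<open>n \<ge> 2\<close> by (simp add: k_def)
  obtain V h e where V: "(V, h) \<in> \<A>" "p \<in> V" and e: "e > 0"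
    and QV: "{y \<in> ES n. \<forall>i<n. \<bar>y i - h p i\<bar> \<le> e} \<subseteq> h ` V"
    and Q: "closedin M {q \<in> V. \<forall>i<n. \<bar>h q i - h p i\<bar> \<le> e}" and N: "openin M {q \<in> V. \<forall>i<n. \<bar>h q i - h p i\<bar> < e}"
    by (rule chart_box[OF pM])
  note ch = is_chartD[OF smooth_structureD(1)[OF S V(1)]]
  define Qs where "Qs = {q \<in> V. \<forall>i<n. \<bar>h q i - h p i\<bar> \<le> e}"
  define Ns where "Ns = {q \<in> V. \<forall>i<n. \<bar>h q i - h p i\<bar> < e}"
  have NQ: "Ns \<subseteq> Qs" "Ns \<subseteq> V" "Qs \<subseteq> V" by (auto simp: Ns_def Qs_def less_imp_le)
  have Nop: "openin M Ns" and Qcl: "closedin M Qs" using N Q by (auto simp: Ns_def Qs_def)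
  have pN: "p \<in> Ns" using V(2) e by (auto simp: Ns_def)
  obtain \<tau>0 x0 where t0: "\<tau>0 \<in> T" "x0 \<in> std_simplex n" "p = \<tau>0 x0" using p(1) by (auto simp: X_def)
  obtain \<tau> x1 where t1: "\<tau> \<in> \<Phi> n - T" "x1 \<in> std_simplex n" "p = \<tau> x1" using p(2) by (auto simp: Y_def)
  define A where "A = Ns \<inter> \<tau>0 ` osimplex n"
  define B where "B = Ns \<inter> \<tau> ` osimplex n"
  have \<Phi>n: "\<tau>0 \<in> \<Phi> n" "\<tau> \<in> \<Phi> n" using t0(1) t1(1) T(1) by auto
  have A: "openin M A" "A \<noteq> {}" "A \<subseteq> X"
  proof -
    show "openin M A" unfolding A_def using Nop open_top_simplex[OF \<Phi>n(1)] by blast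
    show "A \<noteq> {}" unfolding A_def
      by (rule open_meets_open_simplex[OF \<Phi>n(1) Nop t0(2)]) (use pN t0(3) in simp)
    show "A \<subseteq> X" unfolding A_def X_def using t0(1) osimplex_subset[of n] by blast
  qed
  have B: "openin M B" "B \<noteq> {}" "B \<subseteq> Y"
  proof -
    show "openin M B" unfolding B_def using Nop open_top_simplex[OF \<Phi>n(2)] by blast
    show "B \<noteq> {}" unfolding B_def
      by (rule open_meets_open_simplex[OF \<Phi>n(2) Nop t1(2)]) (use pN t1(3) in simp)
    show "B \<subseteq> Y" unfolding B_def Y_def using t1(1) osimplex_subset[of n] by blast
  qed
  have Bsk: "B \<inter> skeleton (n - 1) = {}"
  proof (rule ccontr)
    assume "B \<inter> skeleton (n - 1) \<noteq> {}"
    then obtain q l \<phi> where "q \<in> \<tau> ` osimplex n" "l < n - 1" "\<phi> \<in> \<Phi> l" "q \<in> \<phi> ` std_simplex l"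
      unfolding B_def skeleton_def by blast
    then obtain x y where *: "x \<in> osimplex n" "l < n - 1" "\<phi> \<in> \<Phi> l" "y \<in> std_simplex l" "\<tau> x = \<phi> y"
      by (elim imageE) simp
    then have "n = l" using open_simplex_meets_closed[of \<tau> n x \<phi> l y] t1 by simp
    then show False using *(2) by simp
  qed
  obtain r where r: "r \<in> B" using B(2) by blast
  have BV: "B \<subseteq> V" "A \<subseteq> V" using NQ by (auto simp: A_def B_def)
  have hB: "openin (Euclidean_space n) (h ` B)" "openin (Euclidean_space n) (h ` A)"
    using ch(6)[OF B(1) BV(1)] ch(6)[OF A(1) BV(2)] by auto
  obtain d where d: "d > 0" "\<And>y. y \<in> ES n \<Longrightarrow> (\<forall>i<n. \<bar>y i - h r i\<bar> < d) \<Longrightarrow> y \<in> h ` B"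
    using openin_ES_box[OF hB(1), of "h r"] r by blast
  \<comment> \<open>bounds the factor from a skeleton point to the end of the segment: the former is at distance at least \<open>d\<close> from \<open>r\<close>, the latter at most \<open>2e\<close>\<close>
  define s where "s = nat \<lceil>2 * e / d\<rceil>"
  have sd: "2 * e / d \<le> real s" unfolding s_def by linarith
  define Sk where "Sk = h ` (Qs \<inter> skeleton (n - 1))"
  have Sk_thin: "thin n k Sk"
    using skeleton_chart_image_thin[of k V h Qs] V(1) Qcl NQ(3) n unfolding Sk_def by simp
  have rN: "\<bar>h r i - h p i\<bar> < e" if "i < n" for i using r that by (auto simp: B_def Ns_def)
  define Cn where "Cn = {b. \<exists>a\<in>Sk. \<exists>t. 0 \<le> t \<and> t \<le> real s \<and> (\<forall>i<n. b i = h r i + t * (a i - h r i))}"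
  have "thin n (Suc k) Cn"
    unfolding Cn_def
  proof (rule thin_cone[OF Sk_thin])
    fix a i assume "a \<in> Sk" "i < n"
    then have "\<bar>a i - h p i\<bar> \<le> e" by (auto simp: Sk_def Qs_def)
    then show "\<bar>a i - h r i\<bar> \<le> 2 * e" using rN[OF \<open>i < n\<close>] by linarith
  qed
  moreover have "h ` A \<subseteq> Cn"
  proof
    fix a assume "a \<in> h ` A"
    then obtain q where q: "q \<in> A" "a = h q" by blast
    have aN: "\<bar>a i - h p i\<bar> < e" if "i < n" for i using q that by (auto simp: A_def Ns_def)
    \<comment> \<open>the segment from \<open>r\<close> to \<open>a\<close> in the chart\<close>
    define g where "g t = (\<lambda>i. (1 - t) * h r i + t * a i)" for t
    have aE: "a \<in> ES n" "h r \<in> ES n" using q r BV ch(4) by auto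
    have gN: "g t \<in> ES n" "\<And>i. i < n \<Longrightarrow> \<bar>g t i - h p i\<bar> < e" if t: "0 \<le> t" "t \<le> 1" for t
    proof -
      show "g t \<in> ES n" using aE by (auto simp: g_def ES_iff)
      fix i assume i: "i < n"
      have "g t i - h p i = (1 - t) * (h r i - h p i) + t * (a i - h p i)" by (simp add: g_def algebra_simps)
      then have "\<bar>g t i - h p i\<bar> \<le> (1 - t) * \<bar>h r i - h p i\<bar> + t * \<bar>a i - h p i\<bar>"
        using t abs_triangle_ineq[of "(1 - t) * (h r i - h p i)" "t * (a i - h p i)"] by (simp add: abs_mult)
      also have "\<dots> < e"
        using convex_bound_lt[OF rN[OF i] aN[OF i], of "1 - t" t] t by simp
      finally show "\<bar>g t i - h p i\<bar> < e" .
    qed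
    have gV: "g t \<in> h ` V" if "0 \<le> t" "t \<le> 1" for t
    proof -
      have "g t \<in> {y \<in> ES n. \<forall>i<n. \<bar>y i - h p i\<bar> \<le> e}" using gN[OF that] by (simp add: less_imp_le)
      then show ?thesis using QV by blast
    qed
    define G where "G t = inv_into V h (g t)" for t
    have hG: "h (G t) = g t" "G t \<in> V" if "0 \<le> t" "t \<le> 1" for t
      using gV[OF that] by (auto simp: G_def f_inv_into_f inv_into_into)
    have GQ: "G t \<in> Qs" if "0 \<le> t" "t \<le> 1" for t
      using hG[OF that] gN(2)[OF that] by (auto simp: Qs_def less_imp_le)
    have G01: "G 0 = r" "G 1 = q"
      using ch(3) r q BV by (auto simp: G_def g_def)
    have cg: "continuous_on {0..1} g" unfolding g_def
      by (rule continuous_on_coordinatewise_then_product) (intro continuous_intros)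
    have "continuous_map (top_of_set {0..1}) (subtopology (Euclidean_space n) (h ` V)) g"
      unfolding subtopology_ES[OF ch(4)] using cg gV by auto
    from continuous_map_compose[OF this chart_inverse_continuous[OF smooth_structureD(1)[OF S V(1)]]]
    have cG: "continuous_map (top_of_set {0..1}) M G" by (simp add: G_def[abs_def] o_def)
    let ?I = "top_of_set {0..1::real}"
    have "connected_space ?I" by (simp add: connected_space_subtopology)
    moreover have "closedin ?I {t \<in> topspace ?I. G t \<in> X}" "closedin ?I {t \<in> topspace ?I. G t \<in> Y}"
      using closedin_continuous_map_preimage[OF cG] cl by blast+
    moreover have "topspace ?I \<subseteq> {t \<in> topspace ?I. G t \<in> X} \<union> {t \<in> topspace ?I. G t \<in> Y}"
      using cov continuous_map_image_subset_topspace[OF cG] by auto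
    moreover have "1 \<in> {t \<in> topspace ?I. G t \<in> X}" "0 \<in> {t \<in> topspace ?I. G t \<in> Y}"
      using G01 q(1) r A(3) B(3) by auto
    ultimately have "{t \<in> topspace ?I. G t \<in> X} \<inter> {t \<in> topspace ?I. G t \<in> Y} \<noteq> {}"
      unfolding connected_space_closedin by blast
    then obtain t where t: "0 \<le> t" "t \<le> 1" "G t \<in> X \<inter> Y" by auto
    have Gsk: "G t \<in> skeleton (n - 1)" using t(3) XY by blast
    have "g t \<in> Sk" unfolding Sk_def using hG(1)[OF t(1,2)] GQ[OF t(1,2)] Gsk by (metis IntI imageI)
    have "g t \<notin> h ` B"
    proof
      assume "g t \<in> h ` B"
      then obtain b where "b \<in> B" "h b = h (G t)" using hG(1)[OF t(1,2)] by auto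
      then have "G t \<in> B" using ch(3) BV hG(2)[OF t(1,2)] by (metis inj_onD subsetD)
      then show False using Bsk Gsk by blast
    qed
    then obtain i where i: "i < n" "d \<le> \<bar>g t i - h r i\<bar>"
      using d(2)[OF gN(1)[OF t(1,2)]] by (meson not_le)
    have "g t i - h r i = t * (a i - h r i)" by (simp add: g_def algebra_simps)
    moreover have "\<bar>a i - h r i\<bar> \<le> 2 * e" using aN[OF i(1)] rN[OF i(1)] by linarith
    ultimately have "d \<le> t * (2 * e)"
      using i(2) t(1) mult_left_mono[of "\<bar>a i - h r i\<bar>" "2 * e" t] by (simp add: abs_mult)
    then have "t \<noteq> 0" using d(1) by auto
    then have "t > 0" using t(1) by simp
    then have t0: "t > 0" "1 / t \<le> 2 * e / d" using d(1) \<open>d \<le> t * (2 * e)\<close> by (auto simp: field_simps)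
    have "a j = h r j + 1 / t * (g t j - h r j)" for j
      using t0(1) by (simp add: g_def field_simps)
    then show "a \<in> Cn" unfolding Cn_def using \<open>g t \<in> Sk\<close> t0 sd
      by (intro CollectI bexI[of _ "g t"] exI[of _ "1 / t"]) auto
  qed
  ultimately have "thin n (Suc k) (h ` A)" by (rule thin_subset)
  moreover have "h ` A \<noteq> {}" using A(2) by simp
  ultimately show False using not_thin_open[OF hB(2)] n by blast
qed

section \<open>Growing the cell\<close>

text \<open>
  The state of the construction: \<open>T\<close> is the set of the simplices used so far and \<open>C\<close> the cell, with
  chart \<open>h\<close>.  The last condition becomes the description of the complement of \<open>C\<close> when \<open>T\<close> is the set
  of all \<open>n\<close>-simplices; for \<open>n = 0\<close> it says that nothing is left outside \<open>C\<close>.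
\<close>

definition partial_cell :: "((nat \<Rightarrow> real) \<Rightarrow> 'a) set \<Rightarrow> 'a set \<Rightarrow> ('a \<Rightarrow> nat \<Rightarrow> real) \<Rightarrow> bool" where
  "partial_cell T C h \<longleftrightarrow> T \<subseteq> \<Phi> n \<and> (C, h) \<in> \<A> \<and> h ` C = osimplex n \<and>
     (\<forall>\<tau>\<in>T. \<tau> ` osimplex n \<subseteq> C) \<and> C \<subseteq> (\<Union>\<tau>\<in>T. \<tau> ` std_simplex n) \<and>
     (\<forall>\<tau>\<in>T. \<forall>p\<in>\<tau> ` std_simplex n - C. \<exists>m. Suc m = n \<and>
        (\<exists>\<sigma>\<in>\<Phi> m. p \<in> \<sigma> ` std_simplex m \<and> \<sigma> ` std_simplex m \<inter> C = {}))"

text \<open>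
  A boundary point of \<open>\<tau>\<close> lies on a facet, and no facet meets the open simplex.
\<close>

lemma partial_cell_single:
  assumes \<tau>: "\<tau> \<in> \<Phi> n"
  shows "\<exists>h. partial_cell {\<tau>} (\<tau> ` osimplex n) h"
proof -
  obtain U f where U: "openin (Euclidean_space n) U" "std_simplex n \<subseteq> U" "smooth_embedding n n M \<A> U f"
    "\<And>x. x \<in> std_simplex n \<Longrightarrow> \<tau> x = f x" "inj_on f U"
    using simplex_extension[OF \<tau> order_refl] by metis
  let ?h = "inv_into U f"
  have eq: "\<tau> ` osimplex n = f ` osimplex n" using U(4) osimplex_subset by (intro image_cong) auto
  have oU: "osimplex n \<subseteq> U" using osimplex_subset U(2) by blast
  have "(\<tau> ` osimplex n, ?h) \<in> \<A>"
    using chart_restrict[OF S top_simplex_chart(1)[OF U(1,3)] open_top_simplex[OF \<tau>]] oU unfolding eq by blast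
  moreover have "?h ` \<tau> ` osimplex n = osimplex n"
    unfolding eq using U(5) oU by (simp add: inv_into_image_cancel)
  moreover have "\<exists>m. Suc m = n \<and> (\<exists>\<sigma>\<in>\<Phi> m. p \<in> \<sigma> ` std_simplex m \<and> \<sigma> ` std_simplex m \<inter> \<tau> ` osimplex n = {})"
    if p: "p \<in> \<tau> ` std_simplex n - \<tau> ` osimplex n" for p
  proof -
    obtain x where x: "x \<in> std_simplex n" "p = \<tau> x" "x \<notin> osimplex n" using p by blast
    from x(1) obtain m i y where m: "n = Suc m" "i \<le> n" "y \<in> std_simplex m" "x = face_map m i y"
      using x(3) by (cases rule: simplex_open_or_face) auto
    let ?\<sigma> = "restrict (\<tau> \<circ> face_map m i) (std_simplex m)"
    have \<sigma>: "?\<sigma> \<in> \<Phi> m" using face_simplex m \<tau> by auto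
    have "?\<sigma> ` std_simplex m \<inter> \<tau> ` osimplex n = {}"
    proof (rule ccontr)
      assume "\<not> ?thesis"
      then obtain q where "q \<in> ?\<sigma> ` std_simplex m" "q \<in> \<tau> ` osimplex n" by blast
      then obtain a b where ab: "a \<in> std_simplex m" "b \<in> osimplex n" "\<tau> b = ?\<sigma> a" by (elim imageE) simp
      then show False using open_simplex_meets_closed[OF \<tau> order_refl ab(2) \<sigma> _ ab(1)] m(1) by simp
    qed
    moreover have "p \<in> ?\<sigma> ` std_simplex m" using x m by (intro image_eqI[of _ _ y]) auto
    ultimately show ?thesis using \<sigma> m(1) by blast
  qed
  moreover have "\<tau> ` osimplex n \<subseteq> \<tau> ` std_simplex n" by (rule image_mono[OF osimplex_subset])
  ultimately have "partial_cell {\<tau>} (\<tau> ` osimplex n) ?h"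
    using \<tau> unfolding partial_cell_def by simp
  then show ?thesis by blast
qed

text \<open>
  The new simplex \<open>\<tau>\<close> does not meet \<open>C\<close>: its open part does not meet the closed simplices of \<open>T\<close>, and
  \<open>C\<close> is open.  So the facets of \<open>\<tau>\<close> other than the one that is crossed miss the enlarged cell, and they
  contain all points of \<open>\<tau>\<close> outside it.  For the points not in \<open>\<tau>\<close> the old facets still serve: such a
  facet could meet the enlarged cell only by being the crossed one, which is a subset of \<open>\<tau>\<close>.
\<close>

lemma partial_cell_extend:
  assumes g: "partial_cell T C h" and \<tau>0: "\<tau>0 \<in> T" and \<tau>: "\<tau> \<in> \<Phi> n - T" and n: "n = Suc m" and i: "i \<le> n" "i0 \<le> n"
    and facet: "restrict (\<tau>0 \<circ> face_map m i0) (std_simplex m) = restrict (\<tau> \<circ> face_map m i) (std_simplex m)"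
  shows "\<exists>C' h'. partial_cell (insert \<tau> T) C' h'"
proof -
  have T: "T \<subseteq> \<Phi> n" and Ch: "(C, h) \<in> \<A>" "h ` C = osimplex n" and TC: "\<And>\<tau>. \<tau> \<in> T \<Longrightarrow> \<tau> ` osimplex n \<subseteq> C"
    and CT: "C \<subseteq> (\<Union>\<tau>\<in>T. \<tau> ` std_simplex n)"
    and J: "\<And>\<tau> p. \<tau> \<in> T \<Longrightarrow> p \<in> \<tau> ` std_simplex n \<Longrightarrow> p \<notin> C \<Longrightarrow>
        \<exists>\<sigma>\<in>\<Phi> m. p \<in> \<sigma> ` std_simplex m \<and> \<sigma> ` std_simplex m \<inter> C = {}"
    using g n unfolding partial_cell_def by auto
  have Cop: "openin M C" using is_chartD(1)[OF smooth_structureD(1)[OF S Ch(1)]] .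
  have \<tau>': "\<tau> \<in> \<Phi> n" "\<tau> \<notin> T" using \<tau> by auto
  have "C \<inter> \<tau> ` osimplex n = {}"
  proof (rule ccontr)
    assume "C \<inter> \<tau> ` osimplex n \<noteq> {}"
    then obtain q \<tau>1 where q: "q \<in> \<tau> ` osimplex n" "\<tau>1 \<in> T" "q \<in> \<tau>1 ` std_simplex n" using CT by blast
    then obtain x y where "x \<in> osimplex n" "y \<in> std_simplex n" "\<tau> x = \<tau>1 y" by (elim imageE) simp
    then show False using open_simplex_meets_closed[OF \<tau>'(1) order_refl _ _ order_refl, of x \<tau>1 y] T \<tau>'(2) q(2) by blast
  qed
  then have C\<tau>: "C \<inter> \<tau> ` std_simplex n = {}"
    using open_meets_open_simplex[OF \<tau>'(1) Cop] by blast
  define F where "F = \<tau> ` face_map m i ` osimplex m"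
  define C' where "C' = C \<union> \<tau> ` osimplex n \<union> F"
  obtain h' where h': "(C', h') \<in> \<A>" "h' ` C' = osimplex n"
  proof -
    have "\<tau>0 \<in> \<Phi> n" "\<tau>0 \<noteq> \<tau>" using T \<tau>0 \<tau>'(2) by auto
    from grow_cell[OF n i this(1) \<tau>'(1) this(2) facet Ch(1) TC[OF \<tau>0] C\<tau>] show ?thesis
      using that unfolding C'_def F_def Ch(2) by blast
  qed
  let ?\<sigma>F = "restrict (\<tau> \<circ> face_map m i) (std_simplex m)"
  have im: "i \<le> Suc m" using i n by simp
  have \<sigma>F: "?\<sigma>F \<in> \<Phi> m" using face_simplex n i \<tau>' by auto
  have F_eq: "F = ?\<sigma>F ` osimplex m" unfolding F_def image_comp using osimplex_subset by (intro image_cong) auto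
  have FS: "F \<subseteq> \<tau> ` std_simplex n"
    using face_map_simplex[OF im] osimplex_subset n by (fastforce simp: F_def)
  have mn: "m \<le> n" using n by simp
  have J': "\<exists>\<sigma>\<in>\<Phi> m. p \<in> \<sigma> ` std_simplex m \<and> \<sigma> ` std_simplex m \<inter> C' = {}"
    if p: "\<tau>1 \<in> insert \<tau> T" "p \<in> \<tau>1 ` std_simplex n" "p \<notin> C'" for \<tau>1 p
  proof (cases "p \<in> \<tau> ` std_simplex n")
    case True
    then obtain x where x: "x \<in> std_simplex n" "p = \<tau> x" by blast
    have xb: "\<exists>j\<le>n. j \<noteq> i \<and> bary n j x = 0"
    proof (rule ccontr)
      assume none: "\<not> ?thesis"
      have "x \<notin> osimplex n" using x(2) p(3) by (auto simp: C'_def)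
      then have xi: "bary n i x = 0" using none x(1) by (auto simp: osimplex_def std_simplex_iff less_le simp del: bary_simps)
      then obtain y where y: "y \<in> ES m" "x = face_map m i y" "\<forall>k\<le>m. bary m k y = bary (Suc m) (skip i k) x"
        using bary_zero_imp_face[of x m i] x(1) im n by (auto simp: std_simplex_iff simp del: bary_simps)
      have "0 < bary m k y" if "k \<le> m" for k
        using y(3) that none x(1) skip_le[OF that, of i] skip_neq[of i k] n
        by (auto simp: std_simplex_iff less_le simp del: bary_simps)
      then have "y \<in> osimplex m" using y(1) by (simp add: osimplex_def del: bary_simps)
      then have "p \<in> F" using x y by (auto simp: F_def)
      then show False using p(3) by (simp add: C'_def)
    qed
    then obtain j where j: "j \<le> n" "j \<noteq> i" "bary n j x = 0" by blast
    have jm: "j \<le> Suc m" using j n by simp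
    obtain y where y: "y \<in> ES m" "x = face_map m j y" "\<forall>k\<le>m. bary m k y = bary (Suc m) (skip j k) x"
      using bary_zero_imp_face[of x m j] x(1) jm j(3) n by (auto simp: std_simplex_iff simp del: bary_simps)
    have ys: "y \<in> std_simplex m"
      using y x(1) skip_le[of _ m j] n by (auto simp: std_simplex_iff simp del: bary_simps)
    let ?\<sigma> = "restrict (\<tau> \<circ> face_map m j) (std_simplex m)"
    have \<sigma>: "?\<sigma> \<in> \<Phi> m" using face_simplex n j \<tau>' by auto
    have "p \<in> ?\<sigma> ` std_simplex m" using x y ys by (intro image_eqI[of _ _ y]) auto
    moreover have "?\<sigma> ` std_simplex m \<inter> C' = {}"
    proof (rule ccontr)
      assume "\<not> ?thesis"
      then obtain a where a: "a \<in> std_simplex m" "\<tau> (face_map m j a) \<in> C'" by auto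
      have as: "face_map m j a \<in> std_simplex n" using face_map_simplex[OF jm a(1)] n by simp
      have b0: "bary n j (face_map m j a) = 0" using bary_face_self[OF jm] n by simp
      have inj: "inj_on \<tau> (std_simplex n)" by (rule simplex_inj[OF \<tau>'(1) order_refl])
      have "\<tau> (face_map m j a) \<notin> C" using C\<tau> as by blast
      then consider w where "w \<in> osimplex n" "\<tau> (face_map m j a) = \<tau> w"
        | y where "y \<in> osimplex m" "\<tau> (face_map m j a) = \<tau> (face_map m i y)"
        using a(2) by (auto simp: C'_def F_def)
      then show False
      proof cases
        case 1
        then have "face_map m j a = w" using inj_onD[OF inj] as osimplex_subset by blast
        then show False using 1(1) b0 j(1) by (auto simp: osimplex_def simp del: bary_simps)
      next
        case 2
        have "face_map m i y \<in> std_simplex n" using face_map_simplex[OF im] 2(1) osimplex_subset n by blast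
        then have eq: "face_map m j a = face_map m i y" using inj_onD[OF inj, OF 2(2)] as by blast
        obtain k where "k \<le> m" "j = skip i k" using obtain_skip[OF jm j(2)] im by (metis not_le)
        then have "0 < bary n j (face_map m i y)"
          using bary_face_skip[OF im] 2(1) n by (auto simp: osimplex_def simp del: bary_simps)
        then show False using eq b0 by simp
      qed
    qed
    ultimately show ?thesis using \<sigma> by blast
  next
    case False
    then have "\<tau>1 \<in> T" using p by auto
    moreover have "p \<notin> C" using p(3) by (simp add: C'_def)
    ultimately obtain \<sigma> where \<sigma>: "\<sigma> \<in> \<Phi> m" "p \<in> \<sigma> ` std_simplex m" "\<sigma> ` std_simplex m \<inter> C = {}"
      using J p(2) by blast
    have "\<sigma> ` std_simplex m \<inter> \<tau> ` osimplex n = {}"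
    proof (rule ccontr)
      assume "\<not> ?thesis"
      then obtain q where "q \<in> \<sigma> ` std_simplex m" "q \<in> \<tau> ` osimplex n" by blast
      then obtain a b where ab: "a \<in> std_simplex m" "b \<in> osimplex n" "\<tau> b = \<sigma> a" by (elim imageE) simp
      then show False using open_simplex_meets_closed[OF \<tau>'(1) order_refl ab(2) \<sigma>(1) mn ab(1)] n by simp
    qed
    moreover have "\<sigma> ` std_simplex m \<inter> F = {}"
    proof (rule ccontr)
      assume "\<not> ?thesis"
      then obtain q where "q \<in> \<sigma> ` std_simplex m" "q \<in> ?\<sigma>F ` osimplex m" unfolding F_eq by blast
      then obtain a b where ab: "a \<in> std_simplex m" "b \<in> osimplex m" "?\<sigma>F b = \<sigma> a" by (elim imageE) simp
      then have "?\<sigma>F = \<sigma>" using open_simplex_meets_closed[OF \<sigma>F mn ab(2) \<sigma>(1) order_refl ab(1)] by simp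
      then have "p \<in> ?\<sigma>F ` std_simplex m" using \<sigma>(2) by simp
      then have "p \<in> \<tau> ` std_simplex n" using face_map_simplex[OF im] n by auto
      then show False using False by simp
    qed
    ultimately show ?thesis using \<sigma> unfolding C'_def by blast
  qed
  have "partial_cell (insert \<tau> T) C' h'"
    unfolding partial_cell_def
  proof (intro conjI ballI)
    show "insert \<tau> T \<subseteq> \<Phi> n" "(C', h') \<in> \<A>" "h' ` C' = osimplex n" using T \<tau>' h' by auto
    show "\<tau>1 ` osimplex n \<subseteq> C'" if "\<tau>1 \<in> insert \<tau> T" for \<tau>1
      using that TC by (auto simp: C'_def)
    have "\<tau> ` osimplex n \<subseteq> \<tau> ` std_simplex n" by (rule image_mono[OF osimplex_subset])
    then show "C' \<subseteq> (\<Union>\<tau>1\<in>insert \<tau> T. \<tau>1 ` std_simplex n)"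
      unfolding C'_def UN_insert
      by (intro Un_least le_supI2[OF CT] le_supI1[OF FS] le_supI1)
    show "\<exists>m. Suc m = n \<and> (\<exists>\<sigma>\<in>\<Phi> m. p \<in> \<sigma> ` std_simplex m \<and> \<sigma> ` std_simplex m \<inter> C' = {})"
      if "\<tau>1 \<in> insert \<tau> T" "p \<in> \<tau>1 ` std_simplex n - C'" for \<tau>1 p
    proof -
      have "p \<in> \<tau>1 ` std_simplex n" "p \<notin> C'" using that(2) by simp_all
      from J'[OF that(1) this] show ?thesis using n by (intro exI[of _ m] conjI) simp
    qed
  qed
  then show ?thesis by blast
qed

text \<open>
  Simplices are added until all are used; the complement of the cell is then the union of the facets
  that miss it.
\<close>

theorem cell_decomposition:
  assumes conn: "connected_space M" and ne: "topspace M \<noteq> {}"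
  shows "\<exists>C K. topspace M = C \<union> K \<and> C \<inter> K = {} \<and> cell n M \<A> C \<and>
           (\<exists>S. finite S \<and> (\<forall>s\<in>S. \<exists>l. Suc l = n \<and> s \<in> simplexes \<Phi> l) \<and> K = \<Union>S)"
proof -
  obtain \<tau>0 where \<tau>0: "\<tau>0 \<in> \<Phi> n" using ne top_simplices_cover by blast
  have fin: "finite (\<Phi> n)" by (rule finite_simplices) simp
  have "\<exists>T C h. partial_cell T C h \<and> T \<noteq> {} \<and> card T = Suc k" if "Suc k \<le> card (\<Phi> n)" for k
    using that
  proof (induction k)
    case 0
    then show ?case using partial_cell_single[OF \<tau>0] by (metis card.empty card_insert_disjoint empty_iff finite.emptyI insert_not_empty)
  next
    case (Suc k)
    then obtain T C h where g: "partial_cell T C h" "T \<noteq> {}" "card T = Suc k" by auto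
    have T: "T \<subseteq> \<Phi> n" using g(1) by (simp add: partial_cell_def)
    have "T \<noteq> \<Phi> n" using g(3) Suc.prems by auto
    from adjacent_simplex[OF conn T g(2) this] obtain \<tau>0 \<tau> m i i0 where
      *: "\<tau>0 \<in> T" "\<tau> \<in> \<Phi> n - T" "n = Suc m" "i \<le> n" "i0 \<le> n"
      "restrict (\<tau>0 \<circ> face_map m i0) (std_simplex m) = restrict (\<tau> \<circ> face_map m i) (std_simplex m)" by blast
    from partial_cell_extend[OF g(1) *] obtain C' h' where "partial_cell (insert \<tau> T) C' h'" by blast
    moreover have "card (insert \<tau> T) = Suc (Suc k)" using g(3) *(2) finite_subset[OF T fin] by simp
    ultimately show ?case by blast
  qed
  moreover have "card (\<Phi> n) \<noteq> 0" using \<tau>0 fin by auto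
  ultimately obtain T C h where g: "partial_cell T C h" "card T = card (\<Phi> n)"
    by (metis Suc_pred' order_refl neq0_conv)
  have "T \<subseteq> \<Phi> n" using g(1) by (simp add: partial_cell_def)
  then have T: "T = \<Phi> n" using g(2) fin by (simp add: card_subset_eq)
  have Ch: "(C, h) \<in> \<A>" "h ` C = osimplex n" using g(1) by (auto simp: partial_cell_def)
  note chart = smooth_structureD(1)[OF S Ch(1)]
  have CM: "C \<subseteq> topspace M" using is_chartD(1)[OF chart] openin_subset by blast
  have "homeomorphic_map (subtopology M C) (subtopology (Euclidean_space n) (osimplex n)) h"
    using chart Ch(2) by (simp add: is_chart_def)
  then have "subtopology M C homeomorphic_space Euclidean_space n"
    using osimplex_homeomorphic homeomorphic_space_trans homeomorphic_map_imp_homeomorphic_space by blast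
  then have cell: "cell n M \<A> C" using Ch(1) by (auto simp: cell_def)
  define SS where "SS = {s. \<exists>m. Suc m = n \<and> s \<in> simplexes \<Phi> m \<and> s \<inter> C = {}}"
  have "finite SS"
  proof (cases n)
    case (Suc m)
    have "SS \<subseteq> (\<lambda>\<phi>. \<phi> ` std_simplex m) ` \<Phi> m" using Suc by (auto simp: SS_def simplexes_def)
    then show ?thesis using finite_simplices[of m] Suc by (meson finite_imageI finite_subset le_Suc_eq order_refl)
  qed (simp add: SS_def)
  moreover have "topspace M - C = \<Union>SS"
  proof (intro equalityI subsetI)
    fix p assume p: "p \<in> topspace M - C"
    then obtain \<tau> where \<tau>: "\<tau> \<in> T" "p \<in> \<tau> ` std_simplex n - C" using top_simplices_cover T by blast
    moreover have "\<forall>\<tau>\<in>T. \<forall>p\<in>\<tau> ` std_simplex n - C. \<exists>m. Suc m = n \<and>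
        (\<exists>\<sigma>\<in>\<Phi> m. p \<in> \<sigma> ` std_simplex m \<and> \<sigma> ` std_simplex m \<inter> C = {})"
      using g(1) unfolding partial_cell_def by (elim conjE)
    ultimately obtain m \<sigma> where "Suc m = n" "\<sigma> \<in> \<Phi> m" "p \<in> \<sigma> ` std_simplex m" "\<sigma> ` std_simplex m \<inter> C = {}"
      by meson
    then show "p \<in> \<Union>SS" unfolding SS_def simplexes_def by blast
  next
    fix p assume "p \<in> \<Union>SS"
    then obtain m \<sigma> where "Suc m = n" "\<sigma> \<in> \<Phi> m" "p \<in> \<sigma> ` std_simplex m" "\<sigma> ` std_simplex m \<inter> C = {}"
      unfolding SS_def simplexes_def by blast
    then show "p \<in> topspace M - C" using simplex_in_topspace[of \<sigma> m] by auto
  qed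
  ultimately show ?thesis using cell CM
    by (intro exI[of _ C] exI[of _ "topspace M - C"]) (auto simp: SS_def intro!: exI[of _ SS])
qed

end

theorem theorem1:
  fixes n :: nat and M :: "'a topology" and \<A> :: "'a chart set"
    and \<Phi> :: "nat \<Rightarrow> ((nat \<Rightarrow> real) \<Rightarrow> 'a) set"
  assumes "smooth_manifold n M \<A>"
    and "topspace M \<noteq> {}" and "connected_space M" and "compact_space M"
    and "smooth_triangulation n M \<A> \<Phi>"
  shows "\<exists>C K. topspace M = C \<union> K \<and> C \<inter> K = {} \<and> cell n M \<A> C \<and>
           (\<exists>S. finite S \<and> (\<forall>s\<in>S. \<exists>l. Suc l = n \<and> s \<in> simplexes \<Phi> l) \<and> K = \<Union>S)"
proof -
  interpret triangulated_manifold n M \<A> \<Phi>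
    using assms(1,5) by unfold_locales (auto simp: smooth_manifold_def)
  show ?thesis by (rule cell_decomposition[OF assms(3,2)])
qed

end
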